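(* Suppose $p(n)n\to\infty$ and $p(n)^6n^5\to0$, and let $\Gamma\in G(n,p(n))$. Then asymptotically almost surely $\Gamma$ has a connected component $\Gamma'$ (the giant component) such that $W_{\Gamma'}$ is hyperbolic relative to a nonempty collection of proper subgroups, each isomorphic to $D_\infty\times D_\infty$. Consequently $W_\Gamma$ is a.a.s. hyperbolic relative to a nonempty collection of proper subgroups isomorphic to $D_\infty\times D_\infty$, at least one of which is not a proper free factor of $W_\Gamma$.
   Context: $G(n,p)$: random simplicial graphs on $n$ vertices with independent edges of probability $p$; a.a.s. means with probability tending to $1$ as $n\to\infty$. $W_\Gamma$ is the right-angled Coxeter group of $\Gamma$ (vertices are involution generators, adjacent vertices commute); for an induced subgraph $\Gamma'$, $W_{\Gamma'}$ is the subgroup generated by its vertices. $D_\infty$ is the infinite dihedral group. *)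

theory Defs
  imports "HOL-Algebra.Algebra"
begin

definition adj :: "'a set set \<Rightarrow> 'a \<Rightarrow> 'a \<Rightarrow> bool" where
  "adj E u v \<longleftrightarrow> u \<noteq> v \<and> {u, v} \<in> E"

definition walk :: "'a set set \<Rightarrow> 'a list \<Rightarrow> bool" where
  "walk E xs \<longleftrightarrow> xs \<noteq> [] \<and> (\<forall>i. Suc i < length xs \<longrightarrow> adj E (xs ! i) (xs ! Suc i))"

definition reachable :: "'a set set \<Rightarrow> 'a \<Rightarrow> 'a \<Rightarrow> bool" where
  "reachable E x y \<longleftrightarrow> (\<exists>xs. walk E xs \<and> hd xs = x \<and> last xs = y)"

definition components :: "'a set \<Rightarrow> 'a set set \<Rightarrow> 'a set set" where
  "components V E = {{y \<in> V. reachable E x y} | x. x \<in> V}"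

definition graph_dist :: "'a set set \<Rightarrow> 'a \<Rightarrow> 'a \<Rightarrow> nat" where
  "graph_dist E x y =
     (LEAST n. \<exists>xs. walk E xs \<and> hd xs = x \<and> last xs = y \<and> length xs = Suc n)"

definition connected_graph :: "'a set \<Rightarrow> 'a set set \<Rightarrow> bool" where
  "connected_graph V E \<longleftrightarrow> (\<forall>x\<in>V. \<forall>y\<in>V. reachable E x y)"

text \<open>Gromov hyperbolicity of the path metric (four-point condition on vertices).\<close>
definition hyperbolic_graph :: "'a set \<Rightarrow> 'a set set \<Rightarrow> bool" where
  "hyperbolic_graph V E \<longleftrightarrow> connected_graph V E \<and>
     (\<exists>\<delta>::real. \<forall>x\<in>V. \<forall>y\<in>V. \<forall>z\<in>V. \<forall>w\<in>V.
        real (graph_dist E x y) + real (graph_dist E z w)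
          \<le> max (real (graph_dist E x z) + real (graph_dist E y w))
                (real (graph_dist E x w) + real (graph_dist E y z)) + 2 * \<delta>)"

definition circuit :: "'a set set \<Rightarrow> 'a list \<Rightarrow> bool" where
  "circuit E xs \<longleftrightarrow> 3 \<le> length xs \<and> distinct xs \<and> walk E xs \<and> adj E (last xs) (hd xs)"

definition circuit_edges :: "'a list \<Rightarrow> 'a set set" where
  "circuit_edges xs = {{xs ! i, xs ! ((i + 1) mod length xs)} | i. i < length xs}"

definition fine_graph :: "'a set set \<Rightarrow> bool" where
  "fine_graph E \<longleftrightarrow>
     (\<forall>e\<in>E. \<forall>n. finite {xs. circuit E xs \<and> length xs = n \<and> e \<in> circuit_edges xs})"

section \<open>Relative hyperbolicity (Bowditch / Farb: coned-off Cayley graph fine and hyperbolic)\<close>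

definition coned_vertices :: "('g, 'b) monoid_scheme \<Rightarrow> 'g set set \<Rightarrow> ('g + 'g set) set" where
  "coned_vertices G \<P> =
     Inl ` carrier G \<union> Inr ` {g <#\<^bsub>G\<^esub> P | g P. g \<in> carrier G \<and> P \<in> \<P>}"

definition coned_edges ::
  "('g, 'b) monoid_scheme \<Rightarrow> 'g set \<Rightarrow> 'g set set \<Rightarrow> ('g + 'g set) set set" where
  "coned_edges G S \<P> =
     {{Inl g, Inl (g \<otimes>\<^bsub>G\<^esub> s)} | g s. g \<in> carrier G \<and> s \<in> S}
     \<union> {{Inl g, Inr (g <#\<^bsub>G\<^esub> P)} | g P. g \<in> carrier G \<and> P \<in> \<P>}"

definition rel_hyperbolic :: "('g, 'b) monoid_scheme \<Rightarrow> 'g set set \<Rightarrow> bool" where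
  "rel_hyperbolic G \<P> \<longleftrightarrow> finite \<P> \<and> (\<forall>P\<in>\<P>. subgroup P G) \<and>
     (\<exists>S. finite S \<and> S \<subseteq> carrier G \<and> generate G S = carrier G \<and>
          hyperbolic_graph (coned_vertices G \<P>) (coned_edges G S \<P>) \<and>
          fine_graph (coned_edges G S \<P>))"

definition internal_free_product :: "('g, 'b) monoid_scheme \<Rightarrow> 'g set \<Rightarrow> 'g set \<Rightarrow> bool" where
  "internal_free_product G H K \<longleftrightarrow> subgroup H G \<and> subgroup K G \<and>
     generate G (H \<union> K) = carrier G \<and>
     (\<forall>xs :: (bool \<times> 'g) list. xs \<noteq> [] \<longrightarrow>
        (\<forall>(b, g) \<in> set xs. g \<in> (if b then H else K) - {\<one>\<^bsub>G\<^esub>}) \<longrightarrow>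
        (\<forall>i. Suc i < length xs \<longrightarrow> fst (xs ! i) \<noteq> fst (xs ! Suc i)) \<longrightarrow>
        foldr (\<lambda>x acc. snd x \<otimes>\<^bsub>G\<^esub> acc) xs \<one>\<^bsub>G\<^esub> \<noteq> \<one>\<^bsub>G\<^esub>)"

definition proper_free_factor :: "('g, 'b) monoid_scheme \<Rightarrow> 'g set \<Rightarrow> bool" where
  "proper_free_factor G H \<longleftrightarrow> H \<noteq> carrier G \<and> (\<exists>K. internal_free_product G H K)"

definition racg_step :: "'a set set \<Rightarrow> 'a list \<Rightarrow> 'a list \<Rightarrow> bool" where
  "racg_step E xs ys \<longleftrightarrow>
     (\<exists>a b c. xs = a @ [c, c] @ b \<and> ys = a @ b) \<or>
     (\<exists>a b u v. adj E u v \<and> xs = a @ [u, v] @ b \<and> ys = a @ [v, u] @ b)"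

definition racg_rel :: "'a set \<Rightarrow> 'a set set \<Rightarrow> ('a list \<times> 'a list) set" where
  "racg_rel V E = {(xs, ys). xs \<in> lists V \<and> ys \<in> lists V \<and>
                     (\<lambda>x y. racg_step E x y \<or> racg_step E y x)\<^sup>*\<^sup>* xs ys}"

text \<open>W_Gamma = < V | v^2, [u,v] for u,v adjacent >, as words modulo the congruence.\<close>
definition RACG :: "'a set \<Rightarrow> 'a set set \<Rightarrow> 'a list set monoid" where
  "RACG V E = \<lparr>carrier = lists V // racg_rel V E,
               monoid.mult = (\<lambda>A B. Image (racg_rel V E) {(SOME a. a \<in> A) @ (SOME b. b \<in> B)}),
               one = Image (racg_rel V E) {[]}\<rparr>"

definition racg_gen :: "'a set \<Rightarrow> 'a set set \<Rightarrow> 'a \<Rightarrow> 'a list set" where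
  "racg_gen V E v = racg_rel V E `` {[v]}"

definition special_subgroup :: "'a set \<Rightarrow> 'a set set \<Rightarrow> 'a set \<Rightarrow> 'a list set monoid" where
  "special_subgroup V E C =
     (RACG V E)\<lparr>carrier := generate (RACG V E) (racg_gen V E ` C)\<rparr>"

text \<open>Infinite dihedral group: isometries x \<mapsto> (if s then -x else x) + k of the integers.\<close>
definition Dinf :: "(bool \<times> int) monoid" where
  "Dinf = \<lparr>carrier = UNIV,
           monoid.mult = (\<lambda>(s1, k1) (s2, k2). (s1 \<noteq> s2, (if s1 then - k2 else k2) + k1)),
           one = (False, 0)\<rparr>"

definition rel_hyp_DD :: "('g, 'b) monoid_scheme \<Rightarrow> 'g set set \<Rightarrow> bool" where
  "rel_hyp_DD G \<P> \<longleftrightarrow> \<P> \<noteq> {} \<and> rel_hyperbolic G \<P> \<and>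
     (\<forall>P\<in>\<P>. P \<noteq> carrier G \<and> G\<lparr>carrier := P\<rparr> \<cong> Dinf \<times>\<times> Dinf)"

definition pairs :: "nat \<Rightarrow> nat set set" where
  "pairs n = {{i, j} | i j. i < j \<and> j < n}"

definition gnp_prob :: "nat \<Rightarrow> real \<Rightarrow> (nat set set \<Rightarrow> bool) \<Rightarrow> real" where
  "gnp_prob n p Q =
     (\<Sum>E \<in> {E. E \<subseteq> pairs n \<and> Q E}. p ^ card E * (1 - p) ^ (card (pairs n) - card E))"

end

theory Submission
  imports Defs
begin

text \<open>
  Reflections of W are regarded as walls, and two group elements are compared through the set of walls separating
  them. This makes W a median graph in which walls carry labels from the graph, crossing walls having adjacent
  labels. Below the density threshold no vertex outside a 4-cycle has two neighbours on it and 4-cycles have no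
  chords. It follows that two walls that do not cross have at most one common crossing wall, unless the labels of
  all walls crossing both lie on one 4-cycle. Collapsing the cosets of the subgroups of 4-cycles, the
  coned-off distance is therefore additive along combinatorial geodesics up to a constant. By medians the four-point
  condition then reduces to boxes, where it is again a statement about families of mutually crossing walls.
  Fineness holds because two distinct cosets share boundedly many walls, and every wall crossed by a circuit is
  crossed at least twice. The parabolic subgroup of a chordless 4-cycle is a product of two infinite dihedral groups.

  A square in the giant component is adjacent to a further vertex, whose generator commutes with a nontrivial
  element of the square subgroup without belonging to it; a free factor contains the centralizers of its nontrivial
  elements.

  For the random graph, first moments exclude the forbidden subgraphs and sparse cuts; the second moment
  provides a square on half of the vertices, and one of its vertices is joined to the giant component
  of the other half by edges that are independent of both.
\<close>

section \<open>Words and reflections\<close>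

text \<open>A wall is a group element \<open>t\<close>, its two sides are membership and
  non-membership of \<open>t\<close> in \<open>N x\<close>, and the majority of three such sets is
  again of this form; geometry thus turns into Boolean conditions on inversion sets. The locale
  \<open>racg\<close> asks only for a group with the word problem of the presentation. Deleting
  letters shows that the subgroup of a component is an instance too, so one argument serves the
  component and the whole group. The exponents in the hypothesis are those of a 4-cycle with a
  further vertex joined to two of its vertices: 5 vertices and 6 edges, hence at most about
  \<open>n^5 p^6\<close> expected copies. The chorded 4-cycle, with 4 vertices and 5 edges,
  disappears with it as soon as \<open>n p\<close> is at least 1. That \<open>n p\<close> tends to
  infinity yields both the large component and the existence of 4-cycles. The delicate point is to
  place a 4-cycle inside the largest component: the graph need not be connected, and revealing the
  4-cycle or the component must not reveal the edges that are to join them.\<close>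

definition wprod :: "('g, 'b) monoid_scheme \<Rightarrow> ('v \<Rightarrow> 'g) \<Rightarrow> 'v list \<Rightarrow> 'g" where
  "wprod G s xs = foldr (\<lambda>v g. s v \<otimes>\<^bsub>G\<^esub> g) xs \<one>\<^bsub>G\<^esub>"

declare in_lists_conv_set [simp]

lemma adj_sym: "adj E u v \<longleftrightarrow> adj E v u"
  by (auto simp: adj_def insert_commute)

lemma adj_neq: "adj E u v \<Longrightarrow> u \<noteq> v"
  by (simp add: adj_def)

text \<open>Killing the generators outside \<open>P\<close> maps every relator to a relator or to
  the empty word. This is the retraction of the group onto a special subgroup, on the level of
  words.\<close>

lemma racg_step_filter:
  assumes "racg_step E xs ys"
  shows "filter P xs = filter P ys \<or> racg_step E (filter P xs) (filter P ys)"
proof -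
  from assms consider (c) a b c where "xs = a @ [c, c] @ b" "ys = a @ b"
    | (s) a b u v where "adj E u v" "xs = a @ [u, v] @ b" "ys = a @ [v, u] @ b"
    unfolding racg_step_def by blast
  then show ?thesis
  proof cases
    case c
    show ?thesis
    proof (cases "P c")
      case True
      then have "filter P xs = filter P a @ [c, c] @ filter P b" "filter P ys = filter P a @ filter P b"
        using c by auto
      then show ?thesis unfolding racg_step_def by blast
    qed (use c in auto)
  next
    case s
    show ?thesis
    proof (cases "P u \<and> P v")
      case True
      then have "filter P xs = filter P a @ [u, v] @ filter P b"
        "filter P ys = filter P a @ [v, u] @ filter P b"
        using s by auto
      then show ?thesis using s(1) unfolding racg_step_def by blast
    qed (use s in auto)
  qed
qed

lemma racg_rel_filter:
  assumes "(xs, ys) \<in> racg_rel V E"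
  shows "(filter (\<lambda>x. x \<in> C) xs, filter (\<lambda>x. x \<in> C) ys) \<in> racg_rel C E"
proof -
  let ?f = "filter (\<lambda>x. x \<in> C)"
  from assms have "(\<lambda>x y. racg_step E x y \<or> racg_step E y x)\<^sup>*\<^sup>* xs ys"
    by (simp add: racg_rel_def)
  then have "(\<lambda>x y. racg_step E x y \<or> racg_step E y x)\<^sup>*\<^sup>* (?f xs) (?f ys)"
  proof (induction rule: rtranclp_induct)
    case (step y z)
    then have "?f y = ?f z \<or> racg_step E (?f y) (?f z) \<or> racg_step E (?f z) (?f y)"
      using racg_step_filter by metis
    with step.IH show ?case by (metis (mono_tags, lifting) rtranclp.rtrancl_into_rtrancl)
  qed simp
  then show ?thesis by (auto simp: racg_rel_def)
qed

lemma filter_lists: "xs \<in> lists C \<Longrightarrow> filter (\<lambda>x. x \<in> C) xs = xs"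
  by (induction xs) auto

lemma racg_rel_restrict:
  assumes "xs \<in> lists C" "ys \<in> lists C" "C \<subseteq> V"
  shows "(xs, ys) \<in> racg_rel V E \<longleftrightarrow> (xs, ys) \<in> racg_rel C E"
proof
  assume "(xs, ys) \<in> racg_rel V E"
  from racg_rel_filter[OF this, of C] show "(xs, ys) \<in> racg_rel C E"
    using assms by (simp add: filter_lists)
next
  assume "(xs, ys) \<in> racg_rel C E"
  then show "(xs, ys) \<in> racg_rel V E"
    using assms by (auto simp: racg_rel_def)
qed

text \<open>The chain of steps behind \<open>racg_rel\<close> may pass through words that leave
  \<open>V\<close>. Filtering the whole chain brings it back, so \<open>f\<close> has to be
  invariant only on words over \<open>V\<close>.\<close>

lemma racg_rel_invariant:
  assumes rel: "(xs, ys) \<in> racg_rel V E"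
    and step: "\<And>xs ys. racg_step E xs ys \<Longrightarrow> xs \<in> lists V \<Longrightarrow> ys \<in> lists V \<Longrightarrow> f xs = f ys"
  shows "f xs = f ys"
proof -
  let ?f = "filter (\<lambda>x. x \<in> V)"
  from rel have "(\<lambda>x y. racg_step E x y \<or> racg_step E y x)\<^sup>*\<^sup>* xs ys"
    by (simp add: racg_rel_def)
  then have "f (?f xs) = f (?f ys)"
  proof (induction rule: rtranclp_induct)
    case (step y z)
    have l: "?f w \<in> lists V" for w by auto
    from step.hyps(2) have "?f y = ?f z \<or> racg_step E (?f y) (?f z) \<or> racg_step E (?f z) (?f y)"
      using racg_step_filter by metis
    then have "f (?f y) = f (?f z)" using assms(2) l by metis
    with step.IH show ?case by simp
  qed simp
  moreover have "xs \<in> lists V" "ys \<in> lists V" using rel by (auto simp: racg_rel_def)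
  ultimately show ?thesis by (simp add: filter_lists)
qed

text \<open>Only the four sides are prescribed; that such a 4-cycle is induced is a separate
  condition on the graph.\<close>

definition is_square :: "'v set set \<Rightarrow> 'v \<Rightarrow> 'v \<Rightarrow> 'v \<Rightarrow> 'v \<Rightarrow> bool" where
  "is_square E a b c d \<longleftrightarrow> distinct [a, b, c, d] \<and> adj E a b \<and> adj E b c \<and> adj E c d \<and> adj E d a"

definition squares :: "'v set \<Rightarrow> 'v set set \<Rightarrow> 'v set set" where
  "squares V E = {{a, b, c, d} | a b c d. is_square E a b c d \<and> {a, b, c, d} \<subseteq> V}"

text \<open>The group is described by its word problem and not by its carrier. The elements of the
  subgroup of a component are classes of words over a larger vertex set, and in this form that
  subgroup is still an instance.\<close>

locale racg = group G for G :: "('g, 'b) monoid_scheme" (structure) +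
  fixes V :: "'v set" and E :: "'v set set" and s :: "'v \<Rightarrow> 'g"
  assumes finV: "finite V"
    and s_closed [simp]: "v \<in> V \<Longrightarrow> s v \<in> carrier G"
    and word_problem: "xs \<in> lists V \<Longrightarrow> ys \<in> lists V \<Longrightarrow>
           wprod G s xs = wprod G s ys \<longleftrightarrow> (xs, ys) \<in> racg_rel V E"
    and word_exists: "g \<in> carrier G \<Longrightarrow> \<exists>xs\<in>lists V. g = wprod G s xs"
begin

abbreviation "wp \<equiv> wprod G s"

lemma wp_Nil [simp]: "wp [] = \<one>"
  and wp_Cons [simp]: "wp (v # xs) = s v \<otimes> wp xs"
  by (simp_all add: wprod_def)

lemma wp_closed [simp]: "xs \<in> lists V \<Longrightarrow> wp xs \<in> carrier G"
  by (induction xs) auto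

lemma wp_append: "xs \<in> lists V \<Longrightarrow> ys \<in> lists V \<Longrightarrow> wp (xs @ ys) = wp xs \<otimes> wp ys"
  by (induction xs) (auto simp: m_assoc)

lemma s_sq [simp]: assumes "v \<in> V" shows "s v \<otimes> s v = \<one>"
proof -
  have "racg_step E [v, v] []" unfolding racg_step_def by (metis append_Nil append_Nil2)
  then have "([v, v], []) \<in> racg_rel V E" using assms by (auto simp: racg_rel_def)
  then show ?thesis using word_problem[of "[v,v]" "[]"] assms by simp
qed

lemma s_sq_left [simp]: "v \<in> V \<Longrightarrow> g \<in> carrier G \<Longrightarrow> s v \<otimes> (s v \<otimes> g) = g"
  by (metis m_assoc s_closed s_sq l_one)

lemma inv_s [simp]: "v \<in> V \<Longrightarrow> inv (s v) = s v"
  by (metis inv_equality s_closed s_sq)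

lemma s_comm: assumes "adj E u v" "u \<in> V" "v \<in> V" shows "s u \<otimes> s v = s v \<otimes> s u"
proof -
  have "racg_step E [u, v] [v, u]" unfolding racg_step_def
    using assms(1) by (metis append_Nil append_Nil2)
  then have "([u, v], [v, u]) \<in> racg_rel V E" using assms by (auto simp: racg_rel_def)
  then show ?thesis using word_problem[of "[u,v]" "[v,u]"] assms by simp
qed

lemma wp_rev: "xs \<in> lists V \<Longrightarrow> wp (rev xs) = inv (wp xs)"
  by (induction xs) (auto simp: wp_append inv_mult_group)

section \<open>Conjugation, reflections of a word and inversion sets\<close>

definition cj :: "'g \<Rightarrow> 'g \<Rightarrow> 'g" where "cj g t = g \<otimes> t \<otimes> inv g"

lemma cj_closed [simp]: "g \<in> carrier G \<Longrightarrow> t \<in> carrier G \<Longrightarrow> cj g t \<in> carrier G"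
  by (simp add: cj_def)

lemma cj_one [simp]: "t \<in> carrier G \<Longrightarrow> cj \<one> t = t"
  by (simp add: cj_def)

lemma cj_mult: "g \<in> carrier G \<Longrightarrow> h \<in> carrier G \<Longrightarrow> t \<in> carrier G \<Longrightarrow>
    cj (g \<otimes> h) t = cj g (cj h t)"
  by (simp add: cj_def m_assoc inv_mult_group)

lemma cj_inv [simp]: "g \<in> carrier G \<Longrightarrow> t \<in> carrier G \<Longrightarrow> cj (inv g) (cj g t) = t"
  "g \<in> carrier G \<Longrightarrow> t \<in> carrier G \<Longrightarrow> cj g (cj (inv g) t) = t"
  by (simp_all flip: cj_mult)

lemma cj_eq_iff: "g \<in> carrier G \<Longrightarrow> t \<in> carrier G \<Longrightarrow> t' \<in> carrier G \<Longrightarrow>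
    cj g t = t' \<longleftrightarrow> t = cj (inv g) t'"
  by auto

lemma cj_s_adj: "adj E u v \<Longrightarrow> u \<in> V \<Longrightarrow> v \<in> V \<Longrightarrow> cj (s u) (s v) = s v"
  by (simp add: cj_def s_comm[of u v] m_assoc)

text \<open>The entry at position i is the letter there, conjugated by the prefix before it: the
  wall crossed by that edge of the path from the identity spelled by the word.\<close>

primrec refls :: "'v list \<Rightarrow> 'g list" where
  "refls [] = []"
| "refls (v # xs) = s v # map (cj (s v)) (refls xs)"

lemma refls_closed: "xs \<in> lists V \<Longrightarrow> set (refls xs) \<subseteq> carrier G"
  by (induction xs) auto

lemma length_refls [simp]: "length (refls xs) = length xs"
  by (induction xs) auto

lemma nth_refls_closed: "xs \<in> lists V \<Longrightarrow> i < length xs \<Longrightarrow> refls xs ! i \<in> carrier G"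
  using refls_closed[of xs] nth_mem[of i "refls xs"] by auto

lemma refls_append: "xs \<in> lists V \<Longrightarrow> ys \<in> lists V \<Longrightarrow>
    refls (xs @ ys) = refls xs @ map (cj (wp xs)) (refls ys)"
proof (induction xs)
  case Nil
  have "map (cj \<one>) (refls ys) = map id (refls ys)"
    using refls_closed[OF Nil(2)] by (intro map_cong) auto
  then show ?case by simp
next
  case (Cons v xs)
  have "map (cj (s v \<otimes> wp xs)) (refls ys) = map (cj (s v) \<circ> cj (wp xs)) (refls ys)"
    using refls_closed[OF Cons.prems(2)] Cons.prems(1) by (intro map_cong) (auto simp: cj_mult)
  then show ?case using Cons by auto
qed

lemma count_map_cj:
  assumes "g \<in> carrier G" "t \<in> carrier G" "set ts \<subseteq> carrier G"
  shows "count_list (map (cj g) ts) t = count_list ts (cj (inv g) t)"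
  using assms(3)
proof (induction ts)
  case (Cons a ts)
  then show ?case using assms(1,2) by (auto simp: cj_eq_iff)
qed simp

text \<open>A cancelled pair contributes the same reflection twice, and a commuting pair contributes
  the same two reflections in either order. Behind the changed place nothing moves, because the
  prefix has the same product.\<close>

lemma refl_parity_step:
  assumes st: "racg_step E xs ys" and l: "xs \<in> lists V" "ys \<in> lists V" and t: "t \<in> carrier G"
  shows "odd (count_list (refls xs) t) = odd (count_list (refls ys) t)"
proof -
  from st consider (c) a b c where "xs = a @ [c, c] @ b" "ys = a @ b"
    | (sw) a b u v where "adj E u v" "xs = a @ [u, v] @ b" "ys = a @ [v, u] @ b"
    unfolding racg_step_def by blast
  then show ?thesis
  proof cases
    case c
    have L: "a \<in> lists V" "b \<in> lists V" "c \<in> V" using c l by auto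
    have "wp (a @ [c, c]) = wp a" using L by (simp add: wp_append)
    then have "refls xs = refls (a @ [c, c]) @ map (cj (wp a)) (refls b)"
      using refls_append[of "a @ [c, c]" b] L c by simp
    also have "refls (a @ [c, c]) = refls a @ [cj (wp a) (s c), cj (wp a) (s c)]"
      using refls_append[of a "[c, c]"] L by (simp add: cj_def)
    finally show ?thesis using c refls_append[of a b] L by simp
  next
    case sw
    have L: "a \<in> lists V" "b \<in> lists V" "u \<in> V" "v \<in> V" using sw l by auto
    have "wp (a @ [u, v]) = wp (a @ [v, u])" using L sw by (simp add: wp_append s_comm[of u v])
    then have "refls xs = refls (a @ [u, v]) @ map (cj (wp (a @ [u, v]))) (refls b)"
      "refls ys = refls (a @ [v, u]) @ map (cj (wp (a @ [u, v]))) (refls b)"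
      using refls_append[of "a @ [u, v]" b] refls_append[of "a @ [v, u]" b] L sw by simp_all
    moreover have "refls (a @ [u, v]) = refls a @ [cj (wp a) (s u), cj (wp a) (s v)]"
      "refls (a @ [v, u]) = refls a @ [cj (wp a) (s v), cj (wp a) (s u)]"
      using refls_append[of a "[u, v]"] refls_append[of a "[v, u]"] L sw
      by (simp_all add: cj_s_adj adj_sym)
    ultimately show ?thesis by simp
  qed
qed

text \<open>The inversion set: the reflections (walls) that separate the identity from g. A wall occurs an odd number of
  times among the reflections of a word for g iff it separates, whichever word is chosen.\<close>

definition N :: "'g \<Rightarrow> 'g set" where
  "N g = {t \<in> carrier G. odd (count_list (refls (SOME xs. xs \<in> lists V \<and> wp xs = g)) t)}"

lemma N_word:
  assumes "xs \<in> lists V"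
  shows "N (wp xs) = {t \<in> carrier G. odd (count_list (refls xs) t)}"
proof -
  define ys where "ys = (SOME ys. ys \<in> lists V \<and> wp ys = wp xs)"
  have ys: "ys \<in> lists V \<and> wp ys = wp xs"
    unfolding ys_def by (rule someI[of _ xs]) (use assms in auto)
  then have rel: "(ys, xs) \<in> racg_rel V E" using word_problem assms by blast
  have "odd (count_list (refls ys) t) = odd (count_list (refls xs) t)" if "t \<in> carrier G" for t
    by (rule racg_rel_invariant[OF rel, of "\<lambda>xs. odd (count_list (refls xs) t)"])
      (rule refl_parity_step[OF _ _ _ that])
  then show ?thesis unfolding N_def ys_def[symmetric] by auto
qed

lemma N_closed: "t \<in> N g \<Longrightarrow> t \<in> carrier G"
  by (auto simp: N_def)

lemma N_one [simp]: "N \<one> = {}"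
  using N_word[of "[]"] by simp

lemma N_s [simp]: assumes v: "v \<in> V" shows "N (s v) = {s v}"
proof -
  have "N (s v) = {t \<in> carrier G. odd (count_list [s v] t)}"
    using N_word[of "[v]"] v by simp
  also have "\<dots> = {s v}" using s_closed[OF v] by auto
  finally show ?thesis .
qed

text \<open>The cocycle identity: the reflections of a concatenation are those of the first word
  followed by conjugates of those of the second, and parities add.\<close>

lemma N_mult:
  assumes "g \<in> carrier G" "h \<in> carrier G" "t \<in> carrier G"
  shows "t \<in> N (g \<otimes> h) \<longleftrightarrow> ((t \<in> N g) \<noteq> (cj (inv g) t \<in> N h))"
proof -
  from assms obtain xs ys where w: "xs \<in> lists V" "g = wp xs" "ys \<in> lists V" "h = wp ys"
    by (meson word_exists)
  then have gh: "g \<otimes> h = wp (xs @ ys)" by (simp add: wp_append)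
  have l: "xs @ ys \<in> lists V" using w(1,3) by auto
  have c: "count_list (refls (xs @ ys)) t = count_list (refls xs) t + count_list (refls ys) (cj (inv g) t)"
    using refls_append[OF w(1,3)] count_map_cj[OF assms(1,3) refls_closed[OF w(3)]] w(2) by simp
  have 1: "t \<in> N (g \<otimes> h) \<longleftrightarrow> odd (count_list (refls (xs @ ys)) t)"
    unfolding gh N_word[OF l] using assms(3) by simp
  have 2: "t \<in> N g \<longleftrightarrow> odd (count_list (refls xs) t)"
    unfolding w(2) N_word[OF w(1)] using assms(3) by simp
  have "cj (inv g) t \<in> carrier G" using assms by simp
  then have 3: "cj (inv g) t \<in> N h \<longleftrightarrow> odd (count_list (refls ys) (cj (inv g) t))"
    unfolding w(4) N_word[OF w(3)] by simp
  show ?thesis unfolding 1 2 3 c by simp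
qed

text \<open>The reflection is the letter conjugated by its prefix, so multiplication from the left
  cancels exactly this letter. This is the exchange mechanism of Coxeter groups.\<close>

lemma refl_delete:
  assumes "xs \<in> lists V" "i < length xs"
  shows "refls xs ! i \<otimes> wp xs = wp (take i xs @ drop (Suc i) xs)"
  using assms
proof (induction xs arbitrary: i rule: list.induct)
  case (Cons v xs)
  show ?case
  proof (cases i)
    case (Suc j)
    have v: "v \<in> V" "xs \<in> lists V" using Cons.prems by auto
    have c: "refls xs ! j \<in> carrier G" using nth_refls_closed[OF v(2)] Cons.prems Suc by simp
    have "cj (s v) (refls xs ! j) \<otimes> (s v \<otimes> wp xs) = s v \<otimes> (refls xs ! j \<otimes> wp xs)"
      using c v by (simp add: cj_def m_assoc)
    then show ?thesis using Cons Suc by simp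
  qed (use Cons in simp)
qed simp

lemma refls_take: "refls (take i xs) = take i (refls xs)"
  by (induction xs arbitrary: i) (auto simp: take_Cons take_map split: nat.split)

lemma refl_square:
  assumes "xs \<in> lists V" "i < length xs"
  shows "refls xs ! i \<otimes> refls xs ! i = \<one>"
  using assms
proof (induction xs arbitrary: i rule: list.induct)
  case (Cons v xs)
  show ?case
  proof (cases i)
    case (Suc j)
    have v: "v \<in> V" "xs \<in> lists V" using Cons.prems by auto
    have c: "refls xs ! j \<in> carrier G" using nth_refls_closed[OF v(2)] Cons.prems Suc by simp
    have sq: "refls xs ! j \<otimes> refls xs ! j = \<one>" using Cons Suc v by simp
    have "cj (s v) (refls xs ! j) \<otimes> cj (s v) (refls xs ! j)
        = s v \<otimes> (refls xs ! j \<otimes> refls xs ! j) \<otimes> s v"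
      using c v by (simp add: cj_def m_assoc)
    then show ?thesis using Cons Suc sq v by simp
  qed (use Cons in simp)
qed simp

lemma delete_two:
  assumes xs: "xs \<in> lists V" and nd: "\<not> distinct (refls xs)"
  shows "\<exists>ys\<in>lists V. wp ys = wp xs \<and> set ys \<subseteq> set xs \<and> length ys < length xs"
proof -
  obtain i j where ij: "i < j" "j < length xs" "refls xs ! i = refls xs ! j"
    using nd by (metis distinct_conv_nth length_refls nat_neq_iff)
  define ys where "ys = take j xs @ drop (Suc j) xs"
  define zs where "zs = take i ys @ drop (Suc i) ys"
  have "set ys \<subseteq> set xs" unfolding ys_def by (auto dest: in_set_takeD in_set_dropD)
  then have ys: "ys \<in> lists V" "set ys \<subseteq> set xs" using xs by auto
  have "set zs \<subseteq> set ys" unfolding zs_def by (auto dest: in_set_takeD in_set_dropD)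
  then have zs: "zs \<in> lists V" "set zs \<subseteq> set xs" using ys by auto
  have il: "i < length ys" using ij by (simp add: ys_def)
  \<comment> \<open>A reflection depends only on the letters up to its own place, so removing the
    later letter \<open>j\<close> first leaves the one at \<open>i\<close> unchanged and it can be
    used again.\<close>
  have "take (Suc i) ys = take (Suc i) xs" using ij by (simp add: ys_def min_def)
  then have "take (Suc i) (refls ys) = take (Suc i) (refls xs)"
    by (simp flip: refls_take)
  then have "refls ys ! i = refls xs ! i"
    using nth_take[of i "Suc i" "refls ys"] nth_take[of i "Suc i" "refls xs"] by simp
  then have "refls xs ! i \<otimes> (refls xs ! i \<otimes> wp xs) = wp zs"
    using refl_delete[OF xs, of j] refl_delete[OF ys(1) il] ij by (simp add: ys_def zs_def)
  moreover have "refls xs ! i \<in> carrier G" using ij xs refls_closed[OF xs] nth_mem[of i "refls xs"] by auto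
  moreover have "refls xs ! i \<otimes> refls xs ! i = \<one>" using refl_square[OF xs] ij by simp
  ultimately have "wp zs = wp xs" using m_assoc[of "refls xs ! i" "refls xs ! i" "wp xs"] wp_closed[OF xs] l_one[OF wp_closed[OF xs]] by (simp del: wp_closed)
  moreover have "length zs < length ys" "length ys < length xs" using il ij unfolding zs_def ys_def by simp_all
  ultimately show ?thesis using zs by (intro bexI[of _ zs]) simp_all
qed

lemma N_eq_refls:
  assumes "xs \<in> lists V" "distinct (refls xs)"
  shows "N (wp xs) = set (refls xs)" "card (N (wp xs)) = length xs"
proof -
  have "count_list (refls xs) t = (if t \<in> set (refls xs) then 1 else 0)" for t
    using assms(2) by (induction ("refls xs")) auto
  then show N: "N (wp xs) = set (refls xs)"
    using N_word[OF assms(1)] refls_closed[OF assms(1)] by (auto split: if_splits)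
  then show "card (N (wp xs)) = length xs" using assms(2) by (simp add: distinct_card)
qed

text \<open>Keeping to the letters of the given word is what provides elements of a parabolic
  subgroup with reduced words inside that subgroup.\<close>

lemma reduced_exists_subset:
  assumes "xs \<in> lists V"
  shows "\<exists>ys\<in>lists V. wp ys = wp xs \<and> set ys \<subseteq> set xs \<and> length ys \<le> length xs \<and> distinct (refls ys)"
  using assms
proof (induction "length xs" arbitrary: xs rule: less_induct)
  case less
  show ?case
  proof (cases "distinct (refls xs)")
    case False
    obtain ys where ys: "ys \<in> lists V" "wp ys = wp xs" "set ys \<subseteq> set xs" "length ys < length xs"
      using delete_two[OF less.prems False] by auto
    from less.hyps[OF ys(4,1)] obtain zs where "zs\<in>lists V" "wp zs = wp ys" "set zs \<subseteq> set ys"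
       "length zs \<le> length ys" "distinct (refls zs)" by auto
    then show ?thesis using ys by (intro bexI[of _ zs]) auto
  qed (use less in \<open>auto intro!: bexI[of _ xs]\<close>)
qed

lemma reduced_exists:
  assumes "g \<in> carrier G"
  obtains xs where "xs \<in> lists V" "g = wp xs" "distinct (refls xs)" "N g = set (refls xs)" "card (N g) = length xs"
proof -
  obtain xs where xs: "xs \<in> lists V" "g = wp xs" using word_exists[OF assms] by auto
  obtain ys where "ys \<in> lists V" "wp ys = wp xs" "distinct (refls ys)"
    using reduced_exists_subset[OF xs(1)] by auto
  then show thesis using that[of ys] N_eq_refls[of ys] xs by simp
qed

lemma finite_N [simp]: "g \<in> carrier G \<Longrightarrow> finite (N g)"
  by (erule reduced_exists) simp

lemma card_N_le: "xs \<in> lists V \<Longrightarrow> card (N (wp xs)) \<le> length xs"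
  using reduced_exists_subset[of xs] N_eq_refls(2) by fastforce

lemma card_N_refl_less:
  assumes "g \<in> carrier G" "r \<in> N g"
  shows "card (N (r \<otimes> g)) < card (N g)"
proof -
  obtain xs where xs: "xs \<in> lists V" "g = wp xs" "distinct (refls xs)" "N g = set (refls xs)" "card (N g) = length xs"
    using reduced_exists[OF assms(1)] .
  obtain i where i: "i < length xs" "refls xs ! i = r" using assms(2) xs by (metis in_set_conv_nth length_refls)
  define ys where "ys = take i xs @ drop (Suc i) xs"
  have "r \<otimes> g = wp ys" using refl_delete[OF xs(1) i(1)] i xs by (simp add: ys_def)
  moreover have "ys \<in> lists V" using xs unfolding ys_def by (auto dest!: in_set_takeD in_set_dropD)
  moreover have "length ys < length xs" using i by (simp add: ys_def)
  ultimately show ?thesis using card_N_le[of ys] xs by simp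
qed

lemma N_eq_empty: "g \<in> carrier G \<Longrightarrow> N g = {} \<longleftrightarrow> g = \<one>"
  by (erule reduced_exists) auto

section \<open>Walls separating two elements, and geodesics\<close>

definition H :: "'g \<Rightarrow> 'g \<Rightarrow> 'g set" where
  "H x y = {t. (t \<in> N x) \<noteq> (t \<in> N y)}"

lemma in_H: "t \<in> H x y \<longleftrightarrow> (t \<in> N x) \<noteq> (t \<in> N y)"
  by (simp add: H_def)

lemma H_sym: "H x y = H y x"
  by (auto simp: H_def)

lemma H_self [simp]: "H x x = {}"
  by (auto simp: H_def)

lemma H_one [simp]: "H \<one> x = N x"
  by (auto simp: H_def)

lemma H_triangle: "H x z \<subseteq> H x y \<union> H y z"
  by (auto simp: H_def)

lemma H_carrier: "t \<in> H x y \<Longrightarrow> t \<in> carrier G"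
  using N_closed by (auto simp: H_def)

lemma finite_H [simp]: "x \<in> carrier G \<Longrightarrow> y \<in> carrier G \<Longrightarrow> finite (H x y)"
  by (rule finite_subset[of _ "N x \<union> N y"]) (auto simp: H_def)

lemma H_mult:
  assumes "g \<in> carrier G" "x \<in> carrier G" "y \<in> carrier G" "t \<in> carrier G"
  shows "t \<in> H (g \<otimes> x) (g \<otimes> y) \<longleftrightarrow> cj (inv g) t \<in> H x y"
  using N_mult[OF assms(1,2,4)] N_mult[OF assms(1,3,4)] by (auto simp: in_H)

lemma mult_inv_cancel [simp]: "x \<in> carrier G \<Longrightarrow> y \<in> carrier G \<Longrightarrow> x \<otimes> (inv x \<otimes> y) = y"
  by (simp flip: m_assoc)

lemma mult_inv_cancel' [simp]: "x \<in> carrier G \<Longrightarrow> y \<in> carrier G \<Longrightarrow> inv x \<otimes> (x \<otimes> y) = y"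
  by (simp flip: m_assoc)

lemma H_N:
  assumes "x \<in> carrier G" "y \<in> carrier G" "t \<in> carrier G"
  shows "t \<in> H x y \<longleftrightarrow> cj (inv x) t \<in> N (inv x \<otimes> y)"
  using H_mult[of x \<one> "inv x \<otimes> y" t] assms by simp

lemma cj_in_H:
  assumes "x \<in> carrier G" "y \<in> carrier G" "t \<in> carrier G"
  shows "cj x t \<in> H x y \<longleftrightarrow> t \<in> N (inv x \<otimes> y)"
  using H_N[of x y "cj x t"] assms by simp

lemma H_eq_empty:
  assumes "x \<in> carrier G" "y \<in> carrier G"
  shows "H x y = {} \<longleftrightarrow> x = y"
proof
  assume "H x y = {}"
  then have "N (inv x \<otimes> y) = {}" using cj_in_H[OF assms] N_closed by blast
  then have "inv x \<otimes> y = \<one>" using assms N_eq_empty by simp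
  then show "x = y" using assms mult_inv_cancel[OF assms] by simp
qed simp

lemma H_edge:
  assumes "x \<in> carrier G" "v \<in> V"
  shows "H x (x \<otimes> s v) = {cj x (s v)}"
proof -
  have "t \<in> H x (x \<otimes> s v) \<longleftrightarrow> t = cj x (s v)" if "t \<in> carrier G" for t
    using H_N[of x "x \<otimes> s v" t] assms that by (auto simp: cj_eq_iff)
  moreover have "cj x (s v) \<in> carrier G" using assms by simp
  ultimately show ?thesis using H_carrier[of _ x "x \<otimes> s v"] by blast
qed

text \<open>The first letter of a reduced word for \<open>inv x \<otimes> y\<close> is the first
  step of a geodesic: its wall is removed from the separating walls and no other is added.\<close>

lemma geo_step:
  assumes "x \<in> carrier G" "y \<in> carrier G" "x \<noteq> y"
  shows "\<exists>v\<in>V. cj x (s v) \<in> H x y \<and> H (x \<otimes> s v) y = H x y - {cj x (s v)}"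
proof -
  obtain xs where xs: "xs \<in> lists V" "inv x \<otimes> y = wp xs" "N (inv x \<otimes> y) = set (refls xs)"
    by (rule reduced_exists[of "inv x \<otimes> y"]) (use assms in auto)
  obtain t where t: "t \<in> H x y" using H_eq_empty[OF assms(1,2)] assms(3) by auto
  then have "cj (inv x) t \<in> set (refls xs)" using H_N[OF assms(1,2) H_carrier[OF t]] xs(3) by simp
  then have "xs \<noteq> []" by auto
  then obtain v ys where v: "xs = v # ys" by (cases xs) auto
  then have vV: "v \<in> V" using xs by auto
  then have "cj x (s v) \<in> H x y" using cj_in_H[of x y "s v"] xs v assms by simp
  moreover have "H (x \<otimes> s v) y = H x y - {cj x (s v)}"
  proof (rule Set.set_eqI)
    fix t
    have "t \<in> H x (x \<otimes> s v) \<longleftrightarrow> t = cj x (s v)" using H_edge[OF assms(1) vV] by simp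
    then show "t \<in> H (x \<otimes> s v) y \<longleftrightarrow> t \<in> H x y - {cj x (s v)}"
      using calculation unfolding in_H Diff_iff singleton_iff by metis
  qed
  ultimately show ?thesis using vV by blast
qed

lemma geo_induct [consumes 2, case_names base step]:
  assumes x: "x \<in> carrier G" and y: "y \<in> carrier G" and base: "P y"
    and step: "\<And>x v. x \<in> carrier G \<Longrightarrow> v \<in> V \<Longrightarrow> cj x (s v) \<in> H x y \<Longrightarrow>
       H (x \<otimes> s v) y = H x y - {cj x (s v)} \<Longrightarrow> P (x \<otimes> s v) \<Longrightarrow> P x"
  shows "P x"
  using x
proof (induction "card (H x y)" arbitrary: x rule: less_induct)
  case less
  show ?case
  proof (cases "x = y")
    case False
    obtain v where v: "v \<in> V" "cj x (s v) \<in> H x y" "H (x \<otimes> s v) y = H x y - {cj x (s v)}"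
      using geo_step[OF less.prems y False] by auto
    have "card (H (x \<otimes> s v) y) < card (H x y)"
      using v(2,3) less.prems y psubset_card_mono[of "H x y" "H x y - {cj x (s v)}"] by auto
    then have "P (x \<otimes> s v)" using less v by simp
    then show ?thesis using step less.prems v by blast
  qed (use base in simp)
qed

text \<open>The label of a wall is well defined because each relator of the group contains every letter an even number of times.\<close>

lemma parity_step: "racg_step E xs ys \<Longrightarrow> even (count_list xs v) = even (count_list ys v)"
  unfolding racg_step_def by auto

lemma parity:
  assumes "xs \<in> lists V" "ys \<in> lists V" "wp xs = wp ys"
  shows "even (count_list xs v) = even (count_list ys v)"
proof -
  have "(xs, ys) \<in> racg_rel V E" using word_problem assms by blast
  then show ?thesis
    by (rule racg_rel_invariant[of _ _ _ _ "\<lambda>xs. even (count_list xs v)"]) (rule parity_step)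
qed

lemma label_unique:
  assumes "g \<in> carrier G" "h \<in> carrier G" "u \<in> V" "v \<in> V" "cj g (s u) = cj h (s v)"
  shows "u = v"
proof -
  obtain xs ys where w: "xs \<in> lists V" "g = wp xs" "ys \<in> lists V" "h = wp ys"
    using word_exists[OF assms(1)] word_exists[OF assms(2)] by auto
  have l: "xs @ [u] @ rev xs \<in> lists V" "ys @ [v] @ rev ys \<in> lists V" using w assms by auto
  have r: "rev xs \<in> lists V" "rev ys \<in> lists V" using w by auto
  have "wp (xs @ [u] @ rev xs) = cj g (s u)" "wp (ys @ [v] @ rev ys) = cj h (s v)"
    using w assms r by (simp_all add: wp_append wp_rev cj_def m_assoc)
  then have eq: "wp (xs @ [u] @ rev xs) = wp (ys @ [v] @ rev ys)" using assms(5) by metis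
  \<comment> \<open>The outer parts of a conjugate contribute every letter twice, so the parity of
    \<open>u\<close> reads off the middle letter.\<close>
  have "even (count_list (xs @ [u] @ rev xs) u) = even (count_list (ys @ [v] @ rev ys) u)"
    by (rule parity[OF l eq])
  moreover have "count_list (rev zs) c = count_list zs c" for zs :: "'v list" and c
    by (induction zs) auto
  ultimately show ?thesis by (auto split: if_splits)
qed

definition lab :: "'g \<Rightarrow> 'v" where
  "lab t = (THE v. v \<in> V \<and> (\<exists>g\<in>carrier G. t = cj g (s v)))"

lemma lab_cj [simp]:
  assumes "g \<in> carrier G" "v \<in> V" shows "lab (cj g (s v)) = v"
  unfolding lab_def using assms label_unique by (intro the_equality) blast+

lemma refls_form:
  assumes "xs \<in> lists V" "t \<in> set (refls xs)"
  shows "\<exists>g\<in>carrier G. \<exists>v\<in>set xs. t = cj g (s v)"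
  using assms
proof (induction xs arbitrary: t rule: list.induct)
  case (Cons a xs)
  then have a: "a \<in> V" "xs \<in> lists V" by auto
  from Cons.prems consider "t = s a" | r where "r \<in> set (refls xs)" "t = cj (s a) r" by auto
  then show ?case
  proof cases
    case 1
    then have "t = cj \<one> (s a)" using a by simp
    then show ?thesis by auto
  next
    case 2
    obtain g v where g: "g \<in> carrier G" "v \<in> set xs" "r = cj g (s v)" using Cons.IH[OF a(2) 2(1)] by auto
    then have "v \<in> V" using a by auto
    then have "t = cj (s a \<otimes> g) (s v)" using 2 g a by (simp add: cj_mult)
    then show ?thesis using g a by auto
  qed
qed simp

lemma N_form:
  assumes "g \<in> carrier G" "t \<in> N g"
  shows "\<exists>h\<in>carrier G. \<exists>v\<in>V. t = cj h (s v)"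
proof -
  obtain xs where xs: "xs \<in> lists V" "g = wp xs" "N g = set (refls xs)"
    by (rule reduced_exists[OF assms(1)])
  then show ?thesis using refls_form[OF xs(1), of t] assms(2) by auto
qed

lemma lab_in_V:
  assumes "x \<in> carrier G" "y \<in> carrier G" "t \<in> H x y" shows "lab t \<in> V"
  using assms N_form[of x t] N_form[of y t] by (auto simp: in_H)

section \<open>Parabolic subgroups\<close>

definition parab :: "'v set \<Rightarrow> 'g set" where "parab J = wp ` lists J"

lemma parab_one: "\<one> \<in> parab J"
  unfolding parab_def by (rule image_eqI[of _ _ "[]"]) auto

lemma parab_mult_s:
  assumes "v \<in> J" "g \<in> parab J" shows "s v \<otimes> g \<in> parab J"
proof -
  obtain xs where "xs \<in> lists J" "g = wp xs" using assms by (auto simp: parab_def)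
  then show ?thesis unfolding parab_def using assms by (intro image_eqI[of _ _ "v # xs"]) auto
qed

lemma parab_carrier: "J \<subseteq> V \<Longrightarrow> parab J \<subseteq> carrier G"
  unfolding parab_def by (auto intro!: wp_closed)

lemma parab_subgroup:
  assumes "J \<subseteq> V" shows "subgroup (parab J) G"
proof (rule subgroupI)
  show "parab J \<subseteq> carrier G" by (rule parab_carrier[OF assms])
  show "parab J \<noteq> {}" using parab_one by auto
  have LV: "xs \<in> lists J \<Longrightarrow> xs \<in> lists V" for xs using assms by auto
  show "inv a \<in> parab J" if a: "a \<in> parab J" for a
  proof -
    obtain xs where "xs \<in> lists J" "a = wp xs" using a by (auto simp: parab_def)
    then show ?thesis unfolding parab_def using LV by (intro image_eqI[of _ _ "rev xs"]) (auto simp: wp_rev)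
  qed
  show "a \<otimes> b \<in> parab J" if ab: "a \<in> parab J" "b \<in> parab J" for a b
  proof -
    obtain xs ys where "xs \<in> lists J" "a = wp xs" "ys \<in> lists J" "b = wp ys" using ab by (auto simp: parab_def)
    then show ?thesis unfolding parab_def using LV by (intro image_eqI[of _ _ "xs @ ys"]) (auto simp: wp_append)
  qed
qed

text \<open>A word over \<open>J\<close> crosses only walls with labels in \<open>J\<close>;
  conversely, each letter of a geodesic is the label of the wall that it crosses. Cosets are thereby
  recognised from separating walls alone.\<close>

lemma parab_iff_lab:
  assumes J: "J \<subseteq> V" and x: "x \<in> carrier G" and y: "y \<in> carrier G"
  shows "inv x \<otimes> y \<in> parab J \<longleftrightarrow> lab ` H x y \<subseteq> J"
proof
  assume "inv x \<otimes> y \<in> parab J"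
  then obtain xs where xs: "xs \<in> lists J" "inv x \<otimes> y = wp xs" by (auto simp: parab_def)
  then have xsV: "xs \<in> lists V" using J by auto
  obtain ys where ys: "ys \<in> lists V" "wp ys = wp xs" "set ys \<subseteq> set xs" "distinct (refls ys)"
    using reduced_exists_subset[OF xsV] by auto
  have N: "N (inv x \<otimes> y) = set (refls ys)" using N_eq_refls(1)[OF ys(1,4)] ys(2) xs(2) by simp
  show "lab ` H x y \<subseteq> J"
  proof clarify
    fix t assume t: "t \<in> H x y"
    then have "cj (inv x) t \<in> set (refls ys)" using H_N[OF x y] H_carrier[OF t] N by simp
    then obtain g v where g: "g \<in> carrier G" "v \<in> set ys" "cj (inv x) t = cj g (s v)"
      using refls_form[OF ys(1)] by blast
    have v: "v \<in> V" "v \<in> J" using g ys xs by auto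
    have "t = cj x (cj g (s v))" using g(3) x H_carrier[OF t] by (metis cj_inv(2))
    then have "t = cj (x \<otimes> g) (s v)" using g v x by (simp add: cj_mult)
    then show "lab t \<in> J" using g v x by simp
  qed
next
  assume "lab ` H x y \<subseteq> J"
  with x y show "inv x \<otimes> y \<in> parab J"
  proof (induction rule: geo_induct)
    case base
    then show ?case using y parab_one by simp
  next
    case (step x v)
    then have "inv (x \<otimes> s v) \<otimes> y \<in> parab J" by auto
    moreover have "v \<in> J" using step by (metis image_subset_iff lab_cj)
    ultimately have "s v \<otimes> (inv (x \<otimes> s v) \<otimes> y) \<in> parab J" using parab_mult_s by blast
    moreover have "s v \<otimes> (inv (x \<otimes> s v) \<otimes> y) = inv x \<otimes> y"
      using step y by (simp add: inv_mult_group m_assoc)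
    ultimately show ?case by simp
  qed
qed

text \<open>The edge is the one at which a geodesic from \<open>x\<close> to \<open>z\<close>
  crosses \<open>t\<close>, and \<open>p\<close> is its end on the side of \<open>x\<close>.\<close>

lemma edge_on_geodesic:
  assumes "x \<in> carrier G" "z \<in> carrier G" "t \<in> H x z"
  shows "\<exists>p\<in>carrier G. \<exists>a\<in>V. t = cj p (s a) \<and> H x p \<subseteq> H x z - {t}"
  using assms
proof (induction rule: geo_induct)
  case (step x v)
  show ?case
  proof (cases "t = cj x (s v)")
    case True
    then show ?thesis using step by (intro bexI[of _ x] bexI[of _ v]) auto
  next
    case False
    then have "t \<in> H (x \<otimes> s v) z" using step by simp
    then obtain p a where p: "p \<in> carrier G" "a \<in> V" "t = cj p (s a)" "H (x \<otimes> s v) p \<subseteq> H (x \<otimes> s v) z - {t}"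
      using step by blast
    have "H x p \<subseteq> {cj x (s v)} \<union> H (x \<otimes> s v) p"
      using H_triangle[of x p "x \<otimes> s v"] H_edge step by auto
    then show ?thesis using p step False by blast
  qed
qed simp

section \<open>Crossing walls and medians\<close>

text \<open>The infinite dihedral group acting on a line: \<open>u\<close> is the reflection in 0,
  \<open>v\<close> the reflection in 1/2, and every other letter acts trivially.\<close>

primrec dih_act :: "'v \<Rightarrow> 'v \<Rightarrow> 'v list \<Rightarrow> int \<Rightarrow> int" where
  "dih_act u v [] x = x"
| "dih_act u v (a # as) x =
    (if a = u then - dih_act u v as x else if a = v then 1 - dih_act u v as x else dih_act u v as x)"

lemma dih_act_append: "dih_act u v (xs @ ys) x = dih_act u v xs (dih_act u v ys x)"
  by (induction xs) auto

text \<open>Cancelling pairs act trivially, and the only exchange of letters that could change the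
  action is that of \<open>u\<close> with \<open>v\<close>, which non-adjacency rules out.\<close>

lemma dih_act_wp:
  assumes "u \<noteq> v" "\<not> adj E u v" "xs \<in> lists V" "ys \<in> lists V" "wp xs = wp ys"
  shows "dih_act u v xs = dih_act u v ys"
proof -
  have "(xs, ys) \<in> racg_rel V E" using word_problem assms by blast
  then show ?thesis
  proof (rule racg_rel_invariant)
    fix xs ys assume "racg_step E xs ys"
    then consider (c) a b c where "xs = a @ [c, c] @ b" "ys = a @ b"
      | (sw) a b c d where "adj E c d" "xs = a @ [c, d] @ b" "ys = a @ [d, c] @ b"
      unfolding racg_step_def by blast
    then show "dih_act u v xs = dih_act u v ys"
    proof cases
      case sw
      then have "c \<noteq> d" "\<not> (c = u \<and> d = v)" "\<not> (c = v \<and> d = u)"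
        using assms adj_sym[of E u v] by (auto simp: adj_def)
      then show ?thesis using sw by (auto simp: dih_act_append fun_eq_iff)
    qed (auto simp: dih_act_append fun_eq_iff)
  qed
qed

text \<open>Reflections act on the integers as x \<mapsto> k - x; those with k \<le> 0 and those with k \<ge> 1 have their mirrors on
  different sides of the base chamber [0, 1/2].\<close>

lemma dihedral_refls:
  assumes uv: "u \<noteq> v" "u \<in> V" "v \<in> V" and xs: "xs \<in> lists {u, v}" and d: "distinct (refls xs)"
    and t: "t \<in> set (refls xs)"
  shows "\<exists>zs\<in>lists {u, v}. t = wp zs \<and>
    (\<exists>k. (\<forall>x. dih_act u v zs x = k - x) \<and> (hd xs = u \<longrightarrow> k \<le> 0) \<and> (hd xs = v \<longrightarrow> k \<ge> 1))"
  using xs d t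
proof (induction xs arbitrary: t rule: list.induct)
  case (Cons a ys)
  have a: "a \<in> {u, v}" "ys \<in> lists {u, v}" "a \<in> V" using Cons.prems uv by auto
  have ysV: "ys \<in> lists V" using a(2) uv by auto
  from Cons.prems consider "t = s a" | r where "r \<in> set (refls ys)" "t = cj (s a) r" by auto
  then show ?case
  proof cases
    case 1
    have w: "t = wp [a]" using 1 a by simp
    show ?thesis
    proof (cases "a = u")
      case True
      then show ?thesis using w uv
        by (intro bexI[of _ "[a]"] conjI exI[of _ 0]) auto
    next
      case False
      then show ?thesis using w uv a
        by (intro bexI[of _ "[a]"] conjI exI[of _ 1]) auto
    qed
  next
    case 2
    have "distinct (refls ys)" using Cons.prems(2) by (simp add: distinct_map)
    from Cons.IH[OF a(2) this 2(1)] obtain zs k where zs: "zs \<in> lists {u, v}" "r = wp zs"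
      and k: "\<forall>x. dih_act u v zs x = k - x" "hd ys = u \<longrightarrow> k \<le> 0" "hd ys = v \<longrightarrow> k \<ge> 1" by auto
    have zsV: "zs \<in> lists V" using zs(1) uv by auto
    have w: "t = wp (a # zs @ [a])" "a # zs @ [a] \<in> lists {u, v}"
      using 2 zs a zsV by (auto simp: cj_def wp_append m_assoc)
    obtain b bs where b: "ys = b # bs" using 2(1) by (cases ys) auto
    \<comment> \<open>Two equal letters in front would produce the reflection \<open>s a\<close>
      twice. The word therefore alternates, and the bound on \<open>k\<close> known for
      \<open>ys\<close> is the one belonging to the other generator.\<close>
    have "b \<noteq> a"
    proof
      assume "b = a"
      then have "cj (s a) (s a) \<in> set (map (cj (s a)) (refls ys))" "cj (s a) (s a) = s a"
        using b a by (auto simp: cj_def)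
      then show False using Cons.prems(2) by simp
    qed
    moreover have "b \<in> {u, v}" using a b by auto
    ultimately consider "a = u" "b = v" | "a = v" "b = u" using a by auto
    then show ?thesis
    proof cases
      case 1
      then have "\<forall>x. dih_act u v (a # zs @ [a]) x = - k - x" using k uv by (simp add: dih_act_append)
      then show ?thesis using w 1 k b uv by (intro bexI[of _ "a # zs @ [a]"] conjI exI[of _ "-k"]) auto
    next
      case 2
      then have "\<forall>x. dih_act u v (a # zs @ [a]) x = 2 - k - x" using k uv by (simp add: dih_act_append)
      then show ?thesis using w 2 k b uv by (intro bexI[of _ "a # zs @ [a]"] conjI exI[of _ "2-k"]) auto
    qed
  qed
qed simp

text \<open>\<open>s u\<close> has k = 0 and \<open>s v\<close> has k = 1. The first letter of a
  reduced word decides on which side of the base chamber all its mirrors lie, so the two reflections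
  cannot both occur.\<close>

lemma dihedral_descents:
  assumes uv: "u \<noteq> v" "u \<in> V" "v \<in> V" "\<not> adj E u v" and g: "g \<in> parab {u, v}"
  shows "\<not> (s u \<in> N g \<and> s v \<in> N g)"
proof
  assume d: "s u \<in> N g \<and> s v \<in> N g"
  obtain xs where xs: "xs \<in> lists {u, v}" "g = wp xs" using g by (auto simp: parab_def)
  have xsV: "xs \<in> lists V" using xs uv by auto
  obtain ys where ys: "ys \<in> lists V" "wp ys = wp xs" "set ys \<subseteq> set xs" "distinct (refls ys)"
    using reduced_exists_subset[OF xsV] by auto
  have ysl: "ys \<in> lists {u, v}" using ys(3) xs(1) by auto
  have N: "N g = set (refls ys)" using N_eq_refls(1)[OF ys(1,4)] ys(2) xs(2) by simp
  have L: "zs \<in> lists {u, v} \<Longrightarrow> zs \<in> lists V" for zs using uv by auto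
  have nu: "\<not> hd ys = v"
  proof
    assume h: "hd ys = v"
    obtain zs k where z: "zs \<in> lists {u, v}" "s u = wp zs" "\<forall>x. dih_act u v zs x = k - x" "k \<ge> 1"
      using dihedral_refls[OF uv(1-3) ysl ys(4), of "s u"] d N h by auto
    have "wp [u] = s u" using uv by simp
    then have "[u] \<in> lists V" "wp zs = wp [u]" using z(2) uv by simp_all
    then have "dih_act u v zs = dih_act u v [u]"
      by (rule dih_act_wp[OF uv(1,4) L[OF z(1)]])
    then have "dih_act u v zs 0 = 0" by simp
    then show False using z by simp
  qed
  have nv: "\<not> hd ys = u"
  proof
    assume h: "hd ys = u"
    obtain zs k where z: "zs \<in> lists {u, v}" "s v = wp zs" "\<forall>x. dih_act u v zs x = k - x" "k \<le> 0"
      using dihedral_refls[OF uv(1-3) ysl ys(4), of "s v"] d N h by auto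
    have "wp [v] = s v" using uv by simp
    then have "[v] \<in> lists V" "wp zs = wp [v]" using z(2) uv by simp_all
    then have "dih_act u v zs = dih_act u v [v]"
      by (rule dih_act_wp[OF uv(1,4) L[OF z(1)]])
    then have "dih_act u v zs 0 = 1" using uv by simp
    then show False using z by simp
  qed
  have "ys \<noteq> []" using N d by auto
  then have "hd ys \<in> {u, v}" using ysl by (cases ys) auto
  then show False using nu nv by auto
qed

text \<open>Split off the longest prefix a of w in the parabolic subgroup of u and v: by minimality of the rest, the
  reflections of this subgroup that lie in N w already lie in N a.\<close>

lemma descents_adj:
  assumes uv: "u \<noteq> v" "u \<in> V" "v \<in> V" and w: "w \<in> carrier G" and d: "s u \<in> N w" "s v \<in> N w"
  shows "adj E u v"
proof (rule ccontr)
  assume na: "\<not> adj E u v"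
  have sub: "subgroup (parab {u, v}) G" using uv by (intro parab_subgroup) auto
  obtain a where a: "a \<in> parab {u, v}" "\<And>a'. a' \<in> parab {u, v} \<Longrightarrow> card (N (inv a \<otimes> w)) \<le> card (N (inv a' \<otimes> w))"
    using arg_min_nat_lemma[of "\<lambda>a. a \<in> parab {u, v}" _ "\<lambda>a. card (N (inv a \<otimes> w))"] parab_one by blast
  have ac: "a \<in> carrier G" by (rule subgroup.mem_carrier[OF sub a(1)])
  define b where "b = inv a \<otimes> w"
  have b: "b \<in> carrier G" "w = a \<otimes> b" using w ac by (auto simp: b_def)
  have key: "s c \<in> N a" if c: "c \<in> {u, v}" "s c \<in> N w" for c
  proof (rule ccontr)
    assume n: "s c \<notin> N a"
    have cV: "c \<in> V" using c(1) uv(2,3) by auto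
    have "cj (inv a) (s c) \<in> N b" using N_mult[OF ac b(1), of "s c"] c n b cV by simp
    then have "card (N (cj (inv a) (s c) \<otimes> b)) < card (N b)" by (rule card_N_refl_less[OF b(1)])
    moreover have "cj (inv a) (s c) \<otimes> b = inv (s c \<otimes> a) \<otimes> w"
      using ac b(1) cV unfolding b(2) by (simp add: cj_def m_assoc inv_mult_group)
    moreover have "s c \<otimes> a \<in> parab {u, v}" using parab_mult_s a c by blast
    ultimately show False using a(2)[of "s c \<otimes> a"] unfolding b_def by simp
  qed
  have "s u \<in> N a" "s v \<in> N a" using key d by auto
  then show False using dihedral_descents[OF uv na a(1)] by simp
qed

lemma cj_commuting_labels:
  assumes g: "g \<in> parab J" and a: "a \<in> V" and J: "J \<subseteq> V" "\<And>v. v \<in> J \<Longrightarrow> adj E v a"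
  shows "cj g (s a) = s a"
proof -
  obtain xs where xs: "xs \<in> lists J" "g = wp xs" using g by (auto simp: parab_def)
  have "xs \<in> lists J \<Longrightarrow> cj (wp xs) (s a) = s a"
  proof (induction xs rule: list.induct)
    case (Cons v xs)
    then have v: "v \<in> J" "v \<in> V" "xs \<in> lists J" "xs \<in> lists V" using J by auto
    then have "cj (s v \<otimes> wp xs) (s a) = cj (s v) (cj (wp xs) (s a))" using a by (intro cj_mult) auto
    also have "\<dots> = s a" using Cons.IH v cj_s_adj[OF J(2)] a by simp
    finally show ?case by simp
  qed (use a in simp)
  then show ?thesis using xs by simp
qed

text \<open>If v is the first letter of a geodesic from x to y, then both v and a are left descents of the element
  inv x \<otimes> y \<otimes> s a, so they commute and the edge at x can be moved along v.\<close>

lemma carrier_convex: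
  assumes x: "x \<in> carrier G" and y: "y \<in> carrier G" and a: "a \<in> V"
    and t: "t = cj x (s a)" "t = cj y (s a)" "t \<notin> H x y"
  shows "\<forall>r\<in>H x y. adj E (lab r) a"
  using x y t(1,3)
proof (induction rule: geo_induct)
  case (step x v)
  define h where "h = cj x (s v)"
  have tc: "t \<in> carrier G" "h \<in> carrier G" using step a by (auto simp: h_def)
  have hne: "h \<noteq> t" using step.hyps(3) step.prems(2) unfolding h_def by blast
  define w where "w = inv x \<otimes> (y \<otimes> s a)"
  have wc: "w \<in> carrier G" using step.hyps(1) y a by (simp add: w_def)
  have ed: "H y (y \<otimes> s a) = {t}" using H_edge[OF y a] t(2) by simp
  have Hw: "r \<in> H x (y \<otimes> s a) \<longleftrightarrow> r \<in> H x y \<or> r = t" for r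
  proof -
    have "r \<in> H y (y \<otimes> s a) \<longleftrightarrow> r = t" using ed by simp
    then show ?thesis using step.prems(2) unfolding in_H by metis
  qed
  have "s a \<in> N w" using Hw[of t] cj_in_H[of x "y \<otimes> s a" "s a"] step.hyps(1) step.prems(1) a y unfolding w_def by simp
  moreover have "s v \<in> N w" using Hw[of h] cj_in_H[of x "y \<otimes> s a" "s v"] step.hyps a y unfolding w_def h_def by simp
  moreover have "v \<noteq> a" using hne step.prems h_def by auto
  ultimately have va: "adj E v a" using descents_adj[of v a w] wc step.hyps(2) a by simp
  have t': "t = cj (x \<otimes> s v) (s a)"
    using step.hyps(1,2) step.prems(1) a va by (simp add: cj_mult cj_s_adj)
  have "t \<notin> H (x \<otimes> s v) y" using step.hyps(4) step.prems(2) by blast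
  then have IH: "\<forall>r\<in>H (x \<otimes> s v) y. adj E (lab r) a" by (rule step.IH[OF t'])
  show ?case
  proof
    fix r assume r: "r \<in> H x y"
    show "adj E (lab r) a"
    proof (cases "r = h")
      case True
      then show ?thesis using va step.hyps(1,2) by (simp add: h_def)
    next
      case False
      then show ?thesis using IH r step.hyps(4) by (simp add: h_def)
    qed
  qed
qed simp

section \<open>Crossing walls, meets and medians\<close>

definition cross :: "'g \<Rightarrow> 'g \<Rightarrow> bool" where
  "cross t u \<longleftrightarrow> (\<forall>p q. \<exists>x\<in>carrier G. (t \<in> N x) = p \<and> (u \<in> N x) = q)"

lemma cross_sym: "cross t u \<Longrightarrow> cross u t"
  unfolding cross_def by blast

text \<open>On each side of \<open>u\<close> there is an edge dual to \<open>t\<close>. The wall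
  \<open>u\<close> separates these two edges, and by \<open>carrier_convex\<close> every wall doing
  so has a label adjacent to that of \<open>t\<close>.\<close>

lemma cross_adj:
  assumes "cross t u"
  shows "adj E (lab t) (lab u)"
proof -
  have edge: "\<exists>p\<in>carrier G. \<exists>a\<in>V. t = cj p (s a) \<and> t \<notin> N p \<and> (u \<in> N p) = q" for q
  proof -
    obtain x where x: "x \<in> carrier G" "t \<notin> N x" "(u \<in> N x) = q" using assms unfolding cross_def by metis
    obtain z where z: "z \<in> carrier G" "t \<in> N z" "(u \<in> N z) = q" using assms unfolding cross_def by metis
    have "t \<in> H x z" "u \<notin> H x z" using x z by (auto simp: in_H)
    then obtain p a where p: "p \<in> carrier G" "a \<in> V" "t = cj p (s a)" "H x p \<subseteq> H x z - {t}"
      using edge_on_geodesic[OF x(1) z(1)] by blast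
    then have "t \<notin> H x p" "u \<notin> H x p" using \<open>u \<notin> H x z\<close> by auto
    then show ?thesis using p x by (auto simp: in_H)
  qed
  obtain p a where p: "p \<in> carrier G" "a \<in> V" "t = cj p (s a)" "t \<notin> N p" "u \<notin> N p"
    using edge[of False] by auto
  obtain q b where q: "q \<in> carrier G" "b \<in> V" "t = cj q (s b)" "t \<notin> N q" "u \<in> N q"
    using edge[of True] by auto
  have "a = b" using p q label_unique by metis
  moreover have "t \<notin> H p q" "u \<in> H p q" using p q by (auto simp: in_H)
  ultimately have "adj E (lab u) a" using carrier_convex[OF p(1) q(1) p(2,3)] q(3) by simp
  then show ?thesis using p adj_sym[of E a] by simp
qed

text \<open>Let \<open>p\<close> and \<open>q\<close> be the points just before \<open>t\<close> on
  geodesics from the identity to \<open>y\<close> and \<open>z\<close>. If \<open>N p\<close> and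
  \<open>N q\<close> share a wall, induction applies. Otherwise all of \<open>N p\<close> separates
  two edges dual to \<open>t\<close>, so \<open>p\<close> commutes with the generator of that label
  and \<open>t\<close> is itself this generator.\<close>

lemma common_descent:
  assumes "y \<in> carrier G" "z \<in> carrier G" "t \<in> N y" "t \<in> N z"
  shows "\<exists>v\<in>V. s v \<in> N y \<and> s v \<in> N z"
  using assms
proof (induction "card (N y) + card (N z)" arbitrary: y z t rule: less_induct)
  case less
  obtain p a where p: "p \<in> carrier G" "a \<in> V" "t = cj p (s a)" "N p \<subseteq> N y - {t}"
    using edge_on_geodesic[of \<one> y t] less.prems by auto
  obtain q b where q: "q \<in> carrier G" "b \<in> V" "t = cj q (s b)" "N q \<subseteq> N z - {t}"
    using edge_on_geodesic[of \<one> z t] less.prems by auto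
  have ab: "b = a" using p q label_unique by metis
  show ?case
  proof (cases "N p \<inter> N q = {}")
    case False
    then obtain r where r: "r \<in> N p" "r \<in> N q" by auto
    have "card (N p) < card (N y)" "card (N q) < card (N z)"
      using p q less.prems by (auto intro!: psubset_card_mono)
    then have "card (N p) + card (N q) < card (N y) + card (N z)" by simp
    from less.hyps[OF this p(1) q(1) r] show ?thesis using p q by blast
  next
    case True
    have "t \<notin> H p q" using p q by (auto simp: in_H)
    then have adj: "\<forall>r\<in>H p q. adj E (lab r) a" using carrier_convex[OF p(1) q(1) p(2,3)] q(3) ab by simp
    have "N p \<subseteq> H p q" using True by (auto simp: in_H)
    then have "lab ` H \<one> p \<subseteq> {v \<in> V. adj E v a}"
      using adj lab_in_V[OF one_closed p(1)] by auto
    then have "inv \<one> \<otimes> p \<in> parab {v \<in> V. adj E v a}"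
      using parab_iff_lab[OF _ one_closed p(1), of "{v \<in> V. adj E v a}"] by blast
    then have "cj p (s a) = s a" using p by (intro cj_commuting_labels[of p "{v \<in> V. adj E v a}"]) auto
    then show ?thesis using p less.prems by auto
  qed
qed

text \<open>A common left descent is divided out of both elements and multiplied back onto the meet
  of the quotients. As long as some wall is common, \<open>common_descent\<close> supplies such a
  descent.\<close>

lemma meet_exists:
  assumes "y \<in> carrier G" "z \<in> carrier G"
  shows "\<exists>m\<in>carrier G. N m = N y \<inter> N z"
  using assms
proof (induction "card (N y)" arbitrary: y z rule: less_induct)
  case less
  show ?case
  proof (cases "N y \<inter> N z = {}")
    case True
    then show ?thesis by (intro bexI[of _ \<one>]) auto
  next
    case False
    then obtain v where v: "v \<in> V" "s v \<in> N y" "s v \<in> N z" using common_descent less.prems by blast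
    have "card (N (s v \<otimes> y)) < card (N y)" using card_N_refl_less less.prems v by blast
    then obtain m where m: "m \<in> carrier G" "N m = N (s v \<otimes> y) \<inter> N (s v \<otimes> z)"
      using less.hyps[of "s v \<otimes> y" "s v \<otimes> z"] less.prems v by auto
    have rel: "r \<in> N (s v \<otimes> g) \<longleftrightarrow> (r = s v) \<noteq> (cj (s v) r \<in> N g)" if "r \<in> carrier G" "g \<in> carrier G" for r g
      using N_mult[of "s v" g r] that v by simp
    have sfix: "cj (s v) (s v) = s v" using v by (simp add: cj_def)
    have inv2: "cj (s v) (cj (s v) r) = r" if "r \<in> carrier G" for r
      using cj_inv(1)[of "s v" r] that v by simp
    have "r \<in> N (s v \<otimes> m) \<longleftrightarrow> r \<in> N y \<inter> N z" if r: "r \<in> carrier G" for r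
    proof (cases "r = s v")
      case True
      then show ?thesis using rel[OF r m(1)] m(2) rel[OF r less.prems(1)] v sfix by simp
    next
      case False
      have c: "cj (s v) r \<in> carrier G" "cj (s v) r \<noteq> s v"
        using r v False sfix inv2[OF r] by auto
      show ?thesis using rel[OF r m(1)] m(2) rel[OF c(1) less.prems(1)] rel[OF c(1) less.prems(2)]
          inv2[OF r] False c by simp
    qed
    then have "N (s v \<otimes> m) = N y \<inter> N z" using N_closed by blast
    then show ?thesis using m v by (intro bexI[of _ "s v \<otimes> m"]) auto
  qed
qed

text \<open>The median is the meet of the other two points taken with \<open>x\<close> as base point
  instead of the identity.\<close>

lemma med_exists:
  assumes "x \<in> carrier G" "y \<in> carrier G" "z \<in> carrier G"
  shows "\<exists>m\<in>carrier G. N m = N x \<inter> N y \<union> N y \<inter> N z \<union> N x \<inter> N z"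
proof -
  obtain m where m: "m \<in> carrier G" "N m = N (inv x \<otimes> y) \<inter> N (inv x \<otimes> z)"
    using meet_exists[of "inv x \<otimes> y" "inv x \<otimes> z"] assms by auto
  have "t \<in> N (x \<otimes> m) \<longleftrightarrow> t \<in> N x \<inter> N y \<union> N y \<inter> N z \<union> N x \<inter> N z" if t: "t \<in> carrier G" for t
    using N_mult[OF assms(1) m(1) t] m(2) H_N[OF assms(1,2) t] H_N[OF assms(1,3) t]
    by (auto simp: in_H)
  then have "N (x \<otimes> m) = N x \<inter> N y \<union> N y \<inter> N z \<union> N x \<inter> N z" using N_closed by blast
  then show ?thesis using m assms by (intro bexI[of _ "x \<otimes> m"]) auto
qed

definition med :: "'g \<Rightarrow> 'g \<Rightarrow> 'g \<Rightarrow> 'g" where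
  "med x y z = (SOME m. m \<in> carrier G \<and> N m = N x \<inter> N y \<union> N y \<inter> N z \<union> N x \<inter> N z)"

lemma med:
  assumes "x \<in> carrier G" "y \<in> carrier G" "z \<in> carrier G"
  shows "med x y z \<in> carrier G" "N (med x y z) = N x \<inter> N y \<union> N y \<inter> N z \<union> N x \<inter> N z"
proof -
  have "\<exists>m. m \<in> carrier G \<and> N m = N x \<inter> N y \<union> N y \<inter> N z \<union> N x \<inter> N z"
    using med_exists[OF assms] by blast
  from someI_ex[OF this] show "med x y z \<in> carrier G"
    "N (med x y z) = N x \<inter> N y \<union> N y \<inter> N z \<union> N x \<inter> N z" unfolding med_def by simp_all
qed

section \<open>Dihedral squares\<close>

primrec dih_word :: "'v \<Rightarrow> 'v \<Rightarrow> 'v list \<Rightarrow> bool \<times> int" where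
  "dih_word u v [] = \<one>\<^bsub>Dinf\<^esub>"
| "dih_word u v (x # xs) =
    (if x = u then (True, 0) else if x = v then (True, 1) else \<one>\<^bsub>Dinf\<^esub>) \<otimes>\<^bsub>Dinf\<^esub> dih_word u v xs"

lemma dih_word_append: "dih_word u v (xs @ ys) = dih_word u v xs \<otimes>\<^bsub>Dinf\<^esub> dih_word u v ys"
  by (induction xs) (auto simp: Dinf_def split: prod.splits)

lemma dih_word_act:
  "dih_act u v xs x = (if fst (dih_word u v xs) then - x else x) + snd (dih_word u v xs)"
  by (induction xs) (auto simp: Dinf_def split: prod.splits)

text \<open>An isometry of the integers is determined by its values at 0 and 1.\<close>

lemma dih_word_eqI:
  assumes "dih_act u v xs = dih_act u v ys" shows "dih_word u v xs = dih_word u v ys"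
  using fun_cong[OF assms, of 0] fun_cong[OF assms, of 1]
  by (auto simp: dih_word_act prod_eq_iff split: if_splits)

lemma dih_word_wp:
  assumes "u \<noteq> v" "\<not> adj E u v" "xs \<in> lists V" "ys \<in> lists V" "wp xs = wp ys"
  shows "dih_word u v xs = dih_word u v ys"
  by (rule dih_word_eqI[OF dih_act_wp[OF assms]])

lemma dih_word_filter: "{u, v} \<subseteq> S \<Longrightarrow> dih_word u v (filter (\<lambda>x. x \<in> S) xs) = dih_word u v xs"
  by (induction xs) (auto simp: Dinf_def split: prod.splits)

lemma dih_word_other: "set xs \<inter> {u, v} = {} \<Longrightarrow> dih_word u v xs = \<one>\<^bsub>Dinf\<^esub>"
  by (induction xs) (auto simp: Dinf_def)

lemma dih_word_surj:
  assumes "u \<noteq> v"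
  shows "\<exists>xs\<in>lists {u, v}. dih_word u v xs = (b, k)"
proof (induction k rule: int_induct[where k = 0])
  case base
  show ?case
  proof (cases b)
    case True
    then show ?thesis by (intro bexI[of _ "[u]"]) (auto simp: Dinf_def)
  next
    case False
    then show ?thesis by (intro bexI[of _ "[]"]) (auto simp: Dinf_def)
  qed
next
  case (step1 i)
  then obtain xs where "xs \<in> lists {u, v}" "dih_word u v xs = (b, i)" by blast
  \<comment> \<open>The product of \<open>v\<close> and \<open>u\<close> is the translation by 1; in
    the opposite order it is the translation by -1.\<close>
  then show ?case using assms by (intro bexI[of _ "v # u # xs"]) (auto simp: Dinf_def)
next
  case (step2 i)
  then obtain xs where "xs \<in> lists {u, v}" "dih_word u v xs = (b, i)" by blast
  then show ?case using assms by (intro bexI[of _ "u # v # xs"]) (auto simp: Dinf_def)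
qed

lemma distinct_refls_successively:
  "xs \<in> lists V \<Longrightarrow> distinct (refls xs) \<Longrightarrow> successively (\<noteq>) xs"
proof (induction xs rule: list.induct)
  case (Cons x xs)
  then have xV: "x \<in> V" by simp
  have "distinct (refls xs)" using Cons.prems(2) by (simp add: distinct_map)
  then have IH: "successively (\<noteq>) xs" using Cons by simp
  show ?case
  proof (cases xs)
    case (Cons y ys)
    have "x \<noteq> y"
    proof
      assume "x = y"
      moreover have "cj (s x) (s x) = s x" using xV by (simp add: cj_def)
      ultimately show False using Cons.prems(2) unfolding local.Cons by simp
    qed
    then show ?thesis using IH Cons by simp
  qed simp
qed simp

text \<open>For an affine f, 3 f(0) + f(1) is four times f(1/4), and 1/4 lies in the base chamber [0, 1/2].\<close>

lemma dih_act_alternating: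
  assumes "u \<noteq> v" "xs \<in> lists {u, v}" "successively (\<noteq>) xs" "xs \<noteq> []"
  shows "(hd xs = u \<longrightarrow> 3 * dih_act u v xs 0 + dih_act u v xs 1 < 0) \<and>
         (hd xs = v \<longrightarrow> 3 * dih_act u v xs 0 + dih_act u v xs 1 > 2)"
  using assms(2-)
proof (induction xs rule: list.induct)
  case (Cons x ys)
  show ?case
  proof (cases "ys = []")
    case False
    then have "hd ys \<noteq> x" "hd ys \<in> {u, v}" "x \<in> {u, v}" "successively (\<noteq>) ys" "ys \<in> lists {u, v}"
      using Cons.prems by (auto simp: successively_Cons)
    then show ?thesis using Cons.IH False assms(1) by auto
  qed (use Cons.prems assms(1) in auto)
qed simp

text \<open>A word with trivial image fixes the point 1/4 of the base chamber, whereas a nonempty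
  reduced word alternates and moves this point out of the chamber.\<close>

lemma dih_word_faithful:
  assumes uv: "u \<noteq> v" "\<not> adj E u v" "{u, v} \<subseteq> V" and xs: "xs \<in> lists {u, v}"
    and one: "dih_word u v xs = \<one>\<^bsub>Dinf\<^esub>"
  shows "wp xs = \<one>"
proof -
  have xsV: "xs \<in> lists V" using xs uv by auto
  obtain ys where ys: "ys \<in> lists V" "wp ys = wp xs" "set ys \<subseteq> set xs" "distinct (refls ys)"
    using reduced_exists_subset[OF xsV] by auto
  have ysl: "ys \<in> lists {u, v}" using ys(3) xs by auto
  have "dih_word u v ys = \<one>\<^bsub>Dinf\<^esub>" using dih_word_wp[OF uv(1,2) ys(1) xsV ys(2)] one by simp
  then have "3 * dih_act u v ys 0 + dih_act u v ys 1 = 1" by (simp add: dih_word_act Dinf_def)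
  moreover have "hd ys \<in> {u, v}" if "ys \<noteq> []" using ysl that by (cases ys) auto
  ultimately have "ys = []"
    using dih_act_alternating[OF uv(1) ysl distinct_refls_successively[OF ys(1,4)]] by fastforce
  then show ?thesis using ys(2) by simp
qed

lemma square_split:
  assumes comm: "\<And>x y. x \<in> {a, c} \<Longrightarrow> y \<in> {b, d} \<Longrightarrow> adj E x y" and V: "{a, b, c, d} \<subseteq> V"
    and xs: "xs \<in> lists {a, b, c, d}"
  shows "wp xs = wp (filter (\<lambda>x. x \<in> {a, c}) xs) \<otimes> wp (filter (\<lambda>x. x \<in> {b, d}) xs)"
  using xs
proof (induction xs rule: list.induct)
  case (Cons x xs)
  define f g where "f = filter (\<lambda>x. x \<in> {a, c}) xs" and "g = filter (\<lambda>x. x \<in> {b, d}) xs"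
  have x: "x \<in> {a, b, c, d}" "x \<in> V" "xs \<in> lists {a, b, c, d}" using Cons.prems V by auto
  have fg: "f \<in> lists {a, c}" "f \<in> lists V" "g \<in> lists V" using V by (auto simp: f_def g_def)
  have IH: "wp xs = wp f \<otimes> wp g" using Cons.IH[OF x(3)] by (simp add: f_def g_def)
  have ne: "x \<in> {a, c} \<Longrightarrow> x \<notin> {b, d}" using comm[of x x] adj_neq[of E x x] by auto
  have cm: "s x \<otimes> wp ys = wp ys \<otimes> s x" if "x \<in> {b, d}" "ys \<in> lists {a, c}" for ys
    using that(2)
  proof (induction ys rule: list.induct)
    case (Cons y ys)
    then have y: "y \<in> V" "ys \<in> lists {a, c}" "ys \<in> lists V" "adj E y x" using V comm[OF _ that(1)] by auto
    have "s x \<otimes> (s y \<otimes> wp ys) = s y \<otimes> (s x \<otimes> wp ys)"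
      using s_comm[OF y(4,1) x(2)] y x(2) by (simp flip: m_assoc)
    also have "\<dots> = s y \<otimes> (wp ys \<otimes> s x)" using Cons.IH[OF y(2)] by simp
    finally show ?case using y x(2) by (simp add: m_assoc)
  qed (use x in simp)
  show ?case
  proof (cases "x \<in> {a, c}")
    case True
    then have "filter (\<lambda>x. x \<in> {a, c}) (x # xs) = x # f" "filter (\<lambda>x. x \<in> {b, d}) (x # xs) = g"
      using ne by (simp_all add: f_def g_def)
    then show ?thesis using IH m_assoc[OF s_closed[OF x(2)] wp_closed[OF fg(2)] wp_closed[OF fg(3)]] by simp
  next
    case False
    then have xb: "x \<in> {b, d}" using x(1) by blast
    have "s x \<otimes> (wp f \<otimes> wp g) = wp f \<otimes> (s x \<otimes> wp g)"
      using cm[OF xb fg(1)] x(2) wp_closed[OF fg(2)] wp_closed[OF fg(3)] by (metis m_assoc s_closed)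
    moreover have "filter (\<lambda>x. x \<in> {a, c}) (x # xs) = f" "filter (\<lambda>x. x \<in> {b, d}) (x # xs) = x # g"
      using False xb by (simp_all add: f_def g_def)
    ultimately show ?thesis using IH by simp
  qed
qed simp

text \<open>Opposite vertices are not joined and generate an infinite dihedral group; the two pairs
  commute with each other. Sorting a word into its two pairs shows that the pair of dihedral images
  determines the element.\<close>

lemma square_iso:
  assumes sq: "is_square E a b c d" and V: "{a, b, c, d} \<subseteq> V" and na: "\<not> adj E a c" "\<not> adj E b d"
  shows "G\<lparr>carrier := parab {a, b, c, d}\<rparr> \<cong> Dinf \<times>\<times> Dinf"
proof -
  define T where "T = {a, b, c, d}"
  have di: "a \<noteq> c" "b \<noteq> d" "{a, c} \<inter> {b, d} = {}" using sq by (auto simp: is_square_def)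
  have comm: "adj E x y" if "x \<in> {a, c}" "y \<in> {b, d}" for x y
    using that sq adj_sym[of E] by (auto simp: is_square_def)
  have L: "xs \<in> lists V" if "xs \<in> lists T" for xs using that V by (auto simp: T_def)
  define f where "f xs = (dih_word a c xs, dih_word b d xs)" for xs
  define \<phi> where "\<phi> g = f (SOME xs. xs \<in> lists T \<and> wp xs = g)" for g
  have f_wp: "f xs = f ys" if "xs \<in> lists V" "ys \<in> lists V" "wp xs = wp ys" for xs ys
    using dih_word_wp[OF di(1) na(1) that] dih_word_wp[OF di(2) na(2) that] by (simp add: f_def)
  have \<phi>: "\<phi> (wp xs) = f xs" if xs: "xs \<in> lists T" for xs
  proof -
    have "(SOME ys. ys \<in> lists T \<and> wp ys = wp xs) \<in> lists T \<and> wp (SOME ys. ys \<in> lists T \<and> wp ys = wp xs) = wp xs"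
      by (rule someI[of _ xs]) (use xs in simp)
    then show ?thesis unfolding \<phi>_def by (intro f_wp) (use L xs in auto)
  qed
  have f_app: "f (xs @ ys) = f xs \<otimes>\<^bsub>Dinf \<times>\<times> Dinf\<^esub> f ys" for xs ys
    by (simp add: f_def dih_word_append DirProd_def)
  have f_one: "wp xs = \<one>" if xs: "xs \<in> lists T" and one: "f xs = f []" for xs
  proof -
    have 1: "dih_word a c (filter (\<lambda>x. x \<in> {a, c}) xs) = \<one>\<^bsub>Dinf\<^esub>"
      "dih_word b d (filter (\<lambda>x. x \<in> {b, d}) xs) = \<one>\<^bsub>Dinf\<^esub>"
      using one by (simp_all only: dih_word_filter subset_refl) (simp_all add: f_def)
    have "wp (filter (\<lambda>x. x \<in> {a, c}) xs) = \<one>"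
      by (rule dih_word_faithful[OF di(1) na(1) _ _ 1(1)]) (use V in auto)
    moreover have "wp (filter (\<lambda>x. x \<in> {b, d}) xs) = \<one>"
      by (rule dih_word_faithful[OF di(2) na(2) _ _ 1(2)]) (use V in auto)
    ultimately show ?thesis using square_split[OF comm V xs[unfolded T_def]] by simp
  qed
  have "\<phi> \<in> hom (G\<lparr>carrier := parab T\<rparr>) (Dinf \<times>\<times> Dinf)"
  proof (rule homI)
    show "\<phi> x \<in> carrier (Dinf \<times>\<times> Dinf)" for x by (simp add: DirProd_def Dinf_def)
    fix x y assume "x \<in> carrier (G\<lparr>carrier := parab T\<rparr>)" "y \<in> carrier (G\<lparr>carrier := parab T\<rparr>)"
    then obtain xs ys where w: "xs \<in> lists T" "ys \<in> lists T" "x = wp xs" "y = wp ys" by (auto simp: parab_def)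
    then have "x \<otimes> y = wp (xs @ ys)" "xs @ ys \<in> lists T" using L by (auto simp: wp_append)
    then show "\<phi> (x \<otimes>\<^bsub>G\<lparr>carrier := parab T\<rparr>\<^esub> y) = \<phi> x \<otimes>\<^bsub>Dinf \<times>\<times> Dinf\<^esub> \<phi> y"
      using \<phi> w f_app by simp
  qed
  moreover have "bij_betw \<phi> (parab T) (carrier (Dinf \<times>\<times> Dinf))"
  proof (rule bij_betw_imageI)
    show "inj_on \<phi> (parab T)"
    proof (rule inj_onI)
      fix x y assume "x \<in> parab T" "y \<in> parab T" and e: "\<phi> x = \<phi> y"
      then obtain xs ys where w: "xs \<in> lists T" "ys \<in> lists T" "x = wp xs" "y = wp ys" by (auto simp: parab_def)
      have r: "rev xs \<in> lists T" "rev xs @ ys \<in> lists T" "rev xs @ xs \<in> lists T" using w by auto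
      have "f (rev xs @ ys) = f (rev xs @ xs)" using e w \<phi> by (simp add: f_app)
      also have "\<dots> = f []"
      proof (rule f_wp)
        show "wp (rev xs @ xs) = wp []"
          using wp_append[OF L[OF r(1)] L[OF w(1)]] wp_rev[OF L[OF w(1)]] wp_closed[OF L[OF w(1)]] by simp
      qed (use L[OF r(3)] in auto)
      finally have "wp (rev xs @ ys) = \<one>" using f_one r by blast
      then have "inv x \<otimes> y = \<one>"
        using wp_append[OF L[OF r(1)] L[OF w(2)]] wp_rev[OF L[OF w(1)]] w(3,4) by simp
      moreover have "x \<in> carrier G" "y \<in> carrier G" using w L by auto
      ultimately show "x = y" using mult_inv_cancel[of x y] by simp
    qed
    show "\<phi> ` parab T = carrier (Dinf \<times>\<times> Dinf)"
    proof
      show "\<phi> ` parab T \<subseteq> carrier (Dinf \<times>\<times> Dinf)" by (auto simp: DirProd_def Dinf_def)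
      show "carrier (Dinf \<times>\<times> Dinf) \<subseteq> \<phi> ` parab T"
      proof
        fix z :: "(bool \<times> int) \<times> (bool \<times> int)"
        obtain p k q l where z: "z = ((p, k), (q, l))" by (metis prod.exhaust)
        obtain xs where xs: "xs \<in> lists {a, c}" "dih_word a c xs = (p, k)" using dih_word_surj[OF di(1)] by blast
        obtain ys where ys: "ys \<in> lists {b, d}" "dih_word b d ys = (q, l)" using dih_word_surj[OF di(2)] by blast
        have "dih_word a c ys = \<one>\<^bsub>Dinf\<^esub>" "dih_word b d xs = \<one>\<^bsub>Dinf\<^esub>"
          using xs ys di by (auto intro!: dih_word_other)
        then have "f (xs @ ys) = z" using xs ys z by (simp add: f_app) (simp add: f_def DirProd_def Dinf_def)
        moreover have "xs @ ys \<in> lists T" using xs ys by (auto simp: T_def)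
        ultimately show "z \<in> \<phi> ` parab T" using \<phi> unfolding parab_def by (metis imageI)
      qed
    qed
  qed
  ultimately have "\<phi> \<in> iso (G\<lparr>carrier := parab T\<rparr>) (Dinf \<times>\<times> Dinf)" by (simp add: iso_def)
  then show ?thesis unfolding T_def[symmetric] by (rule is_isoI)
qed

end

text \<open>Write v = h1 w h2 with h1, h2 in A and w a nonempty alternating product that starts and ends in K. Then
  v t = t v turns into a nonempty alternating product that equals the identity.\<close>

lemma (in group) free_factor_centralizer:
  assumes fp: "internal_free_product G A K" and t: "t \<in> A" "t \<noteq> \<one>"
    and v: "v \<in> carrier G" "v \<otimes> t = t \<otimes> v"
  shows "v \<in> A"
proof (rule ccontr)
  assume vA: "v \<notin> A"
  have A: "subgroup A G" and K: "subgroup K G" and gen: "generate G (A \<union> K) = carrier G"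
    using fp by (auto simp: internal_free_product_def)
  define syl where "syl b = (if b then A else K)" for b
  have sub: "subgroup (syl b) G" for b using A K by (simp add: syl_def)
  define alt where "alt xs \<longleftrightarrow> (\<forall>x\<in>set xs. snd x \<in> syl (fst x) - {\<one>}) \<and> successively (\<lambda>x y. fst x \<noteq> fst y) xs"
    for xs :: "(bool \<times> 'a) list"
  define ev where "ev xs = foldr (\<lambda>x acc. snd x \<otimes> acc) xs \<one>" for xs :: "(bool \<times> 'a) list"
  have ev_simps [simp]: "ev [] = \<one>" "ev (x # xs) = snd x \<otimes> ev xs" for x xs by (simp_all add: ev_def)
  have alt_c: "\<forall>x\<in>set xs. snd x \<in> carrier G" if "alt xs" for xs
    using that subgroup.mem_carrier[OF sub] by (auto simp: alt_def)
  have ev_c: "ev xs \<in> carrier G" if "\<forall>x\<in>set xs. snd x \<in> carrier G" for xs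
    using that by (induction xs) auto
  have ev_app: "ev (xs @ ys) = ev xs \<otimes> ev ys"
    if "\<forall>x\<in>set xs. snd x \<in> carrier G" "\<forall>x\<in>set ys. snd x \<in> carrier G" for xs ys
    using that(1) by (induction xs) (auto simp: m_assoc ev_c that(2))
  have free: "ev xs \<noteq> \<one>" if "alt xs" "xs \<noteq> []" for xs
    using fp that unfolding internal_free_product_def ev_def alt_def syl_def successively_conv_nth
    by (auto simp: case_prod_beta)
  \<comment> \<open>Normal forms are built by multiplication from the left: the new syllable is put
    in front, merged with a first syllable of the same factor, or cancelled against it.\<close>
  have cons: "\<exists>ys. alt ys \<and> ev ys = g \<otimes> ev xs" if xs: "alt xs" and g: "g \<in> syl b" for g b xs
  proof (cases "g = \<one>")
    case True
    then show ?thesis using xs ev_c[OF alt_c[OF xs]] by auto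
  next
    case g1: False
    have gc: "g \<in> carrier G" using subgroup.mem_carrier[OF sub g] .
    show ?thesis
    proof (cases "xs \<noteq> [] \<and> fst (hd xs) = b")
      case False
      then have "alt ((b, g) # xs)" using xs g g1 by (cases xs) (auto simp: alt_def)
      then show ?thesis by (intro exI[of _ "(b, g) # xs"]) simp
    next
      case True
      then obtain h ys where h: "xs = (b, h) # ys" by (cases xs) auto
      have hs: "h \<in> syl b" "alt ys" "h \<in> carrier G" "ev ys \<in> carrier G"
        using xs alt_c[OF xs] ev_c[OF alt_c, of ys] unfolding h
        by (auto simp: alt_def successively_Cons)
      show ?thesis
      proof (cases "g \<otimes> h = \<one>")
        case True
        then have "g \<otimes> ev xs = ev ys" using h hs gc by (simp flip: m_assoc)
        then show ?thesis using hs by metis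
      next
        case False
        have "g \<otimes> h \<in> syl b" using subgroup.m_closed[OF sub g hs(1)] .
        then have "alt ((b, g \<otimes> h) # ys)" using xs False unfolding h by (auto simp: alt_def successively_Cons)
        moreover have "ev ((b, g \<otimes> h) # ys) = g \<otimes> ev xs" using h hs gc by (simp add: m_assoc)
        ultimately show ?thesis by blast
      qed
    qed
  qed
  have "v \<in> generate G (A \<union> K)" using gen v by simp
  then have "\<exists>xs. alt xs \<and> ev xs = v"
  proof (induction rule: generate.induct)
    case one
    show ?case by (intro exI[of _ "[]"]) (simp add: alt_def)
  next
    case (incl h)
    have "alt []" by (simp add: alt_def)
    moreover have "h \<in> syl (h \<in> A)" "h \<in> carrier G"
      using incl subgroup.mem_carrier[OF A] subgroup.mem_carrier[OF K] by (auto simp: syl_def)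
    ultimately show ?case using cons[of "[]" h] by (metis ev_simps(1) r_one)
  next
    case (inv h)
    have "alt []" by (simp add: alt_def)
    moreover have "inv h \<in> syl (h \<in> A)" "inv h \<in> carrier G"
      using inv subgroup.m_inv_closed[OF A] subgroup.m_inv_closed[OF K]
        subgroup.mem_carrier[OF A] subgroup.mem_carrier[OF K] by (auto simp: syl_def)
    ultimately show ?case using cons[of "[]" "inv h"] by (metis ev_simps(1) r_one)
  next
    case (eng h1 h2)
    then obtain xs ys where xy: "alt xs" "ev xs = h1" "alt ys" "ev ys = h2" by blast
    have "alt xs \<Longrightarrow> \<exists>zs. alt zs \<and> ev zs = ev xs \<otimes> ev ys" for xs
    proof (induction xs)
      case (Cons x xs)
      then have x: "alt xs" "snd x \<in> syl (fst x)" by (auto simp: alt_def successively_Cons)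
      then obtain zs where zs: "alt zs" "ev zs = ev xs \<otimes> ev ys" using Cons.IH by blast
      obtain zs' where "alt zs'" "ev zs' = snd x \<otimes> ev zs" using cons[OF zs(1) x(2)] by blast
      moreover have "snd x \<otimes> ev zs = ev (x # xs) \<otimes> ev ys"
        using zs(2) ev_c[OF alt_c[OF x(1)]] ev_c[OF alt_c[OF xy(3)]] alt_c[OF Cons.prems] by (simp add: m_assoc)
      ultimately show ?case by auto
    qed (use xy ev_c[OF alt_c] in auto)
    then show ?case using xy by metis
  qed
  then obtain xs where xs: "alt xs" "ev xs = v" by blast
  obtain h1 ys where h1: "h1 \<in> A" "alt ys" "v = h1 \<otimes> ev ys" "ys = [] \<or> \<not> fst (hd ys)"
  proof (cases "xs \<noteq> [] \<and> fst (hd xs)")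
    case True
    then obtain h ys where h: "xs = (True, h) # ys" by (cases xs) auto
    then show thesis using that[of h ys] xs by (cases ys) (auto simp: alt_def syl_def)
  next
    case False
    then show thesis using that[of \<one> xs] xs v subgroup.one_closed[OF A] by auto
  qed
  have ys0: "ys \<noteq> []" using h1 vA subgroup.mem_carrier[OF A] by auto
  obtain h2 ws where h2: "h2 \<in> A" "alt ws" "ev ys = ev ws \<otimes> h2" "ws \<noteq> []" "\<not> fst (hd ws)" "\<not> fst (last ws)"
  proof (cases "fst (last ys)")
    case True
    obtain ws z where wz: "ys = ws @ [z]" using ys0 by (metis rev_exhaust)
    then have z: "fst z" "snd z \<in> A" using True h1(2) by (auto simp: alt_def syl_def)
    have w0: "ws \<noteq> []" using h1(4) wz z by auto
    have "alt ws" "\<not> fst (last ws)" using h1(2) z w0 unfolding wz by (auto simp: alt_def successively_append_iff)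
    moreover have "ev ys = ev ws \<otimes> snd z"
      using ev_app[of ws "[z]"] alt_c[OF h1(2)] unfolding wz by simp
    moreover have "\<not> fst (hd ws)" using h1(4) w0 wz by auto
    ultimately show thesis using that[of "snd z" ws] z w0 by blast
  next
    case False
    then show thesis using that[of \<one> ys] h1 ys0 subgroup.one_closed[OF A] ev_c[OF alt_c[OF h1(2)]] by auto
  qed
  define ws' where "ws' = rev (map (\<lambda>x. (fst x, inv (snd x))) ws)"
  have wc: "\<forall>x\<in>set ws. snd x \<in> carrier G" by (rule alt_c[OF h2(2)])
  have ev_inv: "ev (rev (map (\<lambda>x. (fst x, inv (snd x))) us)) = inv (ev us)"
    if "\<forall>x\<in>set us. snd x \<in> carrier G" for us
    using that by (induction us) (auto simp: ev_app inv_mult_group ev_c)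
  have ws'c: "\<forall>x\<in>set ws'. snd x \<in> carrier G" using wc by (auto simp: ws'_def)
  \<comment> \<open>Conjugating \<open>v t v^-1 t^-1 = 1\<close> by \<open>h1\<close>, with
    \<open>v = h1 w h2\<close>, turns it into \<open>w t1 w^-1 t2 = 1\<close>.\<close>
  define t1 t2 where "t1 = h2 \<otimes> t \<otimes> inv h2" and "t2 = inv h1 \<otimes> inv t \<otimes> h1"
  have c: "h1 \<in> carrier G" "h2 \<in> carrier G" "t \<in> carrier G" using h1 h2 t subgroup.mem_carrier[OF A] by auto
  have t12: "t1 \<in> A" "t2 \<in> A" unfolding t1_def t2_def
    using h1(1) h2(1) t(1) subgroup.m_closed[OF A] subgroup.m_inv_closed[OF A] by auto
  have "t1 \<noteq> \<one>"
  proof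
    assume "t1 = \<one>"
    then have "inv h2 \<otimes> (h2 \<otimes> t \<otimes> inv h2) \<otimes> h2 = \<one>" using c by (simp add: t1_def)
    then show False using c t(2) by (simp add: m_assoc flip: m_assoc[of "inv h2" h2])
  qed
  moreover have "t2 \<noteq> \<one>"
  proof
    assume "t2 = \<one>"
    then have "h1 \<otimes> (inv h1 \<otimes> inv t \<otimes> h1) \<otimes> inv h1 = \<one>" using c by (simp add: t2_def)
    then have "inv t = \<one>" using c by (simp add: m_assoc flip: m_assoc[of h1 "inv h1"])
    then show False using c t(2) by (metis inv_inv inv_one)
  qed
  moreover have w'0: "ws' \<noteq> []" "fst (hd ws') = fst (last ws)" "fst (last ws') = fst (hd ws)"
    using h2(4) by (auto simp: ws'_def hd_rev last_rev last_map hd_map)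
  moreover have "alt ws'"
  proof -
    have "\<forall>x\<in>set ws'. snd x \<in> syl (fst x) - {\<one>}"
    proof
      fix x assume "x \<in> set ws'"
      then obtain y where y: "y \<in> set ws" "x = (fst y, inv (snd y))" by (auto simp: ws'_def)
      then have "snd y \<in> syl (fst y)" "snd y \<noteq> \<one>" "snd y \<in> carrier G" using h2(2) wc by (auto simp: alt_def)
      then show "snd x \<in> syl (fst x) - {\<one>}"
        using subgroup.m_inv_closed[OF sub] y(2) inv_inv[of "snd y"] by auto
    qed
    moreover have "successively (\<lambda>x y. fst x \<noteq> fst y) ws'"
      unfolding ws'_def successively_rev successively_map using h2(2) by (auto simp: alt_def elim!: successively_mono)
    ultimately show ?thesis by (simp add: alt_def)
  qed
  ultimately have "alt (ws @ [(True, t1)] @ ws' @ [(True, t2)])"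
    using h2 t12 by (auto simp: alt_def successively_append_iff successively_Cons syl_def)
  moreover have "ev (ws @ [(True, t1)] @ ws' @ [(True, t2)]) = \<one>"
  proof -
    define w where "w = ev ws"
    have w: "w \<in> carrier G" using ev_c[OF wc] by (simp add: w_def)
    have t1c: "t1 \<in> carrier G" "t2 \<in> carrier G" using t12 subgroup.mem_carrier[OF A] by auto
    have vv: "v = h1 \<otimes> w \<otimes> h2" using h1(3) h2(3) w c by (simp add: w_def m_assoc)
    have "ev (ws @ [(True, t1)] @ ws' @ [(True, t2)]) = w \<otimes> (t1 \<otimes> (inv w \<otimes> t2))"
      using ev_app[of ws "[(True, t1)] @ ws' @ [(True, t2)]"] ev_app[of ws' "[(True, t2)]"] wc ws'c t1c ev_inv[OF wc]
      by (simp add: w_def ws'_def[symmetric])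
    also have "\<dots> = inv h1 \<otimes> (v \<otimes> t) \<otimes> inv v \<otimes> inv t \<otimes> h1"
      using w c unfolding vv t1_def t2_def
      by (simp add: m_assoc inv_mult_group flip: m_assoc[of "inv h1" h1])
    also have "\<dots> = \<one>" using c v(1) unfolding v(2)
      by (simp add: m_assoc flip: m_assoc[of v "inv v"] m_assoc[of t "inv t"])
    finally show ?thesis .
  qed
  ultimately show False using free by blast
qed

section \<open>Graph distance\<close>

lemma walk_iff_relpowp:
  "(\<exists>xs. walk E xs \<and> hd xs = x \<and> last xs = y \<and> length xs = Suc n) \<longleftrightarrow> (adj E ^^ n) x y"
proof (induction n arbitrary: x)
  case 0
  show ?case
  proof
    assume "(adj E ^^ 0) x y"
    then have "walk E [x]" "x = y" by (auto simp: walk_def)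
    then show "\<exists>xs. walk E xs \<and> hd xs = x \<and> last xs = y \<and> length xs = Suc 0"
      by (intro exI[of _ "[x]"]) auto
  qed (auto simp: length_Suc_conv)
next
  case (Suc n)
  show ?case
  proof
    assume "\<exists>xs. walk E xs \<and> hd xs = x \<and> last xs = y \<and> length xs = Suc (Suc n)"
    then obtain xs where xs: "walk E xs" "hd xs = x" "last xs = y" "length xs = Suc (Suc n)" by blast
    then obtain z zs where z: "xs = x # z # zs" by (metis length_Suc_conv list.sel(1))
    have "adj E x z" using xs(1) z unfolding walk_def by force
    moreover have "walk E (z # zs)" using xs(1) z unfolding walk_def
      by (metis Suc_less_eq length_Cons list.distinct(1) nth_Cons_Suc)
    ultimately have "(adj E ^^ n) z y" "adj E x z" using Suc[of z] xs z by auto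
    then show "(adj E ^^ Suc n) x y" by (metis relpowp_Suc_I2)
  next
    assume "(adj E ^^ Suc n) x y"
    then obtain z where z: "adj E x z" "(adj E ^^ n) z y" by (metis relpowp_Suc_D2)
    then obtain xs where xs: "walk E xs" "hd xs = z" "last xs = y" "length xs = Suc n" using Suc by blast
    have "walk E (x # xs)"
      unfolding walk_def
    proof (intro conjI allI impI)
      fix i assume "Suc i < length (x # xs)"
      then show "adj E ((x # xs) ! i) ((x # xs) ! Suc i)"
        using xs z by (cases i) (auto simp: walk_def hd_conv_nth)
    qed simp
    moreover have "xs \<noteq> []" using xs by auto
    ultimately show "\<exists>xs. walk E xs \<and> hd xs = x \<and> last xs = y \<and> length xs = Suc (Suc n)"
      using xs by (intro exI[of _ "x # xs"]) auto
  qed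
qed

lemma graph_dist_relpowp: "graph_dist E x y = (LEAST n. (adj E ^^ n) x y)"
  unfolding graph_dist_def walk_iff_relpowp ..

lemma reachable_iff: "reachable E x y \<longleftrightarrow> (\<exists>n. (adj E ^^ n) x y)"
proof
  assume "reachable E x y"
  then obtain xs where xs: "walk E xs" "hd xs = x" "last xs = y" by (auto simp: reachable_def)
  then have "length xs = Suc (length xs - 1)" by (cases xs) (auto simp: walk_def)
  then show "\<exists>n. (adj E ^^ n) x y" using xs walk_iff_relpowp by metis
next
  assume "\<exists>n. (adj E ^^ n) x y"
  then show "reachable E x y" unfolding reachable_def using walk_iff_relpowp by metis
qed

lemma graph_dist_le: "(adj E ^^ n) x y \<Longrightarrow> graph_dist E x y \<le> n"
  unfolding graph_dist_relpowp by (rule Least_le)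

lemma graph_dist_attained: "reachable E x y \<Longrightarrow> (adj E ^^ graph_dist E x y) x y"
  unfolding graph_dist_relpowp reachable_iff by (rule LeastI_ex)

lemma relpowp_adj_sym: "(adj E ^^ n) x y \<Longrightarrow> (adj E ^^ n) y x"
proof (induction n arbitrary: x)
  case (Suc n)
  then obtain z where "adj E x z" "(adj E ^^ n) z y" by (metis relpowp_Suc_D2)
  then show ?case using Suc.IH adj_sym by (metis relpowp_Suc_I)
qed auto

lemma graph_dist_sym: "graph_dist E x y = graph_dist E y x"
  unfolding graph_dist_relpowp using relpowp_adj_sym by metis

lemma reachable_sym: "reachable E x y \<Longrightarrow> reachable E y x"
  unfolding reachable_iff using relpowp_adj_sym by metis

lemma reachable_trans: "reachable E x y \<Longrightarrow> reachable E y z \<Longrightarrow> reachable E x z"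
  unfolding reachable_iff using relpowp_trans by metis

lemma reachable_adj: "adj E x y \<Longrightarrow> reachable E x y"
  unfolding reachable_iff by (metis relpowp_1)

lemma reachable_refl [simp]: "reachable E x x"
  unfolding reachable_iff by (metis relpowp_0_I)

lemma graph_dist_triangle:
  "reachable E x y \<Longrightarrow> reachable E y z \<Longrightarrow> graph_dist E x z \<le> graph_dist E x y + graph_dist E y z"
  by (rule graph_dist_le, rule relpowp_trans) (rule graph_dist_attained, assumption)+

lemma graph_dist_self [simp]: "graph_dist E x x = 0"
  using graph_dist_le[of 0 E x x] by simp

lemma graph_dist_adj: "adj E x y \<Longrightarrow> graph_dist E x y \<le> 1"
  by (rule graph_dist_le) (simp only: relpowp_1)

lemma graph_dist_contract:
  assumes f: "\<And>u v. adj E u v \<Longrightarrow> f u = f v \<or> adj E (f u) (f v)" and r: "reachable E x y"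
  shows "graph_dist E (f x) (f y) \<le> graph_dist E x y"
proof -
  have "(adj E ^^ n) x y \<Longrightarrow> reachable E (f x) (f y) \<and> graph_dist E (f x) (f y) \<le> n" for n
  proof (induction n arbitrary: y)
    case (Suc n)
    then obtain z where z: "(adj E ^^ n) x z" "adj E z y" by auto
    have IH: "reachable E (f x) (f z)" "graph_dist E (f x) (f z) \<le> n" using Suc.IH[OF z(1)] by auto
    have 1: "reachable E (f z) (f y)" "graph_dist E (f z) (f y) \<le> 1"
      using f[OF z(2)] reachable_adj[of E "f z" "f y"] graph_dist_adj[of E "f z" "f y"] by auto
    show ?case using reachable_trans[OF IH(1) 1(1)] graph_dist_triangle[OF IH(1) 1(1)] IH(2) 1(2) by linarith
  qed auto
  then show ?thesis using graph_dist_attained[OF r] by blast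
qed

lemma walk_successively: "walk E xs \<longleftrightarrow> xs \<noteq> [] \<and> successively (adj E) xs"
  unfolding walk_def successively_conv_nth by auto

lemma circuit_rotate:
  assumes "circuit E (as @ bs)" shows "circuit E (bs @ as)"
proof (cases "as = [] \<or> bs = []")
  case False
  then show ?thesis using assms
    by (auto simp: circuit_def walk_successively successively_append_iff)
qed (use assms in auto)

lemma circuit_edges_subset: "e \<in> circuit_edges xs \<Longrightarrow> e \<subseteq> set xs"
proof -
  assume "e \<in> circuit_edges xs"
  then obtain i where i: "i < length xs" "e = {xs ! i, xs ! ((i + 1) mod length xs)}"
    by (auto simp: circuit_edges_def)
  then have "(i + 1) mod length xs < length xs" by (intro mod_less_divisor) linarith
  then show ?thesis using i by auto
qed

section \<open>The coned-off Cayley graph is hyperbolic\<close>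

locale sparse_racg = racg +
  assumes no_chord: "is_square E a b c d \<Longrightarrow> {a, b, c, d} \<subseteq> V \<Longrightarrow> \<not> adj E a c"
    and outside_square: "T \<in> squares V E \<Longrightarrow> e \<in> V - T \<Longrightarrow> p \<in> T \<Longrightarrow> q \<in> T \<Longrightarrow>
          adj E e p \<Longrightarrow> adj E e q \<Longrightarrow> p = q"
begin

lemma squares_subset: "T \<in> squares V E \<Longrightarrow> T \<subseteq> V"
  by (auto simp: squares_def)

text \<open>Two vertices with two common neighbours are opposite on a 4-cycle; a third common
  neighbour outside would have two neighbours on it.\<close>

lemma common_neighbours_square:
  assumes "a \<noteq> e" "c \<noteq> d" "adj E c a" "adj E c e" "adj E d a" "adj E d e" "{a, c, e, d} \<subseteq> V"
  shows "{a, c, e, d} \<in> squares V E" "\<And>f. f \<in> V \<Longrightarrow> adj E f a \<Longrightarrow> adj E f e \<Longrightarrow> f \<in> {a, c, e, d}"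
proof -
  have "is_square E a c e d" using assms adj_sym[of E] unfolding is_square_def by (auto simp: adj_def)
  then show sq: "{a, c, e, d} \<in> squares V E" unfolding squares_def using assms by blast
  show "f \<in> {a, c, e, d}" if "f \<in> V" "adj E f a" "adj E f e" for f
    using outside_square[OF sq, of f a e] that assms(1) by blast
qed

section \<open>Median-convex sets, closest pairs and walls between walls\<close>

definition conv :: "'a set \<Rightarrow> bool" where
  "conv A \<longleftrightarrow> A \<subseteq> carrier G \<and> (\<forall>x\<in>A. \<forall>z\<in>A. \<forall>y\<in>carrier G. med x y z \<in> A)"

text \<open>If \<open>z\<close> lay on the other side of \<open>u\<close>, the median of
  \<open>x\<close>, \<open>y\<close> and \<open>z\<close> would belong to \<open>A\<close> and would
  be closer to \<open>y\<close>, since \<open>u\<close> no longer separates it from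
  \<open>y\<close>.\<close>

lemma closest_pair_gate:
  assumes A: "conv A" and x: "x \<in> A" and y: "y \<in> carrier G"
    and min: "\<And>x'. x' \<in> A \<Longrightarrow> card (H x y) \<le> card (H x' y)"
    and u: "u \<in> H x y" and z: "z \<in> A"
  shows "(u \<in> N z) = (u \<in> N x)"
proof (rule ccontr)
  assume ne: "(u \<in> N z) \<noteq> (u \<in> N x)"
  have c: "x \<in> carrier G" "z \<in> carrier G" using A x z by (auto simp: conv_def)
  define m where "m = med x y z"
  have m: "m \<in> A" "m \<in> carrier G" using A x z y unfolding m_def conv_def by auto
  have Nm: "N m = N x \<inter> N y \<union> N y \<inter> N z \<union> N x \<inter> N z" using med(2)[OF c(1) y c(2)] m_def by simp
  have "H m y \<subseteq> H x y" unfolding H_def Nm by blast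
  moreover have "u \<notin> H m y" using u ne unfolding in_H Nm by blast
  ultimately have "H m y \<subset> H x y" using u by blast
  then have "card (H m y) < card (H x y)" using c y by (intro psubset_card_mono) auto
  then show False using min[OF m(1)] by simp
qed

text \<open>Minimising over both sets makes each point a gate for the other. This serves for
  disjoint half-spaces, where it finds a wall between two walls, and for two cosets of square
  subgroups.\<close>

lemma closest_pair:
  assumes A: "conv A" "A \<noteq> {}" and B: "conv B" "B \<noteq> {}"
  shows "\<exists>x\<in>A. \<exists>y\<in>B. \<forall>u\<in>H x y. (\<forall>z\<in>A. (u \<in> N z) = (u \<in> N x)) \<and> (\<forall>z\<in>B. (u \<in> N z) = (u \<in> N y))"
proof -
  obtain a b where "a \<in> A" "b \<in> B" using A B by auto
  then obtain p where p: "fst p \<in> A \<and> snd p \<in> B"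
    "\<And>p'. fst p' \<in> A \<and> snd p' \<in> B \<Longrightarrow> card (H (fst p) (snd p)) \<le> card (H (fst p') (snd p'))"
    using arg_min_nat_lemma[of "\<lambda>p. fst p \<in> A \<and> snd p \<in> B" "(a, b)" "\<lambda>p. card (H (fst p) (snd p))"] by auto
  define x y where "x = fst p" and "y = snd p"
  have xy: "x \<in> A" "y \<in> B" "x \<in> carrier G" "y \<in> carrier G" using p(1) A B by (auto simp: x_def y_def conv_def)
  have m: "card (H x y) \<le> card (H x' y')" if "x' \<in> A" "y' \<in> B" for x' y'
    using p(2)[of "(x', y')"] that by (simp add: x_def y_def)
  have "(u \<in> N z) = (u \<in> N x)" if "u \<in> H x y" "z \<in> A" for u z
    by (rule closest_pair_gate[OF A(1) xy(1,4) m[OF _ xy(2)] that])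
  moreover have "(u \<in> N z) = (u \<in> N y)" if "u \<in> H x y" "z \<in> B" for u z
  proof (rule closest_pair_gate[OF B(1) xy(2,3) _ _ that(2)])
    show "u \<in> H y x" using that H_sym by metis
    show "card (H y x) \<le> card (H y' x)" if "y' \<in> B" for y' using m[OF xy(1) that] H_sym by metis
  qed
  ultimately show ?thesis using xy by blast
qed

lemma conv_halfspace: "conv {x \<in> carrier G. (h \<in> N x) = p}"
  unfolding conv_def by (auto simp: med)

definition wall :: "'a \<Rightarrow> bool" where
  "wall h \<longleftrightarrow> (\<exists>x\<in>carrier G. \<exists>y\<in>carrier G. h \<in> H x y)"

lemma wallI: "x \<in> carrier G \<Longrightarrow> y \<in> carrier G \<Longrightarrow> h \<in> H x y \<Longrightarrow> wall h"
  unfolding wall_def by blast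

lemma wall_sides: "wall h \<Longrightarrow> \<exists>x\<in>carrier G. (h \<in> N x) = p"
  unfolding wall_def in_H by metis

lemma cross_wall: "cross t u \<Longrightarrow> wall t \<and> wall u"
  unfolding cross_def wall_def in_H by metis

lemma wall_lab: "wall h \<Longrightarrow> lab h \<in> V"
  unfolding wall_def using lab_in_V by blast

lemma cross_same_lab: "cross t u \<Longrightarrow> lab t \<noteq> lab u"
  using cross_adj adj_neq by metis

text \<open>An empty quadrant gives two disjoint half-spaces, and the walls between a closest pair
  of points separate them. These walls include \<open>h1\<close> and \<open>h2\<close>, so a
  geodesic between the points has at least two letters; successive letters differ, so some wall has
  another label than \<open>h1\<close>.\<close>

lemma between:
  assumes w: "wall h1" "wall h2" and ne: "h1 \<noteq> h2" and nc: "\<not> cross h1 h2"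
  shows "\<exists>h3 p q r. wall h3 \<and> lab h3 \<noteq> lab h1 \<and>
    (\<forall>x\<in>carrier G. (h1 \<in> N x) = p \<longrightarrow> (h3 \<in> N x) = r) \<and>
    (\<forall>x\<in>carrier G. (h2 \<in> N x) = q \<longrightarrow> (h3 \<in> N x) = (\<not> r))"
proof -
  obtain p q where pq: "\<And>x. x \<in> carrier G \<Longrightarrow> \<not> ((h1 \<in> N x) = p \<and> (h2 \<in> N x) = q)"
    using nc unfolding cross_def by blast
  define A where "A = {x \<in> carrier G. (h1 \<in> N x) = p}"
  define B where "B = {x \<in> carrier G. (h2 \<in> N x) = q}"
  have "A \<noteq> {}" "B \<noteq> {}" using w wall_sides by (auto simp: A_def B_def)
  then obtain x y where xy: "x \<in> A" "y \<in> B"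
    and sep: "\<forall>u\<in>H x y. (\<forall>z\<in>A. (u \<in> N z) = (u \<in> N x)) \<and> (\<forall>z\<in>B. (u \<in> N z) = (u \<in> N y))"
    using closest_pair[of A B] conv_halfspace unfolding A_def B_def by blast
  have c: "x \<in> carrier G" "y \<in> carrier G" using xy by (auto simp: A_def B_def)
  have h: "h1 \<in> H x y" "h2 \<in> H x y" using xy pq[OF c(1)] pq[OF c(2)] by (auto simp: A_def B_def in_H)
  have "\<exists>u\<in>H x y. lab u \<noteq> lab h1"
  proof (rule ccontr)
    assume "\<not> ?thesis"
    then have all: "lab u = lab h1" if "u \<in> H x y" for u using that by blast
    have "x \<noteq> y" using h by auto
    then obtain v where v: "v \<in> V" "cj x (s v) \<in> H x y" "H (x \<otimes> s v) y = H x y - {cj x (s v)}"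
      using geo_step[OF c] by auto
    have c': "x \<otimes> s v \<in> carrier G" using c v by simp
    have "h1 \<in> H (x \<otimes> s v) y \<or> h2 \<in> H (x \<otimes> s v) y" using v h ne by blast
    then have "x \<otimes> s v \<noteq> y" by auto
    then obtain v' where v': "v' \<in> V" "cj (x \<otimes> s v) (s v') \<in> H (x \<otimes> s v) y"
      using geo_step[OF c' c(2)] by auto
    then have 2: "cj (x \<otimes> s v) (s v') \<in> H x y" using v by simp
    have "v = v'" using all[OF v(2)] all[OF 2] lab_cj[OF c(1) v(1)] lab_cj[OF c' v'(1)] by simp
    then have "cj (x \<otimes> s v) (s v') = cj x (s v)" using c v by (simp add: cj_mult) (simp add: cj_def)
    then show False using v v' by simp
  qed
  then obtain u where u: "u \<in> H x y" "lab u \<noteq> lab h1" by auto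
  show ?thesis
  proof (intro exI conjI ballI impI)
    show "wall u" using wallI c u by blast
    show "lab u \<noteq> lab h1" by (rule u(2))
    fix z assume z: "z \<in> carrier G"
    show "(u \<in> N z) = (u \<in> N x)" if "(h1 \<in> N z) = p" using sep u z that by (simp add: A_def)
    show "(u \<in> N z) = (\<not> (u \<in> N x))" if "(h2 \<in> N z) = q" 
    proof -
      have "z \<in> B" using z that by (simp add: B_def)
      then have "(u \<in> N z) = (u \<in> N y)" using sep u(1) by blast
      then show ?thesis using u(1) unfolding in_H by blast
    qed
  qed
qed

text \<open>A wall crossing \<open>h1\<close> and \<open>h2\<close> has, on each of its sides,
  points of both half-spaces that \<open>h3\<close> separates.\<close>

lemma between_cross:
  assumes "wall h1" "wall h2" "h1 \<noteq> h2" "\<not> cross h1 h2"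
  shows "\<exists>h3. lab h3 \<noteq> lab h1 \<and> (\<forall>k. cross k h1 \<longrightarrow> cross k h2 \<longrightarrow> cross k h3)"
proof -
  obtain h3 p q r where h3: "lab h3 \<noteq> lab h1"
    "\<forall>x\<in>carrier G. (h1 \<in> N x) = p \<longrightarrow> (h3 \<in> N x) = r"
    "\<forall>x\<in>carrier G. (h2 \<in> N x) = q \<longrightarrow> (h3 \<in> N x) = (\<not> r)"
    using between[OF assms] by blast
  have "cross k h3" if k: "cross k h1" "cross k h2" for k
    unfolding cross_def
  proof (intro allI)
    fix i j
    obtain a where a: "a \<in> carrier G" "(k \<in> N a) = i" "(h1 \<in> N a) = p" using k(1) unfolding cross_def by blast
    obtain b where b: "b \<in> carrier G" "(k \<in> N b) = i" "(h2 \<in> N b) = q" using k(2) unfolding cross_def by blast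
    show "\<exists>x\<in>carrier G. (k \<in> N x) = i \<and> (h3 \<in> N x) = j"
      using a b h3 by (cases "j = r") blast+
  qed
  then show ?thesis using h3(1) by blast
qed

text \<open>With \<open>h3\<close> between \<open>h1\<close> and \<open>h2\<close>, all labels of
  \<open>K\<close> are common neighbours of two distinct vertices, the labels of \<open>h1\<close>
  and \<open>h3\<close>. Two different labels in \<open>K\<close> complete a 4-cycle, which then
  contains every common neighbour. If all labels coincide, \<open>k1\<close> and \<open>k2\<close>
  cannot cross; the wall between them has a second label and crosses \<open>h1\<close> and
  \<open>h3\<close>, so it completes the 4-cycle instead.\<close>

lemma common_crossers:
  assumes h: "h1 \<noteq> h2" "\<not> cross h1 h2"
    and K: "\<And>k. k \<in> K \<Longrightarrow> cross k h1 \<and> cross k h2"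
    and k: "k1 \<in> K" "k2 \<in> K" "k1 \<noteq> k2"
  shows "\<exists>T\<in>squares V E. lab ` K \<subseteq> T"
proof -
  have w: "wall h1" "wall h2" using K[OF k(1)] cross_wall by auto
  obtain h3 where h3: "lab h3 \<noteq> lab h1" "\<And>k. k \<in> K \<Longrightarrow> cross k h3"
    using between_cross[OF w h] K by blast
  define a e where "a = lab h1" and "e = lab h3"
  have ae: "a \<noteq> e" "a \<in> V" "e \<in> V" using h3 w(1) wall_lab cross_wall k(1) unfolding a_def e_def by auto
  have adj: "adj E (lab k) a" "adj E (lab k) e" "lab k \<in> V" if "k \<in> K" for k
    using K[OF that] h3(2)[OF that] cross_adj wall_lab cross_wall unfolding a_def e_def by blast+
  show ?thesis
  proof (cases "\<exists>k\<in>K. lab k \<noteq> lab k1")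
    case True
    then obtain k where k': "k \<in> K" "lab k \<noteq> lab k1" by auto
    have c: "{a, lab k, e, lab k1} \<subseteq> V" using ae adj k k' by auto
    note S = common_neighbours_square[OF ae(1) k'(2) adj(1,2)[OF k'(1)] adj(1,2)[OF k(1)] c]
    then show ?thesis using adj by (intro bexI[OF _ S(1)]) blast
  next
    case False
    then have all: "lab k = lab k1" if "k \<in> K" for k using that by blast
    have "\<not> cross k1 k2" using all[OF k(2)] cross_same_lab by metis
    then obtain k3 where k3: "lab k3 \<noteq> lab k1" "\<forall>k. cross k k1 \<longrightarrow> cross k k2 \<longrightarrow> cross k k3"
      using between_cross[of k1 k2] cross_wall K k by blast
    have "cross h1 k3" "cross h3 k3" using k3(2) K h3(2) k cross_sym by blast+
    then have a3: "adj E (lab k3) a" "adj E (lab k3) e" "lab k3 \<in> V"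
      using cross_adj cross_sym cross_wall wall_lab unfolding a_def e_def by blast+
    have c: "{a, lab k3, e, lab k1} \<subseteq> V" using ae adj k a3 by auto
    show ?thesis using common_neighbours_square(1)[OF ae(1) k3(1) a3(1,2) adj(1,2)[OF k(1)] c] all
      by (intro bexI) auto
  qed
qed

definition pw_cross :: "'a set \<Rightarrow> bool" where
  "pw_cross A \<longleftrightarrow> (\<forall>t\<in>A. \<forall>u\<in>A. t \<noteq> u \<longrightarrow> cross t u)"

text \<open>Crossing walls have adjacent, hence different labels, so \<open>lab\<close> is injective
  on the family. The multiples of \<open>card V\<close> in the hyperbolicity constants start
  here.\<close>

lemma pw_cross_card:
  assumes "pw_cross A" "\<And>t. t \<in> A \<Longrightarrow> wall t"
  shows "finite A" "card A \<le> card V"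
proof -
  have i: "inj_on lab A" using assms(1) cross_same_lab unfolding pw_cross_def inj_on_def by blast
  have s: "lab ` A \<subseteq> V" using assms(2) wall_lab by auto
  show "finite A" using i s finV by (metis finite_imageD finite_subset)
  show "card A \<le> card V" by (rule card_inj_on_le[OF i s finV])
qed

lemma crossI:
  assumes "a \<in> carrier G" "b \<in> carrier G" "c \<in> carrier G" "d \<in> carrier G"
    and "(t \<in> N a) = (t \<in> N b)" "(t \<in> N c) = (t \<in> N d)" "(t \<in> N a) \<noteq> (t \<in> N c)"
    and "(u \<in> N a) = (u \<in> N c)" "(u \<in> N b) = (u \<in> N d)" "(u \<in> N a) \<noteq> (u \<in> N b)"
  shows "cross t u"
  unfolding cross_def
proof (intro allI)
  fix p q
  have "\<exists>x\<in>{a, b, c, d}. (t \<in> N x) = p \<and> (u \<in> N x) = q"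
    using assms(5-) by (cases p; cases q) auto
  then show "\<exists>x\<in>carrier G. (t \<in> N x) = p \<and> (u \<in> N x) = q" using assms(1-4) by blast
qed

section \<open>The coned-off graph and projections to intervals\<close>

definition square_subgroups :: "'a set set" where "square_subgroups = parab ` squares V E"

definition coned_graph :: "('a + 'a set) set set" where "coned_graph = coned_edges G (s ` V) square_subgroups"

abbreviation pcoset where "pcoset x T \<equiv> l_coset G x (parab T)"

lemma in_coset:
  assumes T: "T \<subseteq> V" and x: "x \<in> carrier G"
  shows "z \<in> pcoset x T \<longleftrightarrow> z \<in> carrier G \<and> lab ` H x z \<subseteq> T"
proof
  assume "z \<in> pcoset x T"
  then obtain w where w: "w \<in> parab T" "z = x \<otimes> w" unfolding l_coset_def by auto
  then have "w \<in> carrier G" using parab_carrier[OF T] by auto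
  then show "z \<in> carrier G \<and> lab ` H x z \<subseteq> T" using w x parab_iff_lab[OF T x, of z] by simp
next
  assume z: "z \<in> carrier G \<and> lab ` H x z \<subseteq> T"
  then have "inv x \<otimes> z \<in> parab T" using parab_iff_lab[OF T x] by simp
  moreover have "z = x \<otimes> (inv x \<otimes> z)" using x z by simp
  ultimately show "z \<in> pcoset x T" unfolding l_coset_def by blast
qed

lemma self_in_coset: "T \<subseteq> V \<Longrightarrow> x \<in> carrier G \<Longrightarrow> x \<in> pcoset x T"
  by (simp add: in_coset)

lemma coset_eq:
  assumes "T \<subseteq> V" "x \<in> carrier G" "y \<in> carrier G" "lab ` H x y \<subseteq> T"
  shows "pcoset x T = pcoset y T"
proof -
  have "z \<in> pcoset x T \<longleftrightarrow> z \<in> pcoset y T" for z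
  proof -
    have "lab ` H x z \<subseteq> lab ` H x y \<union> lab ` H y z" "lab ` H y z \<subseteq> lab ` H x y \<union> lab ` H x z"
      using image_mono[OF H_triangle[of x z y], of lab] image_mono[OF H_triangle[of y z x], of lab]
      by (simp_all add: image_Un H_sym[of y x])
    then show ?thesis using in_coset[OF assms(1,2), of z] in_coset[OF assms(1,3), of z] 
      order_trans[OF _ Un_least[OF assms(4)]] by blast
  qed
  then show ?thesis by blast
qed

lemma adj_Inl_Inl:
  "adj coned_graph (Inl x) (Inl y) \<longleftrightarrow> x \<in> carrier G \<and> (\<exists>v\<in>V. y = x \<otimes> s v)"
proof
  assume "adj coned_graph (Inl x) (Inl y)"
  then obtain g v where g: "g \<in> carrier G" "v \<in> V" "{Inl x, Inl y} = {Inl g, Inl (g \<otimes> s v) :: 'a + 'a set}"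
    unfolding adj_def coned_graph_def coned_edges_def by auto
  then consider "x = g" "y = g \<otimes> s v" | "y = g" "x = g \<otimes> s v" by (auto simp: doubleton_eq_iff)
  then show "x \<in> carrier G \<and> (\<exists>v\<in>V. y = x \<otimes> s v)"
  proof cases
    case 2
    then have "y = x \<otimes> s v" using g by (simp add: m_assoc)
    then show ?thesis using g 2 by auto
  qed (use g in auto)
next
  assume "x \<in> carrier G \<and> (\<exists>v\<in>V. y = x \<otimes> s v)"
  then obtain v where v: "x \<in> carrier G" "v \<in> V" "y = x \<otimes> s v" by auto
  then have "x \<noteq> y" using H_edge[of x v] by auto
  then show "adj coned_graph (Inl x) (Inl y)" using v unfolding adj_def coned_graph_def coned_edges_def by auto
qed

lemma adj_Inl_Inr:
  "adj coned_graph (Inl x) (Inr F) \<longleftrightarrow> x \<in> carrier G \<and> (\<exists>T\<in>squares V E. F = pcoset x T)"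
  unfolding adj_def coned_graph_def coned_edges_def square_subgroups_def by (auto simp: doubleton_eq_iff)

lemma adj_Inr_Inr: "\<not> adj coned_graph (Inr F) (Inr F')"
  unfolding adj_def coned_graph_def coned_edges_def by (auto simp: doubleton_eq_iff)

abbreviation cdist :: "'a \<Rightarrow> 'a \<Rightarrow> nat" where "cdist x y \<equiv> graph_dist coned_graph (Inl x) (Inl y)"

lemma cdist_card:
  assumes "x \<in> carrier G" "y \<in> carrier G"
  shows "reachable coned_graph (Inl x) (Inl y) \<and> cdist x y \<le> card (H x y)"
  using assms
proof (induction rule: geo_induct)
  case (step x v)
  have a: "adj coned_graph (Inl x) (Inl (x \<otimes> s v))" using step by (auto simp: adj_Inl_Inl)
  then have r: "reachable coned_graph (Inl x) (Inl (x \<otimes> s v))" "cdist x (x \<otimes> s v) \<le> 1"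
    by (rule reachable_adj, rule graph_dist_adj)
  have "card (H x y) = Suc (card (H (x \<otimes> s v) y))"
    using step(3,4) card_Suc_Diff1[of "H x y" "cj x (s v)"] step(1) assms(2) by simp
  then show ?case using reachable_trans[OF r(1)] graph_dist_triangle[OF r(1)] step.IH r(2) by fastforce
qed simp

lemma cdist_triangle:
  assumes "x \<in> carrier G" "y \<in> carrier G" "z \<in> carrier G"
  shows "cdist x z \<le> cdist x y + cdist y z"
  by (rule graph_dist_triangle) (use cdist_card assms in auto)

lemma cdist_sym: "cdist x y = cdist y x"
  by (rule graph_dist_sym)

lemma cdist_square:
  assumes T: "T \<in> squares V E" and x: "x \<in> carrier G" and y: "y \<in> carrier G" and l: "lab ` H x y \<subseteq> T"
  shows "cdist x y \<le> 2"
proof -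
  have "pcoset x T = pcoset y T" using coset_eq squares_subset[OF T] x y l by blast
  then have "adj coned_graph (Inl x) (Inr (pcoset x T))" "adj coned_graph (Inl y) (Inr (pcoset x T))"
    using adj_Inl_Inr T x y by blast+
  then have "adj coned_graph (Inl x) (Inr (pcoset x T))" "adj coned_graph (Inr (pcoset x T)) (Inl y)"
    using adj_sym by metis+
  then have "(adj coned_graph ^^ 2) (Inl x) (Inl y)" by (metis numeral_2_eq_2 relpowp_1 One_nat_def relpowp_Suc_I)
  then show ?thesis by (rule graph_dist_le)
qed

lemma coned_vertex_cases:
  assumes "v \<in> coned_vertices G square_subgroups"
  shows "\<exists>x\<in>carrier G. v = Inl x \<or> adj coned_graph v (Inl x)"
proof -
  from assms consider x where "x \<in> carrier G" "v = Inl x"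
    | g T where "g \<in> carrier G" "T \<in> squares V E" "v = Inr (pcoset g T)"
    unfolding coned_vertices_def square_subgroups_def by auto
  then show ?thesis
  proof cases
    case 2
    then have "adj coned_graph (Inl g) v" by (auto simp: adj_Inl_Inr)
    then show ?thesis using adj_sym 2(1) by metis
  qed auto
qed

text \<open>All points of a coset of a parabolic subgroup are projected into one coset of the same subgroup.\<close>

lemma cdist_med:
  assumes a: "a \<in> carrier G" and b: "b \<in> carrier G" and x: "x \<in> carrier G" and y: "y \<in> carrier G"
  shows "cdist (med a b x) (med a b y) \<le> cdist x y"
proof -
  \<comment> \<open>A cone vertex is given only as a set, so a base point and a square are chosen
    for it. The chosen square need not be the one an edge came from; the edge condition is therefore
    checked for the chosen one.\<close>
  define f :: "'a + 'a set \<Rightarrow> 'a + 'a set" where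
    "f = case_sum (\<lambda>g. Inl (med a b g))
       (\<lambda>F. let (g, T) = (SOME (g, T). g \<in> carrier G \<and> T \<in> squares V E \<and> F = pcoset g T)
             in Inr (pcoset (med a b g) T))"
  have Hm: "H (med a b g) (med a b h) \<subseteq> H g h" if "g \<in> carrier G" "h \<in> carrier G" for g h
    unfolding H_def med(2)[OF a b that(1)] med(2)[OF a b that(2)] by blast
  have LR: "f (Inl g) = f (Inr F) \<or> adj coned_graph (f (Inl g)) (f (Inr F))" if ad: "adj coned_graph (Inl g) (Inr F)" for g F
  proof -
    obtain T where T: "g \<in> carrier G" "T \<in> squares V E" "F = pcoset g T" using ad unfolding adj_Inl_Inr by auto
    define p where "p = (SOME (g, T). g \<in> carrier G \<and> T \<in> squares V E \<and> F = pcoset g T)"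
    have "case p of (g, T) \<Rightarrow> g \<in> carrier G \<and> T \<in> squares V E \<and> F = pcoset g T"
      unfolding p_def by (rule someI[of _ "(g, T)"]) (use T in simp)
    then obtain h U where hU: "p = (h, U)" "h \<in> carrier G" "U \<in> squares V E" "F = pcoset h U" by auto
    have U: "U \<subseteq> V" using squares_subset hU by blast
    have fF: "f (Inr F) = Inr (pcoset (med a b h) U)" unfolding f_def using hU(1) p_def by simp
    have "g \<in> pcoset h U" using T hU(4) self_in_coset[OF squares_subset[OF T(2)] T(1)] by simp
    then have "lab ` H h g \<subseteq> U" using in_coset[OF U hU(2)] by simp
    then have "lab ` H (med a b h) (med a b g) \<subseteq> U" using Hm[OF hU(2) T(1)] by blast
    then have "pcoset (med a b h) U = pcoset (med a b g) U" by (rule coset_eq[OF U med(1)[OF a b hU(2)] med(1)[OF a b T(1)]])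
    then have "adj coned_graph (Inl (med a b g)) (Inr (pcoset (med a b h) U))"
      unfolding adj_Inl_Inr using med(1)[OF a b T(1)] hU(3) by blast
    then show ?thesis unfolding fF by (simp add: f_def)
  qed
  have LL: "f (Inl g) = f (Inl h) \<or> adj coned_graph (f (Inl g)) (f (Inl h))" if ad: "adj coned_graph (Inl g) (Inl h)" for g h
  proof -
    obtain v where v: "g \<in> carrier G" "v \<in> V" "h = g \<otimes> s v" using ad unfolding adj_Inl_Inl by auto
    have h: "h \<in> carrier G" using v by simp
    have mg: "med a b g \<in> carrier G" and mh: "med a b h \<in> carrier G" using med(1)[OF a b] v h by auto
    have sub: "H (med a b g) (med a b h) \<subseteq> {cj g (s v)}" using Hm[OF v(1) h] H_edge[OF v(1,2)] v(3) by simp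
    show ?thesis
    proof (cases "med a b g = med a b h")
      case False
      obtain w where w: "w \<in> V" "cj (med a b g) (s w) \<in> H (med a b g) (med a b h)"
        "H (med a b g \<otimes> s w) (med a b h) = H (med a b g) (med a b h) - {cj (med a b g) (s w)}"
        using geo_step[OF mg mh False] by auto
      have "cj (med a b g) (s w) = cj g (s v)" using sub w(2) by blast
      then have "H (med a b g) (med a b h) \<subseteq> {cj (med a b g) (s w)}" using sub by simp
      then have "H (med a b g \<otimes> s w) (med a b h) = {}" unfolding w(3) by auto
      then have "med a b h = med a b g \<otimes> s w" using H_eq_empty[of "med a b g \<otimes> s w"] mg mh w(1) by simp
      then show ?thesis using w mg by (auto simp: f_def adj_Inl_Inl)
    qed (simp add: f_def)
  qed
  have "f u = f v \<or> adj coned_graph (f u) (f v)" if "adj coned_graph u v" for u v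
    using that LL LR adj_Inr_Inr adj_sym[of coned_graph] by (cases u; cases v) metis+
  then have "graph_dist coned_graph (f (Inl x)) (f (Inl y)) \<le> cdist x y"
    by (rule graph_dist_contract) (use cdist_card x y in auto)
  then show ?thesis by (simp add: f_def)
qed

text \<open>Either at most one wall separates the points, or all separating walls have labels on one
  4-cycle and a single cone vertex is adjacent to both points.\<close>

lemma few_crossers:
  assumes "a \<in> carrier G" "b \<in> carrier G" "h1 \<noteq> h2" "\<not> cross h1 h2"
    and K: "\<And>k. k \<in> H a b \<Longrightarrow> cross k h1 \<and> cross k h2"
  shows "cdist a b \<le> 2"
proof (cases "\<exists>k1\<in>H a b. \<exists>k2\<in>H a b. k1 \<noteq> k2")
  case True
  then obtain T where "T \<in> squares V E" "lab ` H a b \<subseteq> T"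
    using common_crossers[OF assms(3,4) K] by blast
  then show ?thesis using cdist_square assms by blast
next
  case False
  then have "card (H a b) \<le> 1" using assms(1,2) by (metis card_le_Suc0_iff_eq One_nat_def finite_H)
  then show ?thesis using cdist_card[OF assms(1,2)] by simp
qed

text \<open>A discrete intermediate value argument. Cone vertices are never adjacent, so successive
  group elements on a path are at most 2 steps apart, which bounds the step at which
  \<open>P\<close> is lost.\<close>

lemma discrete_crossing:
  assumes "(adj coned_graph ^^ n) (Inl x) (Inl y)" "P x" "\<not> P y"
  shows "\<exists>p q i j k. i + j + k = n \<and> (adj coned_graph ^^ i) (Inl x) (Inl p) \<and> (adj coned_graph ^^ j) (Inl p) (Inl q)
     \<and> j \<le> 2 \<and> (adj coned_graph ^^ k) (Inl q) (Inl y) \<and> P p \<and> \<not> P q"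
  using assms
proof (induction n arbitrary: x rule: less_induct)
  case (less n)
  have "n \<noteq> 0" using less.prems by (intro notI) auto
  then obtain m where n: "n = Suc m" by (cases n) auto
  then obtain w where w: "adj coned_graph (Inl x) w" "(adj coned_graph ^^ m) w (Inl y)" using less.prems(1) by (metis relpowp_Suc_D2)
  have main: ?case if z: "(adj coned_graph ^^ j) (Inl x) (Inl z)" "(adj coned_graph ^^ k) (Inl z) (Inl y)" "j + k = n" "0 < j" "j \<le> 2" for j k z
  proof (cases "P z")
    case True
    have "k < n" using z by simp
    then obtain p q i j' k' where "i + j' + k' = k" "(adj coned_graph ^^ i) (Inl z) (Inl p)"
      and r: "(adj coned_graph ^^ j') (Inl p) (Inl q)"
      "j' \<le> 2" "(adj coned_graph ^^ k') (Inl q) (Inl y)" "P p" "\<not> P q"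
      using less.IH z(2) True less.prems(3) by blast
    then have "(adj coned_graph ^^ (j + i)) (Inl x) (Inl p)" "(j + i) + j' + k' = n"
      using relpowp_trans[OF z(1)] z(3) by auto
    then show ?thesis using r by blast
  next
    case False
    have "(adj coned_graph ^^ 0) (Inl x) (Inl x)" by simp
    then show ?thesis using z less.prems(2) False add_0 by metis
  qed
  show ?case
  proof (cases w)
    case (Inl z)
    then have "(adj coned_graph ^^ 1) (Inl x) (Inl z)" using w by (simp only: relpowp_1)
    then show ?thesis using main[of 1 z m] w Inl n by simp
  next
    case (Inr F)
    have "m \<noteq> 0" using w Inr by (intro notI) auto
    then obtain l where l: "m = Suc l" by (cases m) auto
    then obtain w' where w': "adj coned_graph w w'" "(adj coned_graph ^^ l) w' (Inl y)" using w(2) by (metis relpowp_Suc_D2)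
    then obtain z where z: "w' = Inl z" using Inr adj_Inr_Inr by (cases w') auto
    have "(adj coned_graph ^^ 2) (Inl x) (Inl z)"
      using w w' z by (metis numeral_2_eq_2 relpowp_1 One_nat_def relpowp_Suc_I)
    then show ?thesis using main[of 2 z l] w' z n l by simp
  qed
qed

lemma cdist_pw_cross:
  assumes "x \<in> carrier G" "y \<in> carrier G" "pw_cross (H x y)"
  shows "cdist x y \<le> card V"
  using pw_cross_card(2)[OF assms(3)] wallI[OF assms(1,2)] cdist_card[OF assms(1,2)] by fastforce

text \<open>Along a coned-off geodesic from x to y, the walls of H x m that are not yet crossed all cross the walls of
  H m y that are already crossed. At the point where the former become pairwise crossing, the latter still take
  boundedly many steps.\<close>

lemma cdist_almost_additive:
  assumes x: "x \<in> carrier G" and y: "y \<in> carrier G" and m: "m \<in> carrier G" and sub: "H x m \<subseteq> H x y"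
  shows "cdist x m + cdist m y \<le> cdist x y + 2 * (card V + 4)"
proof (cases "pw_cross (H x m)")
  case True
  then have "cdist x m \<le> card V" using cdist_pw_cross x m by blast
  moreover have "cdist m y \<le> cdist m x + cdist x y" using cdist_triangle m x y by blast
  ultimately show ?thesis using cdist_sym[of m x] by simp
next
  case False
  \<comment> \<open>The walls of \<open>H x m\<close> that still separate \<open>p\<close> from
    \<open>m\<close>. None is left at \<open>y\<close>, because each of them separates
    \<open>x\<close> from \<open>y\<close> as well.\<close>
  define U where "U p = H x m \<inter> H p m" for p
  have Ux: "\<not> pw_cross (U x)" using False by (simp add: U_def)
  have "H x m \<inter> H y m = {}" using sub unfolding H_def by blast
  then have Uy: "pw_cross (U y)" by (simp add: U_def pw_cross_def)
  have geo: "(adj coned_graph ^^ cdist x y) (Inl x) (Inl y)" by (rule graph_dist_attained) (use cdist_card[OF x y] in blast)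
  have "\<exists>p q i j k. i + j + k = cdist x y \<and> (adj coned_graph ^^ i) (Inl x) (Inl p) \<and> (adj coned_graph ^^ j) (Inl p) (Inl q)
     \<and> j \<le> 2 \<and> (adj coned_graph ^^ k) (Inl q) (Inl y) \<and> \<not> pw_cross (U p) \<and> \<not> \<not> pw_cross (U q)"
    by (rule discrete_crossing[where P = "\<lambda>p. \<not> pw_cross (U p)", OF geo Ux]) (use Uy in simp)
  then obtain p q i j k where pq': "i + j + k = cdist x y \<and> (adj coned_graph ^^ i) (Inl x) (Inl p) \<and> (adj coned_graph ^^ j) (Inl p) (Inl q)
     \<and> j \<le> 2 \<and> (adj coned_graph ^^ k) (Inl q) (Inl y) \<and> \<not> pw_cross (U p) \<and> \<not> \<not> pw_cross (U q)"
    by (elim exE) (rule that)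
  then have ijk: "i + j + k = cdist x y" "j \<le> 2"
    "(adj coned_graph ^^ i) (Inl x) (Inl p)" "(adj coned_graph ^^ j) (Inl p) (Inl q)" "(adj coned_graph ^^ k) (Inl q) (Inl y)"
    and pq: "\<not> pw_cross (U p)" "pw_cross (U q)" by simp_all
  have car: "g \<in> carrier G" if gh: "(adj coned_graph ^^ l) (Inl h) (Inl g)" "h \<in> carrier G" for l g h
  proof (cases l)
    case (Suc l')
    then obtain w where w: "adj coned_graph w (Inl g)" using gh(1) by auto
    then have "adj coned_graph (Inl g) w" by (simp add: adj_sym[of coned_graph w])
    then show ?thesis by (cases w) (auto simp: adj_Inl_Inl adj_Inl_Inr)
  qed (use gh in auto)
  have p: "p \<in> carrier G" using car ijk(3) x by blast
  have q: "q \<in> carrier G" using car ijk(4) p by blast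
  have d: "cdist p q \<le> 2" "cdist x q \<le> i + j" "cdist q y \<le> k"
    using graph_dist_le[OF ijk(4)] ijk graph_dist_le[OF relpowp_trans[OF ijk(3,4)]] graph_dist_le[OF ijk(5)] by auto
  obtain h1 h2 where h: "h1 \<in> U p" "h2 \<in> U p" "h1 \<noteq> h2" "\<not> cross h1 h2" using pq(1) unfolding pw_cross_def by blast
  define p2 where "p2 = med m y p"
  define q2 where "q2 = med m y q"
  define q1 where "q1 = med x y q"
  have c: "p2 \<in> carrier G" "q2 \<in> carrier G" "q1 \<in> carrier G" using med(1) x y m p q by (auto simp: p2_def q2_def q1_def)
  have N2: "N p2 = N m \<inter> N y \<union> N y \<inter> N p \<union> N m \<inter> N p" using med(2)[OF m y p] by (simp add: p2_def)
  have N3: "N q2 = N m \<inter> N y \<union> N y \<inter> N q \<union> N m \<inter> N q" using med(2)[OF m y q] by (simp add: q2_def)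
  have N4: "N q1 = N x \<inter> N y \<union> N y \<inter> N q \<union> N x \<inter> N q" using med(2)[OF x y q] by (simp add: q1_def)
  \<comment> \<open>\<open>k\<close> separates \<open>x\<close> and \<open>m\<close> from
    \<open>p\<close> and \<open>y\<close>, while \<open>t\<close> separates \<open>x\<close> and
    \<open>p\<close> from \<open>m\<close> and \<open>y\<close>; so the four points occupy the four
    quadrants.\<close>
  have "cross k t" if k: "k \<in> H m p2" and t: "t \<in> U p" for k t
  proof -
    have "k \<in> H m y" "k \<in> H m p" using k unfolding H_def N2 by blast+
    moreover have "k \<in> H x m \<Longrightarrow> k \<in> H x y" "t \<in> H x y" using sub t unfolding U_def by blast+
    moreover have "t \<in> H x m" "t \<in> H p m" using t by (auto simp: U_def)
    ultimately show ?thesis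
      by (intro crossI[of x m p y]) (use x m p y in \<open>auto simp: in_H\<close>)
  qed
  then have "cdist m p2 \<le> 2" using few_crossers[OF m c(1) h(3,4)] h(1,2) by blast
  moreover have "cdist p2 q2 \<le> 2" using cdist_med[OF m y p q] d(1) unfolding p2_def q2_def by simp
  moreover have "cdist m q2 \<le> cdist m p2 + cdist p2 q2" using cdist_triangle m c by blast
  moreover have "H q2 q1 \<subseteq> U q" using sub unfolding H_def U_def N3 N4 by blast
  then have "pw_cross (H q2 q1)" using pq(2) unfolding pw_cross_def by blast
  then have "cdist q2 q1 \<le> card V" using cdist_pw_cross c by blast
  moreover have "cdist m q1 \<le> cdist m q2 + cdist q2 q1" using cdist_triangle m c by blast
  \<comment> \<open>The stretches from \<open>m\<close> to \<open>p2\<close>, from \<open>p2\<close>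
    to \<open>q2\<close> and from \<open>q2\<close> to \<open>q1\<close> cost at most 2, 2 and
    \<open>card V\<close>.\<close>
  ultimately have mq: "cdist m q1 \<le> card V + 4" by simp
  have "med x y x = x" "med x y y = y"
  proof -
    have "N (med x y x) = N x" "N (med x y y) = N y" using med(2)[OF x y x] med(2)[OF x y y] by auto
    then have "H (med x y x) x = {}" "H (med x y y) y = {}" by (auto simp: H_def)
    then show "med x y x = x" "med x y y = y" using H_eq_empty med(1) x y by auto
  qed
  then have "cdist x q1 \<le> cdist x q" "cdist q1 y \<le> cdist q y"
    using cdist_med[OF x y x q] cdist_med[OF x y q y] by (auto simp: q1_def)
  moreover have "cdist x m \<le> cdist x q1 + cdist q1 m" "cdist m y \<le> cdist m q1 + cdist q1 y" using cdist_triangle m c x y by blast+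
  ultimately have "cdist x m \<le> (i + j) + (card V + 4)" "cdist m y \<le> (card V + 4) + k"
    using mq d(2,3) cdist_sym[of q1 m] by linarith+
  then show ?thesis unfolding ijk(1)[symmetric] by simp
qed

text \<open>The hypothesis says that no wall separates one of the four points from the other three; then walls that
  split the quadruple differently cross.\<close>

lemma box_four_point:
  assumes c: "a \<in> carrier G" "b \<in> carrier G" "c \<in> carrier G" "d \<in> carrier G" and box: "H a b = H c d"
  shows "cdist a b + cdist c d \<le> max (cdist a c + cdist b d) (cdist a d + cdist b c) + (4 * card V + 4)"
proof -
  have bx: "((t \<in> N a) \<noteq> (t \<in> N b)) = ((t \<in> N c) \<noteq> (t \<in> N d))" for t
    using box in_H[of t a b] in_H[of t c d] by simp
  \<comment> \<open>The walls are sorted by how they split the points: \<open>A\<close> separates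
    \<open>a\<close>, \<open>b\<close> from \<open>c\<close>, \<open>d\<close>; \<open>B\<close>
    separates \<open>a\<close>, \<open>c\<close> from \<open>b\<close>, \<open>d\<close>;
    \<open>C\<close> separates \<open>a\<close>, \<open>d\<close> from \<open>b\<close>,
    \<open>c\<close>. Each side of the box consists of two of these families.\<close>
  define A B C where "A = H a c \<inter> H a d" and "B = H a b \<inter> H a d" and "C = H a b \<inter> H a c"
  have AB: "cross t u" if "t \<in> A" "u \<in> B" for t u
    by (rule crossI[of a b c d]) (use that c bx[of t] bx[of u] in \<open>auto simp: A_def B_def in_H\<close>)
  have AC: "cross t u" if "t \<in> A" "u \<in> C" for t u
    by (rule crossI[of a b d c]) (use that c bx[of t] bx[of u] in \<open>auto simp: A_def C_def in_H\<close>)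
  have BC: "cross t u" if "t \<in> B" "u \<in> C" for t u
    by (rule crossI[of a c d b]) (use that c bx[of t] bx[of u] in \<open>auto simp: B_def C_def in_H\<close>)
  have split: "t \<in> H a b \<longleftrightarrow> t \<in> B \<union> C" "t \<in> H c d \<longleftrightarrow> t \<in> B \<union> C"
    "t \<in> H a c \<longleftrightarrow> t \<in> A \<union> C" "t \<in> H b d \<longleftrightarrow> t \<in> A \<union> C"
    "t \<in> H a d \<longleftrightarrow> t \<in> A \<union> B" "t \<in> H b c \<longleftrightarrow> t \<in> A \<union> B" for t
    using bx[of t] unfolding A_def B_def C_def by (auto simp: in_H)
  then have Hab: "H a b = B \<union> C" "H c d = B \<union> C" and Hac: "H a c = A \<union> C" "H b d = A \<union> C"
    and Had: "H a d = A \<union> B" "H b c = A \<union> B"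
    by blast+
  have tri: "cdist a b \<le> cdist a c + cdist c b" "cdist c d \<le> cdist c a + cdist a d" "cdist a b \<le> cdist a d + cdist d b"
      "cdist c d \<le> cdist c b + cdist b d" "cdist c d \<le> cdist c a + cdist a d"
    using cdist_triangle c by blast+
  have sym: "cdist c b = cdist b c" "cdist c a = cdist a c" "cdist d b = cdist b d" by (rule cdist_sym)+
  \<comment> \<open>A non-crossing pair in one family is crossed by all walls of the other two, so
    the sides made of those two have length at most 2. If all families are pairwise crossing, the
    two sides on the left have at most \<open>2 * card V\<close> walls each.\<close>
  consider "\<not> pw_cross A" | "\<not> pw_cross B" | "\<not> pw_cross C" | "pw_cross A" "pw_cross B" "pw_cross C" by blast
  then show ?thesis
  proof cases
    case 1
    then obtain h1 h2 where h: "h1 \<in> A" "h2 \<in> A" "h1 \<noteq> h2" "\<not> cross h1 h2" unfolding pw_cross_def by blast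
    have "cross k h1 \<and> cross k h2" if "k \<in> B \<union> C" for k using that AB AC h cross_sym by blast
    then have "cdist a b \<le> 2" "cdist c d \<le> 2" using few_crossers[OF _ _ h(3,4)] c Hab by blast+
    then show ?thesis by linarith
  next
    case 2
    then obtain h1 h2 where h: "h1 \<in> B" "h2 \<in> B" "h1 \<noteq> h2" "\<not> cross h1 h2" unfolding pw_cross_def by blast
    have "cross k h1 \<and> cross k h2" if "k \<in> A \<union> C" for k using that AB BC h cross_sym by blast
    then have "cdist a c \<le> 2" "cdist b d \<le> 2" using few_crossers[OF _ _ h(3,4)] c Hac by blast+
    then show ?thesis using tri(1,2) sym by linarith
  next
    case 3
    then obtain h1 h2 where h: "h1 \<in> C" "h2 \<in> C" "h1 \<noteq> h2" "\<not> cross h1 h2" unfolding pw_cross_def by blast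
    have "cross k h1 \<and> cross k h2" if "k \<in> A \<union> B" for k using that AC BC h cross_sym by blast
    then have "cdist a d \<le> 2" "cdist b c \<le> 2" using few_crossers[OF _ _ h(3,4)] c Had by blast+
    then show ?thesis using tri(3,5) sym by linarith
  next
    case 4
    have "card B \<le> card V" "card C \<le> card V"
      using 4 pw_cross_card(2) Hab wallI[OF c(1,2)] by blast+
    then have "card (B \<union> C) \<le> 2 * card V" using card_Un_le[of B C] by linarith
    then have "cdist a b \<le> 2 * card V" "cdist c d \<le> 2 * card V"
      using cdist_card[OF c(1,2)] cdist_card[OF c(3,4)] Hab by auto
    then show ?thesis by linarith
  qed
qed

text \<open>The corner next to x of the box spanned by four points: c lies on the side of x of every wall, except for the
  walls that separate x from the three other points.\<close>

definition corner :: "'a \<Rightarrow> 'a \<Rightarrow> 'a \<Rightarrow> 'a \<Rightarrow> 'a \<Rightarrow> bool" where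
  "corner x y z w c \<longleftrightarrow> c \<in> carrier G \<and> N c = N x \<inter> (N y \<union> N z \<union> N w) \<union> N y \<inter> N z \<inter> N w"

lemma corner_exists:
  assumes "x \<in> carrier G" "y \<in> carrier G" "z \<in> carrier G" "w \<in> carrier G"
  shows "\<exists>c. corner x y z w c"
proof (intro exI)
  \<comment> \<open>A vote among the four points in which \<open>x\<close> counts twice; the
    majority of the three medians containing \<open>x\<close> computes it.\<close>
  show "corner x y z w (med (med x y z) (med x y w) (med x z w))"
    unfolding corner_def using assms by (auto simp: med)
qed

text \<open>Both corners lie in this order on a geodesic from \<open>x\<close> to \<open>y\<close>.
  Almost additivity is used twice, which doubles its constant
  \<open>2 * (card V + 4)\<close>.\<close>

lemma cdist_corner:
  assumes "x \<in> carrier G" "y \<in> carrier G" "corner x y z w c" "corner y x z w d"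
  shows "cdist x c + cdist c d + cdist y d \<le> cdist x y + (4 * card V + 16)"
proof -
  have cc: "c \<in> carrier G" "d \<in> carrier G" using assms by (auto simp: corner_def)
  have "H x c \<subseteq> H x y" "H c d \<subseteq> H c y" using assms(3,4) unfolding corner_def H_def by auto
  then have "cdist x c + cdist c y \<le> cdist x y + 2 * (card V + 4)" "cdist c d + cdist d y \<le> cdist c y + 2 * (card V + 4)"
    using cdist_almost_additive assms(1,2) cc by blast+
  then show ?thesis using cdist_sym[of y d] by (simp add: algebra_simps)
qed

text \<open>Up to constants, each of the six distances is a side of the box of corners plus the legs
  from its two endpoints to their corners. All four legs occur once in each of the three sums, so
  only the box matters. The constant adds the box constant to twice that of
  \<open>cdist_corner\<close>.\<close>

lemma four_point:
  assumes c: "x \<in> carrier G" "y \<in> carrier G" "z \<in> carrier G" "w \<in> carrier G"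
  shows "cdist x y + cdist z w \<le> max (cdist x z + cdist y w) (cdist x w + cdist y z) + (12 * card V + 36)"
proof -
  obtain x' where x': "corner x y z w x'" using corner_exists c by blast
  obtain y' where y': "corner y x z w y'" using corner_exists c by blast
  obtain z' where z': "corner z w x y z'" using corner_exists c by blast
  obtain w' where w': "corner w z x y w'" using corner_exists c by blast
  have cc: "x' \<in> carrier G" "y' \<in> carrier G" "z' \<in> carrier G" "w' \<in> carrier G"
    using x' y' z' w' by (auto simp: corner_def)
  have "H x' y' = H z' w'" using x' y' z' w' unfolding corner_def H_def by auto
  note B = box_four_point[OF cc this]
  have "corner x z y w x'" "corner z x y w z'" "corner y w x z y'" "corner w y x z w'"
    "corner x w y z x'" "corner w x y z w'" "corner y z x w y'" "corner z y x w z'"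
    using x' y' z' w' by (auto simp: corner_def)
  then have "cdist x x' + cdist x' z' + cdist z z' \<le> cdist x z + (4 * card V + 16)"
    "cdist y y' + cdist y' w' + cdist w w' \<le> cdist y w + (4 * card V + 16)"
    "cdist x x' + cdist x' w' + cdist w w' \<le> cdist x w + (4 * card V + 16)"
    "cdist y y' + cdist y' z' + cdist z z' \<le> cdist y z + (4 * card V + 16)"
    using cdist_corner c by blast+
  moreover have "cdist x y \<le> cdist x x' + cdist x' y" "cdist x' y \<le> cdist x' y' + cdist y' y"
    "cdist z w \<le> cdist z z' + cdist z' w" "cdist z' w \<le> cdist z' w' + cdist w' w"
    using cdist_triangle c cc by blast+
  ultimately have 1: "cdist x y + cdist z w \<le> (cdist x x' + cdist y y' + cdist z z' + cdist w w') + (cdist x' y' + cdist z' w')"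
    and 2: "(cdist x x' + cdist y y' + cdist z z' + cdist w w') + (cdist x' z' + cdist y' w') \<le> (cdist x z + cdist y w) + (8 * card V + 32)"
    and 3: "(cdist x x' + cdist y y' + cdist z z' + cdist w w') + (cdist x' w' + cdist y' z') \<le> (cdist x w + cdist y z) + (8 * card V + 32)"
    using cdist_sym[of y' y] cdist_sym[of w' w] by linarith+
  from B consider "cdist x' y' + cdist z' w' \<le> (cdist x' z' + cdist y' w') + (4 * card V + 4)"
    | "cdist x' y' + cdist z' w' \<le> (cdist x' w' + cdist y' z') + (4 * card V + 4)"
    unfolding max_def by (auto split: if_splits)
  then show ?thesis
  proof cases
    case 1
    then have "cdist x y + cdist z w \<le> (cdist x z + cdist y w) + (12 * card V + 36)" using \<open>cdist x y + cdist z w \<le> _\<close> 2 by linarith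
    then show ?thesis by (simp add: max_def)
  next
    case 2
    then have "cdist x y + cdist z w \<le> (cdist x w + cdist y z) + (12 * card V + 36)" using 1 3 by linarith
    then show ?thesis by (simp add: max_def)
  qed
qed

lemma coned_approx:
  assumes "u \<in> coned_vertices G square_subgroups" "v \<in> coned_vertices G square_subgroups"
    and x: "x \<in> carrier G" "u = Inl x \<or> adj coned_graph u (Inl x)" and y: "y \<in> carrier G" "v = Inl y \<or> adj coned_graph v (Inl y)"
  shows "reachable coned_graph u v" "graph_dist coned_graph u v \<le> cdist x y + 2" "cdist x y \<le> graph_dist coned_graph u v + 2"
proof -
  have u: "reachable coned_graph u (Inl x)" "graph_dist coned_graph u (Inl x) \<le> 1"
    using x(2) reachable_adj graph_dist_adj by fastforce+
  have v: "reachable coned_graph v (Inl y)" "graph_dist coned_graph v (Inl y) \<le> 1"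
    using y(2) reachable_adj graph_dist_adj by fastforce+
  have xy: "reachable coned_graph (Inl x) (Inl y)" using cdist_card x y by blast
  note R = reachable_trans[OF u(1) xy] reachable_sym[OF u(1)] reachable_sym[OF v(1)]
  show r: "reachable coned_graph u v" by (rule reachable_trans[OF R(1,3)])
  show "graph_dist coned_graph u v \<le> cdist x y + 2"
    using graph_dist_triangle[OF R(1,3)] graph_dist_triangle[OF u(1) xy] u(2) v(2)
      graph_dist_sym[of coned_graph v "Inl y"] by linarith
  show "cdist x y \<le> graph_dist coned_graph u v + 2"
    using graph_dist_triangle[OF reachable_trans[OF R(2) r] v(1)] graph_dist_triangle[OF R(2) r] u(2) v(2)
      graph_dist_sym[of coned_graph u "Inl x"] by linarith
qed

lemma coned_hyperbolic: "hyperbolic_graph (coned_vertices G square_subgroups) coned_graph"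
proof -
  \<comment> \<open>Replacing cone vertices by adjacent group elements changes each distance by at
    most 2. Two distances on either side of the inequality are affected, hence 36 + 8 = 44.\<close>
  define M where "M = 12 * card V + 44"
  have four: "graph_dist coned_graph a b + graph_dist coned_graph c d
      \<le> max (graph_dist coned_graph a c + graph_dist coned_graph b d) (graph_dist coned_graph a d + graph_dist coned_graph b c) + M"
    if v: "a \<in> coned_vertices G square_subgroups" "b \<in> coned_vertices G square_subgroups" "c \<in> coned_vertices G square_subgroups" "d \<in> coned_vertices G square_subgroups"
    for a b c d
  proof -
    obtain x where x: "x \<in> carrier G" "a = Inl x \<or> adj coned_graph a (Inl x)" using coned_vertex_cases[OF v(1)] by blast
    obtain y where y: "y \<in> carrier G" "b = Inl y \<or> adj coned_graph b (Inl y)" using coned_vertex_cases[OF v(2)] by blast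
    obtain z where z: "z \<in> carrier G" "c = Inl z \<or> adj coned_graph c (Inl z)" using coned_vertex_cases[OF v(3)] by blast
    obtain w where w: "w \<in> carrier G" "d = Inl w \<or> adj coned_graph d (Inl w)" using coned_vertex_cases[OF v(4)] by blast
    show ?thesis
      using four_point[OF x(1) y(1) z(1) w(1)] coned_approx(2)[OF v(1,2) x y] coned_approx(2)[OF v(3,4) z w]
        coned_approx(3)[OF v(1,3) x z] coned_approx(3)[OF v(2,4) y w]
        coned_approx(3)[OF v(1,4) x w] coned_approx(3)[OF v(2,3) y z]
      unfolding M_def by linarith
  qed
  have "connected_graph (coned_vertices G square_subgroups) coned_graph"
    unfolding connected_graph_def using coned_vertex_cases coned_approx(1) by meson
  moreover have "real (graph_dist coned_graph a b) + real (graph_dist coned_graph c d)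
      \<le> max (real (graph_dist coned_graph a c) + real (graph_dist coned_graph b d))
            (real (graph_dist coned_graph a d) + real (graph_dist coned_graph b c)) + 2 * (real M / 2)"
    if v: "a \<in> coned_vertices G square_subgroups" "b \<in> coned_vertices G square_subgroups" "c \<in> coned_vertices G square_subgroups" "d \<in> coned_vertices G square_subgroups"
    for a b c d
    using four[OF v] by (simp add: max_def split: if_splits)
  ultimately show ?thesis unfolding hyperbolic_graph_def by blast
qed

section \<open>The coned-off Cayley graph is fine\<close>

fun dual_walls :: "'a + 'a set \<Rightarrow> 'a set" where
  "dual_walls (Inl x) = (\<lambda>v. cj x (s v)) ` V"
| "dual_walls (Inr F) = {t. \<exists>x\<in>F. \<exists>y\<in>F. t \<in> H x y}"

text \<open>For a coset the value is meaningful only when \<open>t\<close> does not cut it, that is,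
  outside its \<open>dual_walls\<close>.\<close>

fun side :: "'a \<Rightarrow> 'a + 'a set \<Rightarrow> bool" where
  "side t (Inl x) \<longleftrightarrow> t \<in> N x"
| "side t (Inr F) \<longleftrightarrow> (\<exists>x\<in>F. t \<in> N x)"

lemma side_adj:
  assumes "adj coned_graph u v" "t \<notin> dual_walls u" "t \<notin> dual_walls v"
  shows "side t u = side t v"
proof -
  have LR: "side t (Inl x) = side t (Inr F)" if xF: "adj coned_graph (Inl x) (Inr F)" "t \<notin> dual_walls (Inr F)" for x F
  proof -
    obtain T where "x \<in> carrier G" "T \<in> squares V E" "F = pcoset x T" using xF unfolding adj_Inl_Inr by auto
    then have "x \<in> F" using self_in_coset squares_subset by blast
    then have "t \<notin> N y" if "y \<in> F" "t \<notin> N x" for y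
      using xF(2) that in_H[of t x y] by auto
    then show ?thesis using \<open>x \<in> F\<close> by auto
  qed
  have LL: "side t (Inl x) = side t (Inl y)" if xy: "adj coned_graph (Inl x) (Inl y)" "t \<notin> dual_walls (Inl x)" for x y
  proof -
    obtain v where v: "x \<in> carrier G" "v \<in> V" "y = x \<otimes> s v" using xy unfolding adj_Inl_Inl by auto
    then have "t \<notin> H x y" using H_edge xy(2) by auto
    then show ?thesis by (auto simp: in_H)
  qed
  show ?thesis using assms LR LL adj_Inr_Inr adj_sym[of coned_graph] by (cases u; cases v) metis+
qed

lemma side_walk:
  "successively (adj coned_graph) ws \<Longrightarrow> ws \<noteq> [] \<Longrightarrow> \<forall>w\<in>set ws. t \<notin> dual_walls w \<Longrightarrow> side t (hd ws) = side t (last ws)"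
proof (induction ws rule: induct_list012)
  case (3 a b ws)
  then have "side t a = side t b" using side_adj[of a b t] by simp
  then show ?case using 3 by simp
qed auto

lemma coset_H:
  assumes T: "T \<subseteq> V" and g: "g \<in> carrier G" and x: "x \<in> pcoset g T" and y: "y \<in> pcoset g T"
  shows "lab ` H x y \<subseteq> T"
proof -
  have "lab ` H x y \<subseteq> lab ` H g x \<union> lab ` H g y"
    using image_mono[OF H_triangle[of x y g], of lab] by (simp add: image_Un H_sym[of x g])
  then show ?thesis using x y in_coset[OF T g] by blast
qed

lemma conv_coset:
  assumes T: "T \<subseteq> V" and g: "g \<in> carrier G"
  shows "conv (pcoset g T)"
  unfolding conv_def
proof (intro conjI ballI subsetI)
  show "x \<in> carrier G" if "x \<in> pcoset g T" for x using that in_coset[OF T g] by blast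
  fix x z y assume a: "x \<in> pcoset g T" "z \<in> pcoset g T" "y \<in> carrier G"
  then have c: "x \<in> carrier G" "z \<in> carrier G" using in_coset[OF T g] by blast+
  have "H x (med x y z) \<subseteq> H x z" unfolding H_def med(2)[OF c(1) a(3) c(2)] by blast
  then have 1: "lab ` H x (med x y z) \<subseteq> T" using coset_H[OF T g a(1,2)] by blast
  have "lab ` H g (med x y z) \<subseteq> lab ` H g x \<union> lab ` H x (med x y z)"
    using image_mono[OF H_triangle[of g "med x y z" x], of lab] by (simp add: image_Un)
  also have "\<dots> \<subseteq> T" using 1 in_coset[OF T g, of x] a(1) by simp
  finally show "med x y z \<in> pcoset g T" using in_coset[OF T g, of "med x y z"] med(1)[OF c(1) a(3) c(2)] by simp
qed

text \<open>Generators of a clique commute, so conjugation by them fixes each of them and a word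
  over \<open>J\<close> meets no reflections besides the generators themselves.\<close>

lemma clique_N:
  assumes J: "J \<subseteq> V" "\<And>u v. u \<in> J \<Longrightarrow> v \<in> J \<Longrightarrow> u \<noteq> v \<Longrightarrow> adj E u v" and g: "g \<in> parab J"
  shows "N g \<subseteq> s ` J"
proof -
  obtain xs where xs: "xs \<in> lists J" "g = wp xs" using g by (auto simp: parab_def)
  have "xs \<in> lists J \<Longrightarrow> N (wp xs) \<subseteq> s ` J"
  proof (induction xs rule: list.induct)
    case (Cons v xs)
    then have v: "v \<in> J" "v \<in> V" "xs \<in> lists J" "xs \<in> lists V" using J by auto
    show ?case
    proof
      fix t assume t: "t \<in> N (wp (v # xs))"
      have tc: "t \<in> carrier G" by (rule N_closed[OF t])
      have "t = s v \<or> cj (s v) t \<in> N (wp xs)"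
        using N_mult[of "s v" "wp xs" t] t tc v by auto
      then show "t \<in> s ` J"
      proof
        assume "cj (s v) t \<in> N (wp xs)"
        then obtain u where u: "u \<in> J" "cj (s v) t = s u" using Cons.IH[OF v(3)] by auto
        have "u \<in> V" using u J by auto
        have "t = cj (s v) (s u)" using cj_inv(1)[of "s v" t] u(2) v tc by simp
        also have "\<dots> = s u"
        proof (cases "u = v")
          case True then show ?thesis using v by (simp add: cj_def)
        next
          case False then show ?thesis using cj_s_adj J(2) v u \<open>u \<in> V\<close> by metis
        qed
        finally show ?thesis using u by simp
      qed (use v in auto)
    qed
  qed simp
  then show ?thesis using xs by simp
qed

lemma square_opposite:
  assumes "T \<in> squares V E" "u \<in> T" "v \<in> T" "u \<noteq> v" "\<not> adj E u v" "e \<in> T" "e \<noteq> u" "e \<noteq> v"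
  shows "adj E e u" "adj E e v"
proof -
  obtain a b c d where "T = {a, b, c, d}" "is_square E a b c d" using assms(1) unfolding squares_def by blast
  then show "adj E e u" "adj E e v" using assms(2-) adj_sym[of E] unfolding is_square_def by auto
qed

lemma card_square: "T \<in> squares V E \<Longrightarrow> card T = 4"
  unfolding squares_def is_square_def by auto

text \<open>Two shared vertices that are not joined would be opposite in \<open>T'\<close>; then a
  vertex of \<open>T'\<close> outside \<open>T\<close> would be adjacent to both, contrary to
  \<open>outside_square\<close>.\<close>

lemma squares_inter_clique:
  assumes T: "T \<in> squares V E" and T': "T' \<in> squares V E" and ne: "T \<noteq> T'"
    and uv: "u \<in> T \<inter> T'" "v \<in> T \<inter> T'" "u \<noteq> v"
  shows "adj E u v"
proof (rule ccontr)
  assume na: "\<not> adj E u v"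
  have "\<not> T' \<subseteq> T"
    using card_subset_eq[of T T'] card_square[OF T] card_square[OF T'] ne finite_subset[OF squares_subset[OF T] finV]
    by auto
  then obtain e where e: "e \<in> T'" "e \<notin> T" by auto
  have "adj E e u" "adj E e v" using square_opposite[OF T' _ _ uv(3) na e(1)] uv e by auto
  then show False using outside_square[OF T, of e u v] e uv squares_subset[OF T'] by blast
qed

text \<open>If two common walls t1, t2 do not cross, there is a third common wall h of another label, and a wall between the
  cosets would cross t1 and h, so that its label lies in T. Hence the cosets meet, and T and T' share a clique.\<close>

lemma common_walls:
  assumes T: "T \<in> squares V E" and T': "T' \<in> squares V E" and g: "g \<in> carrier G" and g': "g' \<in> carrier G"
    and ne: "pcoset g T \<noteq> pcoset g' T'"
  shows "finite (dual_walls (Inr (pcoset g T)) \<inter> dual_walls (Inr (pcoset g' T'))) \<and>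
    card (dual_walls (Inr (pcoset g T)) \<inter> dual_walls (Inr (pcoset g' T'))) \<le> card V"
proof -
  define F where "F = pcoset g T"
  define F' where "F' = pcoset g' T'"
  have TV: "T \<subseteq> V" "T' \<subseteq> V" using squares_subset T T' by auto
  have Fc: "F \<subseteq> carrier G" "F' \<subseteq> carrier G" using in_coset TV g g' unfolding F_def F'_def by blast+
  define I where "I = dual_walls (Inr F) \<inter> dual_walls (Inr F')"
  have HI: "\<exists>x\<in>F. \<exists>y\<in>F. t \<in> H x y" "\<exists>x\<in>F'. \<exists>y\<in>F'. t \<in> H x y" if "t \<in> I" for t
    using that by (simp_all add: I_def)
  have wallI': "wall t" if tI: "t \<in> I" for t
  proof -
    obtain x y where "x \<in> F" "y \<in> F" "t \<in> H x y" using HI(1)[OF tI] by blast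
    then show ?thesis using wallI[of x y t] Fc by blast
  qed
  have sides: "\<exists>x\<in>F. (t \<in> N x) = p" "\<exists>x\<in>F'. (t \<in> N x) = p" if "t \<in> I" for t p
    using HI[OF that] unfolding in_H by blast+
  have labI: "lab t \<in> T" "lab t \<in> T'" if "t \<in> I" for t
    using that coset_H[OF TV(1) g] coset_H[OF TV(2) g'] unfolding I_def F_def F'_def by fastforce+
  have "finite I \<and> card I \<le> card V"
  proof (cases "pw_cross I")
    case True
    then show ?thesis using pw_cross_card wallI' by blast
  next
    case False
    then obtain t1 t2 where t: "t1 \<in> I" "t2 \<in> I" "t1 \<noteq> t2" "\<not> cross t1 t2" unfolding pw_cross_def by blast
    obtain h p q r where h: "lab h \<noteq> lab t1"
      "\<forall>x\<in>carrier G. (t1 \<in> N x) = p \<longrightarrow> (h \<in> N x) = r"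
      "\<forall>x\<in>carrier G. (t2 \<in> N x) = q \<longrightarrow> (h \<in> N x) = (\<not> r)"
      using between[OF wallI'[OF t(1)] wallI'[OF t(2)] t(3,4)] by blast
    \<comment> \<open>\<open>h\<close> lies between a side of \<open>t1\<close> and a side of
      \<open>t2\<close>; a set meeting both of these half-spaces is cut by \<open>h\<close>.\<close>
    have hZ: "h \<in> dual_walls (Inr K)" if "\<exists>x\<in>K. (t1 \<in> N x) = p" "\<exists>x\<in>K. (t2 \<in> N x) = q" "K \<subseteq> carrier G" for K
    proof -
      obtain x y where "x \<in> K" "(t1 \<in> N x) = p" "y \<in> K" "(t2 \<in> N y) = q" using \<open>\<exists>x\<in>K. (t1 \<in> N x) = p\<close> \<open>\<exists>x\<in>K. (t2 \<in> N x) = q\<close> by blast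
      then have "x \<in> K" "y \<in> K" "h \<in> H x y" using h \<open>K \<subseteq> carrier G\<close> by (auto simp: in_H)
      then show ?thesis by auto
    qed
    have hI: "h \<in> I" unfolding I_def
      by (rule IntI[OF hZ[OF sides(1)[OF t(1)] sides(1)[OF t(2)] Fc(1)] hZ[OF sides(2)[OF t(1)] sides(2)[OF t(2)] Fc(2)]])
    obtain x y where xy: "x \<in> F" "y \<in> F'"
      and sep: "\<forall>u\<in>H x y. (\<forall>z\<in>F. (u \<in> N z) = (u \<in> N x)) \<and> (\<forall>z\<in>F'. (u \<in> N z) = (u \<in> N y))"
      using closest_pair[of F F'] conv_coset[OF TV(1) g] conv_coset[OF TV(2) g'] self_in_coset[OF TV(1) g]
        self_in_coset[OF TV(2) g'] unfolding F_def F'_def by blast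
    have c: "x \<in> carrier G" "y \<in> carrier G" using xy Fc by auto
    have cr: "cross u t" if u: "u \<in> H x y" and tt: "t \<in> I" for u t
    proof -
      obtain a b where ab: "a \<in> F" "b \<in> F" "t \<notin> N a" "t \<in> N b"
        using sides(1)[OF tt, of False] sides(1)[OF tt, of True] by blast
      obtain a' b' where ab': "a' \<in> F'" "b' \<in> F'" "t \<notin> N a'" "t \<in> N b'"
        using sides(2)[OF tt, of False] sides(2)[OF tt, of True] by blast
      have "(u \<in> N a) = (u \<in> N x)" "(u \<in> N b) = (u \<in> N x)" "(u \<in> N a') = (u \<in> N y)" "(u \<in> N b') = (u \<in> N y)"
        using sep u ab ab' by blast+
      moreover have "(u \<in> N x) \<noteq> (u \<in> N y)" using u by (simp add: in_H)
      ultimately show ?thesis using ab ab' Fc by (intro crossI[of a b a' b']) auto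
    qed
    have "lab u \<in> T" if u: "u \<in> H x y" for u
    proof (rule ccontr)
      assume "lab u \<notin> T"
      moreover have "lab u \<in> V" using lab_in_V c u by blast
      moreover have "adj E (lab u) (lab t1)" "adj E (lab u) (lab h)" using cr[OF u] cross_adj t(1) hI by blast+
      ultimately show False using outside_square[OF T, of "lab u" "lab t1" "lab h"] labI t(1) hI h(1) by auto
    qed
    then have "lab ` H x y \<subseteq> T" by blast
    then have "pcoset x T = pcoset y T" by (rule coset_eq[OF TV(1) c])
    moreover have "pcoset g T = pcoset x T"
      using in_coset[OF TV(1) g] xy(1) by (intro coset_eq[OF TV(1) g c(1)]) (simp add: F_def)
    ultimately have Fy: "F = pcoset y T" by (simp add: F_def)
    have Fy': "F' = pcoset y T'"
      using in_coset[OF TV(2) g'] xy(2) unfolding F'_def by (intro coset_eq[OF TV(2) g' c(2)]) simp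
    have TT: "T \<noteq> T'" using ne Fy Fy' by (auto simp: F_def F'_def)
    define J where "J = T \<inter> T'"
    have J: "J \<subseteq> V" using TV by (auto simp: J_def)
    have "I \<subseteq> (\<lambda>v. cj y (s v)) ` J"
    proof
      fix t assume tt: "t \<in> I"
      obtain a b where a: "a \<in> F" "(t \<in> N a) \<noteq> (t \<in> N y)" and b: "b \<in> F'" "(t \<in> N b) \<noteq> (t \<in> N y)"
        using sides(1)[OF tt, of "t \<notin> N y"] sides(2)[OF tt, of "t \<notin> N y"] by blast
      have abc: "a \<in> carrier G" "b \<in> carrier G" using a b Fc by auto
      \<comment> \<open>Both cosets contain \<open>y\<close>. This median lies in both of them and
        is still separated from \<open>y\<close> by \<open>t\<close>, so \<open>t\<close> already
        cuts the common coset of the clique \<open>J\<close> through \<open>y\<close>.\<close>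
      define m where "m = med y a b"
      have m: "m \<in> carrier G" "N m = N y \<inter> N a \<union> N a \<inter> N b \<union> N y \<inter> N b"
        using med[OF c(2) abc] by (simp_all add: m_def)
      have tm: "t \<in> H y m" using a b unfolding in_H m(2) by blast
      have "H y m \<subseteq> H y a" "H y m \<subseteq> H y b" unfolding H_def m(2) by blast+
      moreover have "lab ` H y a \<subseteq> T" "lab ` H y b \<subseteq> T'"
        using a(1) b(1) in_coset[OF TV(1) c(2)] in_coset[OF TV(2) c(2)] Fy Fy' by blast+
      ultimately have "lab ` H y m \<subseteq> J" unfolding J_def by blast
      then have "inv y \<otimes> m \<in> parab J" using parab_iff_lab[OF J c(2) m(1)] by simp
      then have "N (inv y \<otimes> m) \<subseteq> s ` J"
        using squares_inter_clique[OF T T' TT] by (intro clique_N[OF J]) (auto simp: J_def)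
      moreover have tc: "t \<in> carrier G" using tm H_carrier by blast
      ultimately obtain v where v: "v \<in> J" "cj (inv y) t = s v" using H_N[OF c(2) m(1) tc] tm by auto
      then have "t = cj y (s v)" using cj_inv(2)[OF c(2) tc] by simp
      then show "t \<in> (\<lambda>v. cj y (s v)) ` J" using v by blast
    qed
    moreover have "finite J" "card J \<le> card V" using J finV by (auto intro: finite_subset card_mono)
    ultimately show ?thesis
      using finite_subset[of I] card_mono[of "(\<lambda>v. cj y (s v)) ` J" I] card_image_le[of J "\<lambda>v. cj y (s v)"] by fastforce
  qed
  then show ?thesis by (simp add: I_def F_def F'_def)
qed

text \<open>The rest of the circuit joins \<open>h\<close> to \<open>h'\<close> without using the
  cone vertex, so each wall separating them is dual to some vertex on the way. Every such vertex has
  at most \<open>card V\<close> dual walls in common with the coset: by the number of generators for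
  a group element, by \<open>common_walls\<close> for another coset.\<close>

lemma circuit_jump:
  assumes circ: "circuit coned_graph (Inr F # ws)" and n: "length (Inr F # ws) = n"
    and h: "hd ws = Inl h" and h': "last ws = Inl h'"
  shows "card (H h h') \<le> n * card V"
proof -
  have ws: "ws \<noteq> []" "successively (adj coned_graph) ws" "Inr F \<notin> set ws" "adj coned_graph (Inr F) (Inl h)" "adj coned_graph (Inl h') (Inr F)"
    using circ h h' by (cases ws; auto simp: circuit_def walk_successively)+
  obtain T where T: "h \<in> carrier G" "T \<in> squares V E" "F = pcoset h T"
    using ws(4) adj_sym[of coned_graph] adj_Inl_Inr by metis
  obtain T' where T': "h' \<in> carrier G" "T' \<in> squares V E" "F = pcoset h' T'"
    using ws(5) adj_Inl_Inr by metis
  have hF: "h \<in> F" "h' \<in> F" using self_in_coset squares_subset T T' by blast+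
  define Y where "Y w = dual_walls (Inr F) \<inter> dual_walls w" for w
  have sub: "H h h' \<subseteq> (\<Union>w\<in>set ws. Y w)"
  proof
    fix t assume t: "t \<in> H h h'"
    then have tF: "t \<in> dual_walls (Inr F)" using hF by auto
    have "side t (hd ws) \<noteq> side t (last ws)" using t h h' by (simp add: in_H)
    then obtain w where "w \<in> set ws" "t \<in> dual_walls w" using side_walk[OF ws(2,1), of t] by blast
    then show "t \<in> (\<Union>w\<in>set ws. Y w)" using tF by (auto simp: Y_def)
  qed
  have Y: "finite (Y w) \<and> card (Y w) \<le> card V" if w: "w \<in> set ws" for w
  proof (cases w)
    case (Inl x)
    then have "Y w \<subseteq> (\<lambda>v. cj x (s v)) ` V" by (simp add: Y_def)
    moreover have "card ((\<lambda>v. cj x (s v)) ` V) \<le> card V" "finite ((\<lambda>v. cj x (s v)) ` V)"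
      using finV card_image_le by auto
    ultimately show ?thesis by (meson card_mono finite_subset le_trans)
  next
    case (Inr K)
    have "K \<noteq> F" using ws(3) w Inr by auto
    obtain us vs where uv: "ws = us @ w # vs" using w by (meson split_list)
    have "us \<noteq> []" using uv h Inr by (intro notI) auto
    then obtain us' u where "us = us' @ [u]" by (metis rev_exhaust)
    then have "adj coned_graph u (Inr K)" using ws(2) uv Inr by (simp add: successively_append_iff)
    then obtain x where "u = Inl x" "adj coned_graph (Inl x) (Inr K)" using adj_Inr_Inr by (cases u) auto
    then obtain U where U: "x \<in> carrier G" "U \<in> squares V E" "K = pcoset x U" unfolding adj_Inl_Inr by auto
    show ?thesis
      using common_walls[OF T(2) U(2) T(1) U(1)] \<open>K \<noteq> F\<close> T(3) U(3) unfolding Y_def Inr by metis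
  qed
  have "card (H h h') \<le> card (\<Union>w\<in>set ws. Y w)"
    using Y by (intro card_mono sub) auto
  also have "\<dots> \<le> (\<Sum>w\<in>set ws. card (Y w))" by (rule card_UN_le) simp
  also have "\<dots> \<le> (\<Sum>w\<in>set ws. card V)" using Y by (intro sum_mono) auto
  also have "\<dots> \<le> length ws * card V" using card_length[of ws] by simp
  finally show ?thesis using n by auto
qed

text \<open>Induction along the circuit. An ordinary edge crosses one wall. A passage through a cone
  vertex crosses at most \<open>n * card V\<close> walls, as one sees after rotating the circuit so
  that it starts at that vertex.\<close>

lemma circuit_bounded:
  assumes circ: "circuit coned_graph (Inl g # zs)" and n: "length (Inl g # zs) = n"
  shows "Inl g # zs = as @ bs \<Longrightarrow> as \<noteq> [] \<Longrightarrow> last as = Inl h \<Longrightarrow>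
    h \<in> carrier G \<and> card (H g h) \<le> length as * (n * card V + 1)"
proof (induction "length as" arbitrary: as bs h rule: less_induct)
  case less
  have suc: "successively (adj coned_graph) (Inl g # zs)" and gc: "g \<in> carrier G"
    using circ adj_Inl_Inl adj_Inl_Inr
    by (auto simp: circuit_def walk_successively successively_Cons) (metis old.sum.exhaust)
  obtain cs where cs: "as = cs @ [Inl h]" using less.prems by (metis append_butlast_last_id)
  show ?case
  proof (cases cs rule: rev_cases)
    case Nil
    then show ?thesis using less.prems cs gc by auto
  next
    case (snoc ds w)
    have hc: "h \<in> carrier G \<and> adj coned_graph w (Inl h)"
    proof -
      have a: "adj coned_graph w (Inl h)" using suc less.prems(1) cs snoc by (simp add: successively_append_iff)
      then have "adj coned_graph (Inl h) w" using adj_sym[of coned_graph] by metis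
      then show ?thesis using a adj_Inl_Inl adj_Inl_Inr by (cases w) auto
    qed
    show ?thesis
    proof (cases w)
      case (Inl h')
      have "last cs = Inl h'" "cs \<noteq> []" "length cs < length as" "Inl g # zs = cs @ (Inl h # bs)"
        using snoc Inl cs less.prems(1) by auto
      then have IH: "h' \<in> carrier G" "card (H g h') \<le> length cs * (n * card V + 1)"
        using less.hyps[of cs "Inl h # bs" h'] by auto
      obtain v where v: "v \<in> V" "h = h' \<otimes> s v" using hc unfolding Inl adj_Inl_Inl by auto
      have "card (H h' h) = 1" using H_edge[OF IH(1) v(1)] v(2) by simp
      moreover have "card (H g h) \<le> card (H g h' \<union> H h' h)" using gc hc IH by (intro card_mono H_triangle) auto
      moreover have "card (H g h' \<union> H h' h) \<le> card (H g h') + card (H h' h)" by (rule card_Un_le)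
      ultimately show ?thesis using IH(2) hc cs by simp
    next
      case (Inr F)
      have "ds \<noteq> []" using less.prems(1) cs snoc Inr by (intro notI) auto
      then obtain es w' where es: "ds = es @ [w']" by (metis rev_exhaust)
      have "adj coned_graph w' w" using suc less.prems(1) cs snoc es by (simp add: successively_append_iff)
      then obtain h' where h': "w' = Inl h'" using Inr adj_Inr_Inr by (cases w') auto
      have all: "Inl g # zs = (es @ [Inl h']) @ (Inr F # Inl h # bs)" using less.prems(1) cs snoc es h' Inr by simp
      have "length (es @ [Inl h']) < length as" using cs snoc es by simp
      then have IH: "h' \<in> carrier G" "card (H g h') \<le> length (es @ [Inl h']) * (n * card V + 1)"
        using less.hyps[OF _ all] by auto
      have "circuit coned_graph ((Inr F # Inl h # bs) @ (es @ [Inl h']))"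
        using circ unfolding all by (rule circuit_rotate)
      moreover have "length ((Inr F # Inl h # bs) @ (es @ [Inl h'])) = n" using n unfolding all by simp
      ultimately have "card (H h h') \<le> n * card V"
        using circuit_jump[of F "(Inl h # bs) @ (es @ [Inl h'])" n h h'] by simp
      moreover have "card (H g h) \<le> card (H g h' \<union> H h' h)" using gc hc IH by (intro card_mono H_triangle) auto
      moreover have "card (H g h' \<union> H h' h) \<le> card (H g h') + card (H h' h)" by (rule card_Un_le)
      ultimately show ?thesis using IH(2) hc cs snoc es H_sym[of h h'] by simp
    qed
  qed
qed

lemma finite_ball:
  assumes g: "g \<in> carrier G"
  shows "finite {h \<in> carrier G. card (H g h) \<le> M}"
proof (rule finite_subset)
  show "{h \<in> carrier G. card (H g h) \<le> M} \<subseteq> (\<lambda>xs. g \<otimes> wp xs) ` {xs. set xs \<subseteq> V \<and> length xs \<le> M}"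
  proof
    fix h assume "h \<in> {h \<in> carrier G. card (H g h) \<le> M}"
    then have h: "h \<in> carrier G" "card (H g h) \<le> M" by auto
    have hc: "inv g \<otimes> h \<in> carrier G" using g h by simp
    have "N (inv g \<otimes> h) \<subseteq> cj (inv g) ` H g h"
    proof
      fix t assume t: "t \<in> N (inv g \<otimes> h)"
      then have tc: "t \<in> carrier G" by (rule N_closed)
      then have "cj g t \<in> H g h" using cj_in_H[OF g h(1) tc] t by simp
      moreover have "t = cj (inv g) (cj g t)" using tc g by simp
      ultimately show "t \<in> cj (inv g) ` H g h" by blast
    qed
    then have "card (N (inv g \<otimes> h)) \<le> card (H g h)"
      using finite_H[OF g h(1)] by (meson card_image_le card_mono finite_imageI le_trans)
    moreover obtain xs where xs: "xs \<in> lists V" "inv g \<otimes> h = wp xs" "card (N (inv g \<otimes> h)) = length xs"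
      by (rule reduced_exists[OF hc])
    ultimately have "length xs \<le> M" using h(2) by simp
    moreover have "h = g \<otimes> wp xs" using xs(2) g h(1) mult_inv_cancel[OF g h(1)] by simp
    ultimately show "h \<in> (\<lambda>xs. g \<otimes> wp xs) ` {xs. set xs \<subseteq> V \<and> length xs \<le> M}" using xs(1) by auto
  qed
  show "finite ((\<lambda>xs. g \<otimes> wp xs) ` {xs. set xs \<subseteq> V \<and> length xs \<le> M})"
    by (intro finite_imageI finite_lists_length_le finV)
qed

lemma finite_squares: "finite (squares V E)"
  using finV squares_subset by (meson Pow_iff finite_Pow_iff finite_subset subsetI)

text \<open>Every edge has an end in the group, and a circuit through it can be rotated to start
  there. Its group elements then lie in a finite ball, and each of its cone vertices follows one of
  them and so is one of finitely many cosets.\<close>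

lemma coned_fine: "fine_graph coned_graph"
  unfolding fine_graph_def
proof (intro ballI allI)
  fix e n assume e: "e \<in> coned_graph"
  obtain g where g: "Inl g \<in> e" "g \<in> carrier G"
    using e unfolding coned_graph_def coned_edges_def by auto
  define Bl where "Bl = {h \<in> carrier G. card (H g h) \<le> n * (n * card V + 1)}"
  define Y where "Y = Inl ` Bl \<union> (\<lambda>(h, T). Inr (pcoset h T)) ` (Bl \<times> squares V E)"
  have fY: "finite Y" unfolding Y_def Bl_def using finite_ball[OF g(2)] finite_squares by simp
  have Ysub: "set (Inl g # zs) \<subseteq> Y" if circ: "circuit coned_graph (Inl g # zs)" and n: "length (Inl g # zs) = n" for zs
  proof
    fix w assume w: "w \<in> set (Inl g # zs)"
    then obtain cs bs where cb: "Inl g # zs = cs @ w # bs" by (meson split_list)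
    have len: "length cs < n" using arg_cong[OF cb, of length] n by simp
    have suc: "successively (adj coned_graph) (Inl g # zs)" using circ by (simp add: circuit_def walk_successively)
    have inB: "h \<in> Bl" if "Inl g # zs = as @ bs'" "as \<noteq> []" "last as = Inl h" for as bs' h
    proof -
      have "length as \<le> n" using arg_cong[OF that(1), of length] n by simp
      then have "length as * (n * card V + 1) \<le> n * (n * card V + 1)" by (rule mult_le_mono1)
      then show ?thesis using circuit_bounded[OF circ n that] unfolding Bl_def by auto
    qed
    show "w \<in> Y"
    proof (cases w)
      case (Inl h)
      then have "h \<in> Bl" using inB[of "cs @ [w]" bs] cb by simp
      then show ?thesis using Inl by (simp add: Y_def)
    next
      case (Inr F)
      have "cs \<noteq> []" using cb Inr by (intro notI) auto
      then obtain ds w' where ds: "cs = ds @ [w']" by (metis rev_exhaust)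
      have a: "adj coned_graph w' (Inr F)" using suc Inr unfolding cb ds by (simp add: successively_append_iff)
      then obtain h where h: "w' = Inl h" using adj_Inr_Inr by (cases w') auto
      then obtain T where T: "T \<in> squares V E" "F = pcoset h T" using a unfolding h adj_Inl_Inr by auto
      have "h \<in> Bl" using inB[of cs "w # bs"] cb ds h by simp
      then show ?thesis using T Inr by (auto simp: Y_def)
    qed
  qed
  have "{xs. circuit coned_graph xs \<and> length xs = n \<and> e \<in> circuit_edges xs}
      \<subseteq> (\<lambda>(k, zs). rotate k zs) ` ({..n} \<times> {zs. set zs \<subseteq> Y \<and> length zs = n})"
  proof
    fix xs assume "xs \<in> {xs. circuit coned_graph xs \<and> length xs = n \<and> e \<in> circuit_edges xs}"
    then have xs: "circuit coned_graph xs" "length xs = n" "e \<in> circuit_edges xs" by auto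
    have "Inl g \<in> set xs" using circuit_edges_subset[OF xs(3)] g by auto
    then obtain as bs where ab: "xs = as @ Inl g # bs" by (meson split_list)
    have "circuit coned_graph ((Inl g # bs) @ as)" using circuit_rotate xs(1) ab by metis
    moreover have "length ((Inl g # bs) @ as) = n" using xs(2) ab by simp
    ultimately have "set ((Inl g # bs) @ as) \<subseteq> Y" using Ysub[of "bs @ as"] by simp
    moreover have "xs = rotate (length (Inl g # bs)) ((Inl g # bs) @ as)" unfolding ab by (rule rotate_append[symmetric])
    moreover have "length (Inl g # bs) \<le> n" using xs(2) ab by simp
    ultimately show "xs \<in> (\<lambda>(k, zs). rotate k zs) ` ({..n} \<times> {zs. set zs \<subseteq> Y \<and> length zs = n})"
      using \<open>length ((Inl g # bs) @ as) = n\<close> by (intro image_eqI[of _ _ "(length (Inl g # bs), (Inl g # bs) @ as)"]) auto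
  qed
  then show "finite {xs. circuit coned_graph xs \<and> length xs = n \<and> e \<in> circuit_edges xs}"
    by (rule finite_subset) (intro finite_imageI finite_cartesian_product finite_atMost finite_lists_length_eq fY)
qed

section \<open>Relative hyperbolicity and free factors\<close>

lemma generate_gens: "generate G (s ` V) = carrier G"
proof
  show "generate G (s ` V) \<subseteq> carrier G" using generate_incl[of "s ` V"] s_closed by blast
  have "xs \<in> lists V \<Longrightarrow> wp xs \<in> generate G (s ` V)" for xs
    by (induction xs) (auto intro: generate.intros)
  then show "carrier G \<subseteq> generate G (s ` V)" using word_exists by blast
qed

theorem rel_hyperbolic_squares: "rel_hyperbolic G square_subgroups"
  unfolding rel_hyperbolic_def
proof (intro conjI exI)
  show "finite square_subgroups" using finite_squares by (simp add: square_subgroups_def)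
  show "\<forall>P\<in>square_subgroups. subgroup P G" using parab_subgroup squares_subset by (auto simp: square_subgroups_def)
  show "finite (s ` V)" "s ` V \<subseteq> carrier G" using finV by auto
  show "generate G (s ` V) = carrier G" by (rule generate_gens)
  show "hyperbolic_graph (coned_vertices G square_subgroups) (coned_edges G (s ` V) square_subgroups)"
    using coned_hyperbolic by (simp add: coned_graph_def)
  show "fine_graph (coned_edges G (s ` V) square_subgroups)" using coned_fine by (simp add: coned_graph_def)
qed

lemma gen_notin_parab:
  assumes "J \<subseteq> V" "v \<in> V - J" shows "s v \<notin> parab J"
proof
  assume "s v \<in> parab J"
  then have "lab ` N (s v) \<subseteq> J" using parab_iff_lab[OF assms(1) one_closed, of "s v"] assms(2) by simp
  moreover have "lab (cj \<one> (s v)) = v" using assms(2) by (intro lab_cj) auto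
  ultimately show False using assms(2) by simp
qed

theorem rel_hyp_DD_squares:
  assumes "squares V E \<noteq> {}" "4 < card V"
  shows "rel_hyp_DD G square_subgroups"
  unfolding rel_hyp_DD_def
proof (intro conjI ballI)
  show "square_subgroups \<noteq> {}" using assms by (simp add: square_subgroups_def)
  show "rel_hyperbolic G square_subgroups" by (rule rel_hyperbolic_squares)
  fix P assume "P \<in> square_subgroups"
  then obtain T where T: "T \<in> squares V E" "P = parab T" by (auto simp: square_subgroups_def)
  \<comment> \<open>More than four vertices leave one outside the 4-cycle; its generator shows that
    the peripheral subgroup is proper.\<close>
  have "\<not> V \<subseteq> T" using card_square[OF T(1)] squares_subset[OF T(1)] assms(2) by auto
  then obtain v where v: "v \<in> V - T" by auto
  then have "s v \<notin> P" "s v \<in> carrier G" using gen_notin_parab[OF squares_subset[OF T(1)] v] T(2) by auto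
  then show "P \<noteq> carrier G" by blast
  obtain a b c d where abcd: "T = {a, b, c, d}" "is_square E a b c d" "{a, b, c, d} \<subseteq> V"
    using T(1) by (auto simp: squares_def)
  have "is_square E b c d a" "{b, c, d, a} \<subseteq> V" using abcd by (auto simp: is_square_def)
  then show "G\<lparr>carrier := P\<rparr> \<cong> Dinf \<times>\<times> Dinf"
    using square_iso[OF abcd(2,3)] no_chord abcd T(2) by simp
qed

lemma not_free_factor:
  assumes T: "T \<in> squares V E" and t: "t \<in> T" and v: "v \<in> V - T" and a: "adj E v t"
  shows "\<not> proper_free_factor G (parab T)"
proof
  assume "proper_free_factor G (parab T)"
  then obtain K where K: "internal_free_product G (parab T) K" by (auto simp: proper_free_factor_def)
  have V: "t \<in> V" "v \<in> V" using squares_subset[OF T] t v by auto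
  have "s t \<in> parab T" using parab_mult_s[OF t parab_one] V by simp
  moreover have "s t \<noteq> \<one>" using N_s[OF V(1)] by auto
  ultimately have "s v \<in> parab T"
    using free_factor_centralizer[OF K, of "s t" "s v"] s_comm[OF a V(2,1)] V by simp
  then show False using gen_notin_parab[OF squares_subset[OF T] v] by simp
qed

end

section \<open>Right-angled Coxeter groups\<close>

abbreviation word_class :: "'a set \<Rightarrow> 'a set set \<Rightarrow> 'a list \<Rightarrow> 'a list set" where
  "word_class V E xs \<equiv> racg_rel V E `` {xs}"

lemma racg_step_context: "racg_step E x y \<Longrightarrow> racg_step E (a @ x @ b) (a @ y @ b)"
  unfolding racg_step_def by (metis append.assoc)

lemma racg_rel_context:
  assumes "(x, y) \<in> racg_rel V E" "a \<in> lists V" "b \<in> lists V"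
  shows "(a @ x @ b, a @ y @ b) \<in> racg_rel V E"
proof -
  let ?r = "\<lambda>x y. racg_step E x y \<or> racg_step E y x"
  have "?r\<^sup>*\<^sup>* x y" using assms by (simp add: racg_rel_def)
  then have "?r\<^sup>*\<^sup>* (a @ x @ b) (a @ y @ b)"
  proof (induction rule: rtranclp_induct)
    case (step y z)
    then have "?r (a @ y @ b) (a @ z @ b)" using racg_step_context by blast
    with step.IH show ?case by (rule rtranclp.rtrancl_into_rtrancl)
  qed simp
  then show ?thesis using assms by (auto simp: racg_rel_def)
qed

lemma equiv_racg_rel: "equiv (lists V) (racg_rel V E)"
proof (rule equivI)
  let ?r = "\<lambda>x y. racg_step E x y \<or> racg_step E y x"
  show "racg_rel V E \<subseteq> lists V \<times> lists V" by (auto simp: racg_rel_def)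
  show "refl_on (lists V) (racg_rel V E)" by (auto simp: refl_on_def racg_rel_def)
  have "?r\<^sup>*\<^sup>* x y \<Longrightarrow> ?r\<^sup>*\<^sup>* y x" for x y
    by (metis (no_types, lifting) sympD symp_on_def symp_rtranclp)
  then show "sym (racg_rel V E)" by (auto simp: sym_def racg_rel_def)
  show "trans (racg_rel V E)" by (auto simp: trans_def racg_rel_def)
qed

lemma racg_rel_append:
  assumes "(a, b) \<in> racg_rel V E" "(c, d) \<in> racg_rel V E"
  shows "(a @ c, b @ d) \<in> racg_rel V E"
proof -
  have l: "a \<in> lists V" "b \<in> lists V" "c \<in> lists V" "d \<in> lists V" using assms by (auto simp: racg_rel_def)
  have "(a @ c, b @ c) \<in> racg_rel V E" using racg_rel_context[OF assms(1), of "[]" c] l by simp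
  moreover have "(b @ c, b @ d) \<in> racg_rel V E" using racg_rel_context[OF assms(2), of b "[]"] l by simp
  ultimately show ?thesis using equiv_racg_rel by (metis equivE transE)
qed

lemma word_class_eq:
  "xs \<in> lists V \<Longrightarrow> ys \<in> lists V \<Longrightarrow> word_class V E xs = word_class V E ys \<longleftrightarrow> (xs, ys) \<in> racg_rel V E"
  by (rule eq_equiv_class_iff[OF equiv_racg_rel])

lemma RACG_carrier: "carrier (RACG V E) = word_class V E ` lists V"
  by (auto simp: RACG_def quotient_def)

lemma RACG_one: "\<one>\<^bsub>RACG V E\<^esub> = word_class V E []"
  by (simp add: RACG_def)

text \<open>The product is defined with chosen representatives; compatibility of the congruence with
  concatenation makes it independent of the choice.\<close>

lemma RACG_mult:
  assumes "xs \<in> lists V" "ys \<in> lists V"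
  shows "word_class V E xs \<otimes>\<^bsub>RACG V E\<^esub> word_class V E ys = word_class V E (xs @ ys)"
proof -
  define a b where "a = (SOME a. a \<in> word_class V E xs)" and "b = (SOME b. b \<in> word_class V E ys)"
  have "a \<in> word_class V E xs" "b \<in> word_class V E ys"
    unfolding a_def b_def
    by (rule someI_ex[OF exI[of _ xs]], rule equiv_class_self[OF equiv_racg_rel assms(1)],
        rule someI_ex[OF exI[of _ ys]], rule equiv_class_self[OF equiv_racg_rel assms(2)])
  then have ab: "(xs, a) \<in> racg_rel V E" "(ys, b) \<in> racg_rel V E" by auto
  then have "(xs @ ys, a @ b) \<in> racg_rel V E" by (rule racg_rel_append)
  then have "word_class V E (a @ b) = word_class V E (xs @ ys)"
    using equiv_class_eq[OF equiv_racg_rel] by metis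
  then show ?thesis by (simp add: RACG_def a_def b_def)
qed

lemma RACG_rev: "xs \<in> lists V \<Longrightarrow> (rev xs @ xs, []) \<in> racg_rel V E"
proof (induction xs rule: list.induct)
  case (Cons x xs)
  then have x: "x \<in> V" "xs \<in> lists V" by auto
  have "racg_step E [x, x] []" unfolding racg_step_def by (metis append_Nil append_Nil2)
  then have "([x, x], []) \<in> racg_rel V E" using x by (auto simp: racg_rel_def)
  then have "(rev xs @ [x, x] @ xs, rev xs @ [] @ xs) \<in> racg_rel V E"
    using x by (intro racg_rel_context) auto
  then show ?case using Cons.IH[OF x(2)] equiv_racg_rel[of V E] by (auto elim!: equivE dest: transD)
next
  case Nil
  show ?case by (simp add: racg_rel_def)
qed

lemma RACG_group: "group (RACG V E)"
proof (rule groupI)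
  fix x y z
  assume "x \<in> carrier (RACG V E)" "y \<in> carrier (RACG V E)" "z \<in> carrier (RACG V E)"
  then obtain xs ys zs where w: "xs \<in> lists V" "ys \<in> lists V" "zs \<in> lists V"
    "x = word_class V E xs" "y = word_class V E ys" "z = word_class V E zs"
    unfolding RACG_carrier by blast
  have l: "xs @ ys \<in> lists V" "ys @ zs \<in> lists V" using w by auto
  show "x \<otimes>\<^bsub>RACG V E\<^esub> y \<in> carrier (RACG V E)"
    using RACG_mult[OF w(1,2)] l w(4,5) by (simp add: RACG_carrier)
  show "x \<otimes>\<^bsub>RACG V E\<^esub> y \<otimes>\<^bsub>RACG V E\<^esub> z = x \<otimes>\<^bsub>RACG V E\<^esub> (y \<otimes>\<^bsub>RACG V E\<^esub> z)"
    unfolding w(4-6) RACG_mult[OF w(1,2)] RACG_mult[OF w(2,3)] RACG_mult[OF l(1) w(3)] RACG_mult[OF w(1) l(2)]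
    by simp
next
  show "\<one>\<^bsub>RACG V E\<^esub> \<in> carrier (RACG V E)" by (auto simp: RACG_carrier RACG_one)
next
  fix x assume "x \<in> carrier (RACG V E)"
  then obtain xs where w: "xs \<in> lists V" "x = word_class V E xs" unfolding RACG_carrier by blast
  have n: "[] \<in> lists V" "rev xs \<in> lists V" "rev xs @ xs \<in> lists V" using w by auto
  show "\<one>\<^bsub>RACG V E\<^esub> \<otimes>\<^bsub>RACG V E\<^esub> x = x"
    unfolding RACG_one w(2) RACG_mult[OF n(1) w(1)] by simp
  have "word_class V E (rev xs) \<otimes>\<^bsub>RACG V E\<^esub> x = \<one>\<^bsub>RACG V E\<^esub>"
    unfolding w(2) RACG_mult[OF n(2) w(1)] RACG_one using word_class_eq[OF n(3,1)] RACG_rev[OF w(1)] by blast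
  moreover have "word_class V E (rev xs) \<in> carrier (RACG V E)" unfolding RACG_carrier using n(2) by blast
  ultimately show "\<exists>y\<in>carrier (RACG V E). y \<otimes>\<^bsub>RACG V E\<^esub> x = \<one>\<^bsub>RACG V E\<^esub>" by blast
qed

lemma wprod_special:
  assumes "C \<subseteq> V" "xs \<in> lists C"
  shows "wprod (special_subgroup V E C) (racg_gen V E) xs = word_class V E xs"
  using assms(2)
proof (induction xs rule: list.induct)
  case (Cons x xs)
  then have x: "xs \<in> lists C" "xs \<in> lists V" "[x] \<in> lists V" using assms(1) by auto
  have "wprod (special_subgroup V E C) (racg_gen V E) (x # xs)
      = word_class V E [x] \<otimes>\<^bsub>RACG V E\<^esub> word_class V E xs"
    using Cons.IH[OF x(1)] by (simp add: wprod_def special_subgroup_def racg_gen_def)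
  also have "\<dots> = word_class V E (x # xs)" using RACG_mult[OF x(3,2)] by simp
  finally show ?case .
qed (simp add: wprod_def special_subgroup_def RACG_one)

lemma special_carrier:
  assumes C: "C \<subseteq> V"
  shows "carrier (special_subgroup V E C) = word_class V E ` lists C"
proof -
  interpret group "RACG V E" by (rule RACG_group)
  have inV: "xs \<in> lists C \<Longrightarrow> xs \<in> lists V" for xs using C by auto
  have gen_inv: "inv\<^bsub>RACG V E\<^esub> racg_gen V E v = racg_gen V E v" if v: "v \<in> C" for v
  proof (rule inv_equality)
    have l: "[v] \<in> lists V" using v C by auto
    show "racg_gen V E v \<otimes>\<^bsub>RACG V E\<^esub> racg_gen V E v = \<one>\<^bsub>RACG V E\<^esub>"
      unfolding racg_gen_def RACG_mult[OF l l] RACG_one using RACG_rev[OF l, of E] word_class_eq[of "[v] @ [v]" V "[]" E] l by simp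
    show "racg_gen V E v \<in> carrier (RACG V E)" unfolding racg_gen_def RACG_carrier using l by blast
    then show "racg_gen V E v \<in> carrier (RACG V E)" .
  qed
  have "generate (RACG V E) (racg_gen V E ` C) = word_class V E ` lists C"
  proof
    show "generate (RACG V E) (racg_gen V E ` C) \<subseteq> word_class V E ` lists C"
    proof
      fix g assume "g \<in> generate (RACG V E) (racg_gen V E ` C)"
      then show "g \<in> word_class V E ` lists C"
      proof (induction rule: generate.induct)
        case one
        show ?case unfolding RACG_one by (rule imageI) simp
      next
        case (incl h)
        then obtain v where "v \<in> C" "h = word_class V E [v]" by (auto simp: racg_gen_def)
        then show ?case by (intro image_eqI[of _ _ "[v]"]) auto
      next
        case (inv h)
        then obtain v where "v \<in> C" "h = racg_gen V E v" by auto
        then show ?case using gen_inv by (intro image_eqI[of _ _ "[v]"]) (auto simp: racg_gen_def)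
      next
        case (eng h1 h2)
        then obtain xs ys where w: "xs \<in> lists C" "ys \<in> lists C" "h1 = word_class V E xs" "h2 = word_class V E ys" by blast
        then have "h1 \<otimes>\<^bsub>RACG V E\<^esub> h2 = word_class V E (xs @ ys)" using RACG_mult[OF inV[OF w(1)] inV[OF w(2)]] by simp
        then show ?case using w by (intro image_eqI[of _ _ "xs @ ys"]) auto
      qed
    qed
    have "xs \<in> lists C \<Longrightarrow> word_class V E xs \<in> generate (RACG V E) (racg_gen V E ` C)" for xs
    proof (induction xs rule: list.induct)
      case Nil
      then show ?case using generate.one[of "RACG V E"] by (simp add: RACG_one)
    next
      case (Cons x xs)
      then have x: "x \<in> C" "xs \<in> lists C" "[x] \<in> lists V" "xs \<in> lists V" using inV C by auto
      have "word_class V E [x] \<in> generate (RACG V E) (racg_gen V E ` C)"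
        using x(1) by (intro generate.incl) (auto simp: racg_gen_def)
      from generate.eng[OF this Cons.IH[OF x(2)]] show ?case using RACG_mult[OF x(3,4)] by simp
    qed
    then show "word_class V E ` lists C \<subseteq> generate (RACG V E) (racg_gen V E ` C)" by blast
  qed
  then show ?thesis by (simp add: special_subgroup_def)
qed

lemma special_group:
  assumes "C \<subseteq> V" shows "group (special_subgroup V E C)"
proof -
  interpret group "RACG V E" by (rule RACG_group)
  have "racg_gen V E ` C \<subseteq> carrier (RACG V E)"
    unfolding racg_gen_def RACG_carrier using assms by auto
  then show ?thesis unfolding special_subgroup_def
    by (intro subgroup.subgroup_is_group generate_is_subgroup is_group)
qed

text \<open>The elements remain classes of words over \<open>V\<close>, but deleting letters shows
  that two words over \<open>C\<close> are equivalent over \<open>V\<close> exactly when they are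
  equivalent over \<open>C\<close>. The subgroup is thus the Coxeter group of the induced
  graph.\<close>

lemma special_racg:
  assumes "finite V" "C \<subseteq> V"
  shows "racg (special_subgroup V E C) C E (racg_gen V E)"
proof -
  interpret group "special_subgroup V E C" by (rule special_group[OF assms(2)])
  show ?thesis
  proof
    show "finite C" using assms by (rule rev_finite_subset)
    show "racg_gen V E v \<in> carrier (special_subgroup V E C)" if "v \<in> C" for v
      unfolding special_carrier[OF assms(2)] racg_gen_def using that by auto
    show "wprod (special_subgroup V E C) (racg_gen V E) xs = wprod (special_subgroup V E C) (racg_gen V E) ys
        \<longleftrightarrow> (xs, ys) \<in> racg_rel C E" if "xs \<in> lists C" "ys \<in> lists C" for xs ys
    proof -
      have "xs \<in> lists V" "ys \<in> lists V" using that assms(2) by auto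
      then show ?thesis
        using wprod_special[OF assms(2)] that word_class_eq racg_rel_restrict[OF that assms(2)] by metis
    qed
    show "\<exists>xs\<in>lists C. g = wprod (special_subgroup V E C) (racg_gen V E) xs"
      if "g \<in> carrier (special_subgroup V E C)" for g
      using that wprod_special[OF assms(2)] unfolding special_carrier[OF assms(2)] by auto
  qed
qed

text \<open>The whole group is the case \<open>C = V\<close> of the special subgroups, so it needs
  no argument of its own.\<close>

lemma special_full: "special_subgroup V E V = RACG V E"
  using special_carrier[of V V E] RACG_carrier[of V E] by (simp add: special_subgroup_def)

lemma squares_mono: "C \<subseteq> V \<Longrightarrow> squares C E \<subseteq> squares V E"
proof
  fix T assume CV: "C \<subseteq> V" and "T \<in> squares C E"
  then obtain a b c d where abcd: "T = {a, b, c, d}" "is_square E a b c d" "T \<subseteq> C" by (auto simp: squares_def)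
  have "{a, b, c, d} \<subseteq> V" using order_trans[OF abcd(3) CV] abcd(1) by simp
  then show "T \<in> squares V E" unfolding squares_def using abcd(1,2) by blast
qed

definition sparse_graph :: "'a set \<Rightarrow> 'a set set \<Rightarrow> bool" where
  "sparse_graph V E \<longleftrightarrow>
     (\<forall>a b c d. is_square E a b c d \<longrightarrow> {a, b, c, d} \<subseteq> V \<longrightarrow> \<not> adj E a c) \<and>
     (\<forall>T\<in>squares V E. \<forall>e\<in>V - T. \<forall>p\<in>T. \<forall>q\<in>T. adj E e p \<longrightarrow> adj E e q \<longrightarrow> p = q)"

lemma sparse_special:
  assumes "finite V" "C \<subseteq> V" "sparse_graph V E"
  shows "sparse_racg (special_subgroup V E C) C E (racg_gen V E)"
proof -
  interpret racg "special_subgroup V E C" C E "racg_gen V E" by (rule special_racg[OF assms(1,2)])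
  have sub: "squares C E \<subseteq> squares V E" by (rule squares_mono[OF assms(2)])
  show ?thesis
  proof
    show "\<not> adj E a c" if "is_square E a b c d" "{a, b, c, d} \<subseteq> C" for a b c d
    proof -
      have "{a, b, c, d} \<subseteq> V" by (rule order_trans[OF that(2) assms(2)])
      moreover have "is_square E a b c d \<longrightarrow> {a, b, c, d} \<subseteq> V \<longrightarrow> \<not> adj E a c"
        using assms(3) unfolding sparse_graph_def by (elim conjE allE)
      ultimately show ?thesis using that(1) by simp
    qed
    show "p = q" if "T \<in> squares C E" "e \<in> C - T" "p \<in> T" "q \<in> T" "adj E e p" "adj E e q" for T e p q
    proof -
      have "T \<in> squares V E" using that(1) sub by (rule rev_subsetD)
      moreover have "e \<in> V - T" using that(2) assms(2) by blast
      ultimately have "\<forall>p\<in>T. \<forall>q\<in>T. adj E e p \<longrightarrow> adj E e q \<longrightarrow> p = q"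
        using assms(3)[unfolded sparse_graph_def, THEN conjunct2] by blast
      then show ?thesis using that(3-6) by blast
    qed
  qed
qed

theorem special_rel_hyp_DD:
  assumes "finite V" "C \<subseteq> V" "sparse_graph V E" "squares C E \<noteq> {}" "4 < card C"
  shows "\<exists>\<P>. rel_hyp_DD (special_subgroup V E C) \<P>"
proof -
  interpret sparse_racg "special_subgroup V E C" C E "racg_gen V E" by (rule sparse_special[OF assms(1-3)])
  show ?thesis using rel_hyp_DD_squares[OF assms(4,5)] by blast
qed

theorem RACG_rel_hyp_DD:
  assumes "finite V" "sparse_graph V E" "4 < card V"
    and "T \<in> squares V E" "t \<in> T" "v \<in> V - T" "adj E v t"
  shows "\<exists>\<P>. rel_hyp_DD (RACG V E) \<P> \<and> (\<exists>P\<in>\<P>. \<not> proper_free_factor (RACG V E) P)"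
proof -
  interpret sparse_racg "special_subgroup V E V" V E "racg_gen V E"
    by (rule sparse_special[OF assms(1) subset_refl assms(2)])
  have "squares V E \<noteq> {}" using assms(4) by auto
  then have "rel_hyp_DD (RACG V E) square_subgroups" using rel_hyp_DD_squares assms(3) by (simp add: special_full)
  moreover have "parab T \<in> square_subgroups" using assms(4) by (simp add: square_subgroups_def)
  moreover have "\<not> proper_free_factor (RACG V E) (parab T)"
    using not_free_factor[OF assms(4-7)] by (simp add: special_full)
  ultimately show ?thesis by blast
qed

section \<open>Random graphs\<close>

definition weight :: "'a set \<Rightarrow> real \<Rightarrow> 'a set \<Rightarrow> real" where
  "weight U p E = p ^ card E * (1 - p) ^ (card U - card E)"

text \<open>The ground set is arbitrary and need not be a set of pairs, so that the product measure
  can be split along a partition of the edges.\<close>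

definition expect :: "'a set \<Rightarrow> real \<Rightarrow> ('a set \<Rightarrow> real) \<Rightarrow> real" where
  "expect U p f = (\<Sum>E\<in>Pow U. weight U p E * f E)"

definition Pr :: "'a set \<Rightarrow> real \<Rightarrow> ('a set \<Rightarrow> bool) \<Rightarrow> real" where
  "Pr U p Q = expect U p (\<lambda>E. of_bool (Q E))"

lemma gnp_prob_Pr: "gnp_prob n p Q = Pr (pairs n) p Q"
proof -
  have fin: "finite (pairs n)"
    by (rule finite_subset[of _ "Pow {..<n}"]) (auto simp: pairs_def)
  have "(\<Sum>E\<in>Pow (pairs n). weight (pairs n) p E * of_bool (Q E)) = (\<Sum>E\<in>Pow (pairs n). if Q E then weight (pairs n) p E else 0)"
    by (intro sum.cong) auto
  also have "\<dots> = (\<Sum>E\<in>{E \<in> Pow (pairs n). Q E}. weight (pairs n) p E)"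
    by (rule sum.inter_filter[symmetric]) (use fin in simp)
  finally show ?thesis unfolding gnp_prob_def Pr_def expect_def weight_def by simp
qed

context
  fixes p :: real
  assumes p: "0 \<le> p" "p \<le> 1"
begin

lemma weight_nonneg: "0 \<le> weight U p E"
  using p by (simp add: weight_def)

lemma weight_union:
  assumes "finite A" "finite B" "A \<inter> B = {}" "E \<subseteq> A" "F \<subseteq> B"
  shows "weight (A \<union> B) p (E \<union> F) = weight A p E * weight B p F"
proof -
  have c: "card (A \<union> B) = card A + card B" "card (E \<union> F) = card E + card F"
    using assms by (auto intro!: card_Un_disjoint dest: finite_subset)
  have le: "card E \<le> card A" "card F \<le> card B" using assms by (auto intro: card_mono)
  then have "card A + card B - (card E + card F) = (card A - card E) + (card B - card F)" by simp
  then show ?thesis unfolding weight_def c by (simp add: power_add)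
qed

text \<open>Independence of disjoint sets of edges, in the form of Fubini.\<close>

lemma expect_split:
  assumes "finite A" "finite B" "A \<inter> B = {}"
  shows "expect (A \<union> B) p f = expect A p (\<lambda>E. expect B p (\<lambda>F. f (E \<union> F)))"
proof -
  have "expect A p (\<lambda>E. expect B p (\<lambda>F. f (E \<union> F))) = (\<Sum>(E, F)\<in>Pow A \<times> Pow B. weight A p E * weight B p F * f (E \<union> F))"
    unfolding expect_def sum_distrib_left using assms by (simp add: sum.cartesian_product mult.assoc)
  also have "\<dots> = (\<Sum>(E, F)\<in>Pow A \<times> Pow B. weight (A \<union> B) p (E \<union> F) * f (E \<union> F))"
    using assms by (intro sum.cong) (auto simp: weight_union)
  also have "\<dots> = (\<Sum>E\<in>Pow (A \<union> B). weight (A \<union> B) p E * f E)"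
    by (rule sum.reindex_bij_witness[of _ "\<lambda>E. (E \<inter> A, E \<inter> B)" "\<lambda>(E, F). E \<union> F"])
      (use assms in \<open>auto simp: Int_Un_distrib2\<close>)
  finally show ?thesis by (simp add: expect_def)
qed

lemma expect_empty [simp]: "expect {} p f = f {}"
  by (simp add: expect_def weight_def)

lemma expect_cong: "(\<And>E. E \<subseteq> U \<Longrightarrow> f E = g E) \<Longrightarrow> expect U p f = expect U p g"
  unfolding expect_def by (intro sum.cong) auto

lemma expect_mono: "(\<And>E. E \<subseteq> U \<Longrightarrow> f E \<le> g E) \<Longrightarrow> expect U p f \<le> expect U p g"
  unfolding expect_def using weight_nonneg by (intro sum_mono mult_left_mono) auto

lemma expect_add: "expect U p (\<lambda>E. f E + g E) = expect U p f + expect U p g"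
  unfolding expect_def by (simp add: algebra_simps sum.distrib)

lemma expect_cmult: "expect U p (\<lambda>E. c * f E) = c * expect U p f"
  unfolding expect_def sum_distrib_left by (intro sum.cong) auto

lemma expect_sum: "expect U p (\<lambda>E. \<Sum>i\<in>I. f i E) = (\<Sum>i\<in>I. expect U p (f i))"
  unfolding expect_def sum_distrib_left by (rule sum.swap)

lemma expect_insert:
  assumes "finite U" "x \<notin> U"
  shows "expect (insert x U) p f = p * expect U p (\<lambda>E. f (insert x E)) + (1 - p) * expect U p f"
proof -
  have "expect ({x} \<union> U) p f = expect {x} p (\<lambda>E. expect U p (\<lambda>F. f (E \<union> F)))"
    using assms by (intro expect_split) auto
  also have "\<dots> = p * expect U p (\<lambda>E. f (insert x E)) + (1 - p) * expect U p f"
    by (simp add: expect_def[of "{x}"] Pow_insert weight_def)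
  finally show ?thesis by simp
qed

lemma expect_const: "finite U \<Longrightarrow> expect U p (\<lambda>_. c) = c"
  by (induction U rule: finite_induct) (auto simp: expect_insert algebra_simps)

lemma Pr_superset:
  assumes "finite U" "F \<subseteq> U"
  shows "Pr U p (\<lambda>E. F \<subseteq> E) = p ^ card F"
proof -
  have fF: "finite F" using assms finite_subset by blast
  have "expect F p (\<lambda>E. of_bool (F \<subseteq> E)) = p ^ card F"
  proof -
    have "(\<Sum>E\<in>Pow F. weight F p E * of_bool (F \<subseteq> E)) = (\<Sum>E\<in>{F}. weight F p E * of_bool (F \<subseteq> E))"
      using fF by (intro sum.mono_neutral_right) auto
    then show ?thesis by (simp add: expect_def weight_def)
  qed
  moreover have "expect (F \<union> (U - F)) p (\<lambda>E. of_bool (F \<subseteq> E)) = expect F p (\<lambda>E. expect (U - F) p (\<lambda>E'. of_bool (F \<subseteq> E \<union> E')))"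
    using assms fF by (intro expect_split) auto
  moreover have "\<dots> = expect F p (\<lambda>E. of_bool (F \<subseteq> E))"
  proof (rule expect_cong)
    fix E assume "E \<subseteq> F"
    have "expect (U - F) p (\<lambda>E'. of_bool (F \<subseteq> E \<union> E')) = expect (U - F) p (\<lambda>_. of_bool (F \<subseteq> E))"
      by (rule expect_cong) (auto intro!: arg_cong[of _ _ of_bool])
    then show "expect (U - F) p (\<lambda>E'. of_bool (F \<subseteq> E \<union> E')) = of_bool (F \<subseteq> E)"
      using assms by (simp add: expect_const)
  qed
  moreover have "F \<union> (U - F) = U" using assms by auto
  ultimately show ?thesis by (simp add: Pr_def)
qed

lemma Pr_disjoint:
  assumes "finite U" "F \<subseteq> U"
  shows "Pr U p (\<lambda>E. E \<inter> F = {}) = (1 - p) ^ card F"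
proof -
  have fF: "finite F" using assms finite_subset by blast
  have "expect F p (\<lambda>E. of_bool (E \<inter> F = {})) = (1 - p) ^ card F"
  proof -
    have "(\<Sum>E\<in>Pow F. weight F p E * of_bool (E \<inter> F = {})) = (\<Sum>E\<in>{{}}. weight F p E * of_bool (E \<inter> F = {}))"
      using fF by (intro sum.mono_neutral_right) auto
    then show ?thesis by (simp add: expect_def weight_def)
  qed
  moreover have "expect (F \<union> (U - F)) p (\<lambda>E. of_bool (E \<inter> F = {}))
      = expect F p (\<lambda>E. expect (U - F) p (\<lambda>E'. of_bool ((E \<union> E') \<inter> F = {})))"
    using assms fF by (intro expect_split) auto
  moreover have "\<dots> = expect F p (\<lambda>E. of_bool (E \<inter> F = {}))"
  proof (rule expect_cong)
    fix E assume "E \<subseteq> F"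
    have "expect (U - F) p (\<lambda>E'. of_bool ((E \<union> E') \<inter> F = {})) = expect (U - F) p (\<lambda>_. of_bool (E \<inter> F = {}))"
      by (rule expect_cong) (auto intro!: arg_cong[of _ _ of_bool])
    then show "expect (U - F) p (\<lambda>E'. of_bool ((E \<union> E') \<inter> F = {})) = of_bool (E \<inter> F = {})"
      using assms by (simp add: expect_const)
  qed
  moreover have "F \<union> (U - F) = U" using assms by auto
  ultimately show ?thesis by (simp add: Pr_def)
qed

lemma Pr_mono: "(\<And>E. E \<subseteq> U \<Longrightarrow> Q E \<Longrightarrow> R E) \<Longrightarrow> Pr U p Q \<le> Pr U p R"
  unfolding Pr_def by (rule expect_mono) auto

lemma Pr_le_1: "finite U \<Longrightarrow> Pr U p Q \<le> 1"
  using expect_mono[of U "\<lambda>E. of_bool (Q E)" "\<lambda>_. 1"] expect_const[of U 1] by (simp add: Pr_def)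

lemma Pr_compl: "finite U \<Longrightarrow> Pr U p Q = 1 - Pr U p (\<lambda>E. \<not> Q E)"
proof -
  assume "finite U"
  moreover have "expect U p (\<lambda>E. of_bool (Q E) + of_bool (\<not> Q E)) = expect U p (\<lambda>_. 1)"
    by (rule expect_cong) simp
  ultimately show ?thesis by (simp add: expect_add Pr_def expect_const)
qed

lemma Pr_disj: "Pr U p (\<lambda>E. Q E \<or> R E) \<le> Pr U p Q + Pr U p R"
  unfolding Pr_def expect_add[symmetric] by (rule expect_mono) auto

lemma Pr_exists:
  assumes "finite I"
  shows "Pr U p (\<lambda>E. \<exists>i\<in>I. Q i E) \<le> (\<Sum>i\<in>I. Pr U p (Q i))"
  unfolding Pr_def expect_sum[symmetric]
proof (rule expect_mono)
  fix E
  show "of_bool (\<exists>i\<in>I. Q i E) \<le> (\<Sum>i\<in>I. of_bool (Q i E) :: real)"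
  proof (cases "\<exists>i\<in>I. Q i E")
    case True
    then obtain i where "i \<in> I" "Q i E" by auto
    then show ?thesis using member_le_sum[of i I "\<lambda>i. of_bool (Q i E) :: real"] assms by simp
  qed (simp add: sum_nonneg)
qed

lemma Pr_exists_superset:
  assumes "finite U" "finite I" "\<And>i. i \<in> I \<Longrightarrow> F i \<subseteq> U \<and> card (F i) = k" "card I \<le> M"
  shows "Pr U p (\<lambda>E. \<exists>i\<in>I. F i \<subseteq> E) \<le> real M * p ^ k"
proof -
  have "Pr U p (\<lambda>E. \<exists>i\<in>I. F i \<subseteq> E) \<le> (\<Sum>i\<in>I. Pr U p (\<lambda>E. F i \<subseteq> E))" by (rule Pr_exists[OF assms(2)])
  also have "\<dots> = real (card I) * p ^ k" using assms by (simp add: Pr_superset)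
  also have "\<dots> \<le> real M * p ^ k" using assms(4) p by (intro mult_right_mono) auto
  finally show ?thesis .
qed

text \<open>The edges in A are exposed first: the set S to be avoided may depend on them.\<close>

lemma Pr_two_step:
  assumes "finite A" "finite B" "A \<inter> B = {}"
    and S: "\<And>E. E \<subseteq> A \<Longrightarrow> R E \<Longrightarrow> S E \<subseteq> B \<and> (1 - p) ^ card (S E) \<le> c" and c: "0 \<le> c"
  shows "Pr (A \<union> B) p (\<lambda>E. R (E \<inter> A) \<and> E \<inter> S (E \<inter> A) = {}) \<le> c"
proof -
  have "Pr (A \<union> B) p (\<lambda>E. R (E \<inter> A) \<and> E \<inter> S (E \<inter> A) = {})
      = expect A p (\<lambda>E. expect B p (\<lambda>F. of_bool (R ((E \<union> F) \<inter> A) \<and> (E \<union> F) \<inter> S ((E \<union> F) \<inter> A) = {})))"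
    unfolding Pr_def by (rule expect_split[OF assms(1-3)])
  also have "\<dots> \<le> expect A p (\<lambda>_. c)"
  proof (rule expect_mono)
    fix E assume E: "E \<subseteq> A"
    have EF: "(E \<union> F) \<inter> A = E" if "F \<subseteq> B" for F using that E assms(3) by auto
    show "expect B p (\<lambda>F. of_bool (R ((E \<union> F) \<inter> A) \<and> (E \<union> F) \<inter> S ((E \<union> F) \<inter> A) = {})) \<le> c"
    proof (cases "R E")
      case True
      have "expect B p (\<lambda>F. of_bool (R ((E \<union> F) \<inter> A) \<and> (E \<union> F) \<inter> S ((E \<union> F) \<inter> A) = {}))
          \<le> Pr B p (\<lambda>F. F \<inter> S E = {})"
        unfolding Pr_def by (rule expect_mono) (auto simp: EF)
      also have "\<dots> = (1 - p) ^ card (S E)" using S[OF E True] assms by (intro Pr_disjoint) auto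
      finally show ?thesis using S[OF E True] by linarith
    next
      case False
      have "expect B p (\<lambda>F. of_bool (R ((E \<union> F) \<inter> A) \<and> (E \<union> F) \<inter> S ((E \<union> F) \<inter> A) = {})) = expect B p (\<lambda>_. 0)"
        by (rule expect_cong) (simp add: EF False)
      then show ?thesis using c assms by (simp add: expect_const)
    qed
  qed
  also have "\<dots> = c" using assms by (simp add: expect_const)
  finally show ?thesis .
qed

lemma one_minus_power_le_exp: "(1 - p) ^ m \<le> exp (- p * real m)"
proof -
  have "1 - p \<le> exp (- p)" using exp_ge_add_one_self[of "- p"] by simp
  then have "(1 - p) ^ m \<le> exp (- p) ^ m" using p by (intro power_mono) auto
  also have "\<dots> = exp (- p * real m)" by (simp add: exp_of_nat_mult[symmetric] mult.commute)
  finally show ?thesis .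
qed

text \<open>Chebyshev's inequality for the number of configurations \<open>F i\<close> contained in
  the graph; \<open>d\<close> bounds the variance relative to the squared mean.\<close>

lemma Pr_second_moment:
  assumes "finite U" "finite I" "\<And>i. i \<in> I \<Longrightarrow> F i \<subseteq> U \<and> card (F i) = k"
    and mu: "mu = real (card I) * p ^ k" "0 < mu"
    and second: "(\<Sum>i\<in>I. \<Sum>j\<in>I. p ^ card (F i \<union> F j)) \<le> mu\<^sup>2 + d * mu\<^sup>2"
  shows "Pr U p (\<lambda>E. \<not> (\<exists>i\<in>I. F i \<subseteq> E)) \<le> d"
proof -
  define Y where "Y E = (\<Sum>i\<in>I. of_bool (F i \<subseteq> E) :: real)" for E
  have "expect U p Y = (\<Sum>i\<in>I. Pr U p (\<lambda>E. F i \<subseteq> E))" unfolding Y_def expect_sum Pr_def ..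
  then have EX: "expect U p Y = mu" using assms(1,3) mu(1) by (simp add: Pr_superset)
  have "expect U p (\<lambda>E. Y E * Y E) = (\<Sum>i\<in>I. \<Sum>j\<in>I. Pr U p (\<lambda>E. F i \<union> F j \<subseteq> E))"
    unfolding Y_def sum_product expect_sum Pr_def
    by (intro sum.cong refl expect_cong) (simp add: of_bool_conj[symmetric])
  also have "\<dots> = (\<Sum>i\<in>I. \<Sum>j\<in>I. p ^ card (F i \<union> F j))"
    using assms(1,3) by (intro sum.cong refl Pr_superset) auto
  finally have EXX: "expect U p (\<lambda>E. Y E * Y E) \<le> mu\<^sup>2 + d * mu\<^sup>2" using second by simp
  \<comment> \<open>The function on the right is \<open>(Y - mu)^2 / mu^2\<close>: it is nonnegative
    and equals 1 where \<open>Y\<close> vanishes.\<close>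
  have "Pr U p (\<lambda>E. \<not> (\<exists>i\<in>I. F i \<subseteq> E)) \<le> expect U p (\<lambda>E. (1 / mu\<^sup>2) * (Y E * Y E + ((-2 * mu) * Y E + mu\<^sup>2)))"
    unfolding Pr_def
  proof (rule expect_mono)
    fix E
    have e: "Y E * Y E + ((-2 * mu) * Y E + mu\<^sup>2) = (Y E - mu)\<^sup>2" by (simp add: power2_eq_square algebra_simps)
    show "of_bool (\<not> (\<exists>i\<in>I. F i \<subseteq> E)) \<le> (1 / mu\<^sup>2) * (Y E * Y E + ((-2 * mu) * Y E + mu\<^sup>2))"
    proof (cases "\<exists>i\<in>I. F i \<subseteq> E")
      case False
      then have "Y E = 0" by (simp add: Y_def)
      then show ?thesis using mu(2) by simp
    next
      case True
      then show ?thesis unfolding e using mu(2) by simp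
    qed
  qed
  also have "\<dots> = (1 / mu\<^sup>2) * (expect U p (\<lambda>E. Y E * Y E) - mu\<^sup>2)"
    unfolding expect_cmult expect_add EX expect_const[OF assms(1)] by (simp add: power2_eq_square)
  also have "\<dots> \<le> (1 / mu\<^sup>2) * (d * mu\<^sup>2)" using EXX by (intro mult_left_mono) auto
  also have "\<dots> = d" using mu(2) by simp
  finally show ?thesis .
qed

end

section \<open>Forbidden subgraphs\<close>

lemma finite_pairs [simp]: "finite (pairs n)"
  by (rule finite_subset[of _ "Pow {..<n}"]) (auto simp: pairs_def)

lemma pairs_iff: "{i, j} \<in> pairs n \<longleftrightarrow> i \<noteq> j \<and> i < n \<and> j < n"
proof
  assume "{i, j} \<in> pairs n"
  then show "i \<noteq> j \<and> i < n \<and> j < n" by (auto simp: pairs_def doubleton_eq_iff)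
next
  assume "i \<noteq> j \<and> i < n \<and> j < n"
  then show "{i, j} \<in> pairs n"
    unfolding pairs_def mem_Collect_eq by (metis insert_commute linorder_neqE_nat)
qed

lemma pairs_form: "e \<in> pairs n \<Longrightarrow> \<exists>i j. e = {i, j} \<and> i \<noteq> j \<and> i < n \<and> j < n"
  unfolding pairs_def by force

lemma adj_pairs: "E \<subseteq> pairs n \<Longrightarrow> adj E u v \<longleftrightarrow> {u, v} \<in> E"
  unfolding adj_def by (auto simp: pairs_def)

lemma adj_pairs_less: "E \<subseteq> pairs n \<Longrightarrow> adj E u v \<Longrightarrow> u < n \<and> v < n"
  using pairs_iff by (auto simp: adj_def)

definition quads :: "nat \<Rightarrow> (nat \<times> nat \<times> nat \<times> nat) set" where
  "quads n = {(a, b, c, d). distinct [a, b, c, d] \<and> a < n \<and> b < n \<and> c < n \<and> d < n}"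

definition quints :: "nat \<Rightarrow> (nat \<times> nat \<times> nat \<times> nat \<times> nat) set" where
  "quints n = {(a, b, c, d, e). distinct [a, b, c, d, e] \<and> a < n \<and> b < n \<and> c < n \<and> d < n \<and> e < n}"

lemma quads_finite: "finite (quads n)" "card (quads n) \<le> n ^ 4"
proof -
  have s: "quads n \<subseteq> {..<n} \<times> {..<n} \<times> {..<n} \<times> {..<n}" by (auto simp: quads_def)
  then show "finite (quads n)" by (rule finite_subset) auto
  show "card (quads n) \<le> n ^ 4"
    using card_mono[OF _ s] by (simp add: card_cartesian_product power_numeral_reduce)
qed

lemma quints_finite: "finite (quints n)" "card (quints n) \<le> n ^ 5"
proof -
  have s: "quints n \<subseteq> {..<n} \<times> {..<n} \<times> {..<n} \<times> {..<n} \<times> {..<n}" by (auto simp: quints_def)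
  then show "finite (quints n)" by (rule finite_subset) auto
  show "card (quints n) \<le> n ^ 5"
    using card_mono[OF _ s] by (simp add: card_cartesian_product power_numeral_reduce)
qed

definition cycle_edges :: "'a \<times> 'a \<times> 'a \<times> 'a \<Rightarrow> 'a set set" where
  "cycle_edges = (\<lambda>(a, b, c, d). {{a, b}, {b, c}, {c, d}, {d, a}})"

definition chorded :: "nat \<Rightarrow> nat set set \<Rightarrow> bool" where
  "chorded n E \<longleftrightarrow> (\<exists>i\<in>quads n. (\<lambda>(a, b, c, d). insert {a, c} (cycle_edges (a, b, c, d))) i \<subseteq> E)"

text \<open>The complete bipartite graph on 2 + 3 vertices: the further vertex sees two opposite
  vertices of the 4-cycle. In \<open>house_graph\<close> it sees two neighbouring ones.\<close>

definition theta_graph :: "nat \<Rightarrow> nat set set \<Rightarrow> bool" where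
  "theta_graph n E \<longleftrightarrow> (\<exists>i\<in>quints n. (\<lambda>(a, b, c, d, e). {{e, a}, {e, c}} \<union> cycle_edges (a, b, c, d)) i \<subseteq> E)"

definition house_graph :: "nat \<Rightarrow> nat set set \<Rightarrow> bool" where
  "house_graph n E \<longleftrightarrow> (\<exists>i\<in>quints n. (\<lambda>(a, b, c, d, e). {{e, a}, {e, b}} \<union> cycle_edges (a, b, c, d)) i \<subseteq> E)"

context
  fixes p :: real
  assumes p: "0 \<le> p" "p \<le> 1"
begin

lemma Pr_chorded: "Pr (pairs n) p (chorded n) \<le> real (n ^ 4) * p ^ 5"
  unfolding chorded_def
proof (rule Pr_exists_superset[OF p finite_pairs quads_finite(1) _ quads_finite(2)])
  fix i assume "i \<in> quads n"
  then show "(\<lambda>(a, b, c, d). insert {a, c} (cycle_edges (a, b, c, d))) i \<subseteq> pairs n \<and>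
    card ((\<lambda>(a, b, c, d). insert {a, c} (cycle_edges (a, b, c, d))) i) = 5"
    by (auto simp: quads_def cycle_edges_def pairs_iff doubleton_eq_iff)
qed

lemma Pr_theta: "Pr (pairs n) p (theta_graph n) \<le> real (n ^ 5) * p ^ 6"
  unfolding theta_graph_def
proof (rule Pr_exists_superset[OF p finite_pairs quints_finite(1) _ quints_finite(2)])
  fix i assume "i \<in> quints n"
  then show "(\<lambda>(a, b, c, d, e). {{e, a}, {e, c}} \<union> cycle_edges (a, b, c, d)) i \<subseteq> pairs n \<and>
    card ((\<lambda>(a, b, c, d, e). {{e, a}, {e, c}} \<union> cycle_edges (a, b, c, d)) i) = 6"
    by (auto simp: quints_def cycle_edges_def pairs_iff doubleton_eq_iff)
qed

lemma Pr_house: "Pr (pairs n) p (house_graph n) \<le> real (n ^ 5) * p ^ 6"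
  unfolding house_graph_def
proof (rule Pr_exists_superset[OF p finite_pairs quints_finite(1) _ quints_finite(2)])
  fix i assume "i \<in> quints n"
  then show "(\<lambda>(a, b, c, d, e). {{e, a}, {e, b}} \<union> cycle_edges (a, b, c, d)) i \<subseteq> pairs n \<and>
    card ((\<lambda>(a, b, c, d, e). {{e, a}, {e, b}} \<union> cycle_edges (a, b, c, d)) i) = 6"
    by (auto simp: quints_def cycle_edges_def pairs_iff doubleton_eq_iff)
qed

end

lemma is_square_cycle_edges:
  assumes "E \<subseteq> pairs n"
  shows "is_square E a b c d \<longleftrightarrow> distinct [a, b, c, d] \<and> cycle_edges (a, b, c, d) \<subseteq> E"
  unfolding is_square_def cycle_edges_def adj_def by auto

lemma is_square_rotate: "is_square E a b c d \<Longrightarrow> is_square E b c d a"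
  by (auto simp: is_square_def)

lemma sparse_graphI:
  assumes E: "E \<subseteq> pairs n" and n: "\<not> chorded n E" "\<not> theta_graph n E" "\<not> house_graph n E"
  shows "sparse_graph {..<n} E"
  unfolding sparse_graph_def
proof (intro conjI allI ballI impI)
  fix a b c d assume sq: "is_square E a b c d" "{a, b, c, d} \<subseteq> {..<n}"
  show "\<not> adj E a c"
  proof
    assume "adj E a c"
    then have "(a, b, c, d) \<in> quads n" "insert {a, c} (cycle_edges (a, b, c, d)) \<subseteq> E"
      using sq is_square_cycle_edges[OF E] by (auto simp: quads_def adj_def)
    then have "chorded n E" unfolding chorded_def by (intro bexI[of _ "(a, b, c, d)"]) simp_all
    then show False using n(1) by simp
  qed
next
  fix T e u v
  assume T: "T \<in> squares {..<n} E" and e: "e \<in> {..<n} - T" and uv: "u \<in> T" "v \<in> T" "adj E e u" "adj E e v"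
  have th: "\<not> (adj E e a \<and> adj E e c)" if "is_square E a b c d" "T = {a, b, c, d}" "T \<subseteq> {..<n}" for a b c d
  proof
    assume "adj E e a \<and> adj E e c"
    then have "(a, b, c, d, e) \<in> quints n" "{{e, a}, {e, c}} \<union> cycle_edges (a, b, c, d) \<subseteq> E"
      using that e is_square_cycle_edges[OF E] by (auto simp: quints_def adj_def)
    then have "theta_graph n E" unfolding theta_graph_def by (intro bexI[of _ "(a, b, c, d, e)"]) simp_all
    then show False using n(2) by simp
  qed
  have ho: "\<not> (adj E e a \<and> adj E e b)" if "is_square E a b c d" "T = {a, b, c, d}" "T \<subseteq> {..<n}" for a b c d
  proof
    assume "adj E e a \<and> adj E e b"
    then have "(a, b, c, d, e) \<in> quints n" "{{e, a}, {e, b}} \<union> cycle_edges (a, b, c, d) \<subseteq> E"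
      using that e is_square_cycle_edges[OF E] by (auto simp: quints_def adj_def)
    then have "house_graph n E" unfolding house_graph_def by (intro bexI[of _ "(a, b, c, d, e)"]) simp_all
    then show False using n(3) by simp
  qed
  obtain a b c d where sq: "is_square E a b c d" "T = {a, b, c, d}" and TV: "T \<subseteq> {..<n}"
    using T unfolding squares_def by blast
  \<comment> \<open>Rotations of the 4-cycle bring each of its six pairs of vertices into standard
    position: two diagonals for \<open>th\<close> and four sides for \<open>ho\<close>.\<close>
  have sq2: "is_square E b c d a" "T = {b, c, d, a}" using sq is_square_rotate by auto
  have sq3: "is_square E c d a b" "T = {c, d, a, b}" using sq2 is_square_rotate by auto
  have sq4: "is_square E d a b c" "T = {d, a, b, c}" using sq3 is_square_rotate by auto
  show "u = v"
    using uv th[OF sq TV] th[OF sq2 TV] ho[OF sq TV] ho[OF sq2 TV] ho[OF sq3 TV] ho[OF sq4 TV]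
    unfolding sq(2) by blast
qed

section \<open>Sparse cuts and large connected parts\<close>

definition cut_edges :: "'a set \<Rightarrow> 'a set \<Rightarrow> 'a set set" where
  "cut_edges B Z = (\<lambda>(x, y). {x, y}) ` (Z \<times> (B - Z))"

lemma card_cut_edges:
  assumes "finite B" "Z \<subseteq> B" shows "card (cut_edges B Z) = card Z * (card B - card Z)"
proof -
  have "inj_on (\<lambda>(x, y). {x, y}) (Z \<times> (B - Z))" by (auto simp: inj_on_def doubleton_eq_iff)
  then have "card (cut_edges B Z) = card (Z \<times> (B - Z))" unfolding cut_edges_def by (rule card_image)
  then show ?thesis using assms by (simp add: card_cartesian_product card_Diff_subset finite_subset)
qed

definition mid_sets :: "'a set \<Rightarrow> 'a set set" where
  "mid_sets B = {Z. Z \<subseteq> B \<and> card B \<le> 3 * card Z \<and> 3 * card Z \<le> 2 * card B}"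

text \<open>Weaker than being connected fails: only cuts by sets between one third and two thirds of
  \<open>B\<close> count, because isolated vertices may well be present when \<open>p n\<close>
  grows slowly.\<close>

definition disconnected :: "'a set \<Rightarrow> 'a set set \<Rightarrow> bool" where
  "disconnected B E \<longleftrightarrow> (\<exists>Z\<in>mid_sets B. E \<inter> cut_edges B Z = {})"

lemma Pr_disconnected:
  assumes p: "0 \<le> p" "p \<le> 1" and B: "B \<subseteq> {..<n}" "n \<le> 2 * card B"
  shows "Pr (pairs n) p (disconnected B) \<le> 2 ^ n * exp (- p * (real n)\<^sup>2 / 18)"
proof -
  have fB: "finite B" using B by (auto intro: finite_subset)
  have fm: "finite (mid_sets B)" using fB unfolding mid_sets_def by simp
  have one: "Pr (pairs n) p (\<lambda>E. E \<inter> cut_edges B Z = {}) \<le> exp (- p * (real n)\<^sup>2 / 18)" if Z: "Z \<in> mid_sets B" for Z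
  proof -
    have ZB: "Z \<subseteq> B" "card B \<le> 3 * card Z" "3 * card Z \<le> 2 * card B" using Z by (auto simp: mid_sets_def)
    have le: "card Z \<le> card B" using card_mono[OF fB ZB(1)] .
    define z b where "z = real (card Z)" and "b = real (card B)"
    have zb: "b \<le> 3 * z" "3 * z \<le> 2 * b" "real n \<le> 2 * b" "0 \<le> b" using ZB B(2) unfolding z_def b_def by linarith+
    \<comment> \<open>Between b/3 and 2b/3 the product \<open>z * (b - z)\<close> is at least 2/9 of
      \<open>b^2\<close>. As \<open>b\<close> is at least n/2, the cut has at least
      \<open>n^2 / 18\<close> pairs, against at most \<open>2^n\<close> choices of the set.\<close>
    have "0 \<le> (3 * z - b) * (2 * b - 3 * z)" using zb by (intro mult_nonneg_nonneg) auto
    then have "2 * b\<^sup>2 \<le> 9 * (z * (b - z))" by (simp add: power2_eq_square algebra_simps)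
    moreover have "(real n)\<^sup>2 \<le> (2 * b)\<^sup>2" using zb by (intro power_mono) auto
    moreover have "real (card (cut_edges B Z)) = z * (b - z)"
      using card_cut_edges[OF fB ZB(1)] le by (simp add: z_def b_def of_nat_diff)
    ultimately have m: "(real n)\<^sup>2 / 18 \<le> real (card (cut_edges B Z))" by (simp add: power_mult_distrib)
    have "x < n" if "x \<in> B" for x using B(1) that by auto
    then have "cut_edges B Z \<subseteq> pairs n" using ZB(1) by (auto simp: cut_edges_def pairs_iff)
    then have "Pr (pairs n) p (\<lambda>E. E \<inter> cut_edges B Z = {}) = (1 - p) ^ card (cut_edges B Z)"
      by (intro Pr_disjoint[OF p]) auto
    also have "\<dots> \<le> exp (- p * real (card (cut_edges B Z)))" by (rule one_minus_power_le_exp[OF p])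
    also have "\<dots> \<le> exp (- p * (real n)\<^sup>2 / 18)" using mult_left_mono[OF m p(1)] by simp
    finally show ?thesis .
  qed
  have "Pr (pairs n) p (disconnected B) \<le> (\<Sum>Z\<in>mid_sets B. Pr (pairs n) p (\<lambda>E. E \<inter> cut_edges B Z = {}))"
    unfolding disconnected_def by (rule Pr_exists[OF p fm])
  also have "\<dots> \<le> (\<Sum>Z\<in>mid_sets B. exp (- p * (real n)\<^sup>2 / 18))" by (rule sum_mono[OF one])
  also have "\<dots> = real (card (mid_sets B)) * exp (- p * (real n)\<^sup>2 / 18)" by simp
  also have "\<dots> \<le> 2 ^ n * exp (- p * (real n)\<^sup>2 / 18)"
  proof (intro mult_right_mono)
    have "mid_sets B \<subseteq> Pow {..<n}" using B by (auto simp: mid_sets_def)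
    then have "card (mid_sets B) \<le> card (Pow {..<n})" by (rule card_mono[rotated]) simp
    then have "card (mid_sets B) \<le> 2 ^ n" by (simp add: card_Pow)
    then have "real (card (mid_sets B)) \<le> real (2 ^ n)" by (rule of_nat_mono)
    then show "real (card (mid_sets B)) \<le> 2 ^ n" by simp
  qed simp
  finally show ?thesis .
qed

text \<open>The closed sets are the unions of components of the graph induced on
  \<open>B\<close>.\<close>

definition closed_in :: "'a set \<Rightarrow> 'a set set \<Rightarrow> 'a set \<Rightarrow> bool" where
  "closed_in B E Z \<longleftrightarrow> Z \<subseteq> B \<and> (\<forall>x\<in>Z. \<forall>y\<in>B - Z. {x, y} \<notin> E)"

lemma closed_in_large:
  assumes nd: "\<not> disconnected B E" and Z: "closed_in B E Z" and c: "card B \<le> 3 * card Z"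
  shows "2 * card B < 3 * card Z"
proof (rule ccontr)
  assume "\<not> ?thesis"
  then have "Z \<in> mid_sets B" using Z c by (auto simp: mid_sets_def closed_in_def)
  moreover have "E \<inter> cut_edges B Z = {}" using Z by (auto simp: cut_edges_def closed_in_def)
  ultimately show False using nd by (auto simp: disconnected_def)
qed

lemma closed_component: "closed_in B E {y \<in> B. reachable {e \<in> E. e \<subseteq> B} x y}"
  unfolding closed_in_def
proof (intro conjI ballI)
  fix u v assume u: "u \<in> {y \<in> B. reachable {e \<in> E. e \<subseteq> B} x y}"
    and v: "v \<in> B - {y \<in> B. reachable {e \<in> E. e \<subseteq> B} x y}"
  show "{u, v} \<notin> E"
  proof
    assume "{u, v} \<in> E"
    moreover have "u \<noteq> v" using u v by auto
    ultimately have "adj {e \<in> E. e \<subseteq> B} u v" using u v by (auto simp: adj_def)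
    then have "reachable {e \<in> E. e \<subseteq> B} x v" 
      using u reachable_trans[OF _ reachable_adj] by auto
    then show False using v by auto
  qed
qed auto

text \<open>Closed sets have sizes below one third or above two thirds. Let \<open>Z\<close> be
  largest among the small ones. Adding the component \<open>K\<close> of a further vertex jumps over
  the gap, so \<open>K\<close> contributes more than one third by itself and hence has more than two
  thirds.\<close>

lemma large_connected_subset:
  assumes fB: "finite B" and B0: "B \<noteq> {}" and nd: "\<not> disconnected B E"
  shows "\<exists>K\<subseteq>B. 2 * card B < 3 * card K \<and> (\<forall>x\<in>K. \<forall>y\<in>K. reachable {e \<in> E. e \<subseteq> B} x y)"
proof -
  define P where "P Z \<longleftrightarrow> closed_in B E Z \<and> 3 * card Z < card B" for Z
  have "P {}" using fB B0 by (auto simp: P_def closed_in_def card_gt_0_iff)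
  moreover have "\<forall>Z. P Z \<longrightarrow> card Z < Suc (card B)" by (auto simp: P_def)
  ultimately obtain Z where Z: "P Z" "\<And>Z'. P Z' \<Longrightarrow> card Z' \<le> card Z"
    using ex_has_greatest_nat[of P "{}" card "Suc (card B)"] by blast
  have ZB: "Z \<subseteq> B" "closed_in B E Z" "3 * card Z < card B" using Z(1) by (auto simp: P_def closed_in_def)
  have fZ: "finite Z" using ZB fB finite_subset by blast
  have "\<not> B \<subseteq> Z" using ZB by (metis card_mono fZ leD le_trans mult_le_mono1 one_le_numeral mult_1)
  then obtain x where x: "x \<in> B" "x \<notin> Z" by auto
  define K where "K = {y \<in> B. reachable {e \<in> E. e \<subseteq> B} x y}"
  have K: "closed_in B E K" unfolding K_def by (rule closed_component)
  have KB: "K \<subseteq> B" "finite K" "x \<in> K" using x fB by (auto simp: K_def)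
  have "closed_in B E (Z \<union> K)" using K ZB(2) unfolding closed_in_def by blast
  moreover have "card Z < card (Z \<union> K)" using x KB fZ by (intro psubset_card_mono) auto
  ultimately have "card B \<le> 3 * card (Z \<union> K)" using Z(2)[of "Z \<union> K"] by (force simp: P_def)
  then have "2 * card B < 3 * card (Z \<union> K)" using closed_in_large[OF nd \<open>closed_in B E (Z \<union> K)\<close>] by simp
  moreover have "card (Z \<union> K) \<le> card Z + card K" by (rule card_Un_le)
  ultimately have "card B \<le> 3 * card K" using ZB(3) by linarith
  then have "2 * card B < 3 * card K" by (rule closed_in_large[OF nd K])
  moreover have "reachable {e \<in> E. e \<subseteq> B} y z" if "y \<in> K" "z \<in> K" for y z
    using that reachable_trans[OF reachable_sym] unfolding K_def by auto
  ultimately show ?thesis using KB by blast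
qed

section \<open>Existence of 4-cycles by the second moment\<close>

definition parts :: "nat \<Rightarrow> (nat \<times> nat \<times> nat \<times> nat) set" where
  "parts k = {..<k} \<times> {k..<2 * k} \<times> {2 * k..<3 * k} \<times> {3 * k..<4 * k}"

lemma card_parts: "card (parts k) = k ^ 4" "finite (parts k)"
  by (simp_all add: parts_def card_cartesian_product power_numeral_reduce)

lemma cycle_edges_parts:
  assumes "i \<in> parts k" "4 * k \<le> n"
  shows "cycle_edges i \<subseteq> pairs n \<and> card (cycle_edges i) = 4"
  using assms by (auto simp: parts_def cycle_edges_def pairs_iff doubleton_eq_iff)

text \<open>The four vertices come from four disjoint blocks, so an edge of one 4-cycle can coincide
  only with the edge of the other between the same blocks, and overlaps are counted side by
  side.\<close>

lemma card_cycle_edges_union: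
  assumes "(a, b, c, d) \<in> parts k" "(a', b', c', d') \<in> parts k"
  shows "card (cycle_edges (a, b, c, d) \<union> cycle_edges (a', b', c', d')) =
    (if a = a' \<and> b = b' then 1 else 2) + (if b = b' \<and> c = c' then 1 else 2) +
    (if c = c' \<and> d = d' then 1 else 2) + (if d = d' \<and> a = a' then 1 else 2)"
proof -
  have r: "a < k" "a' < k" "k \<le> b" "k \<le> b'" "b < 2 * k" "b' < 2 * k" "2 * k \<le> c" "2 * k \<le> c'"
    "c < 3 * k" "c' < 3 * k" "3 * k \<le> d" "3 * k \<le> d'"
    using assms by (auto simp: parts_def)
  define A1 A2 A3 A4 where "A1 = {{a, b}, {a', b'}}" and "A2 = {{b, c}, {b', c'}}"
    and "A3 = {{c, d}, {c', d'}}" and "A4 = {{d, a}, {d', a'}}"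
  have "cycle_edges (a, b, c, d) \<union> cycle_edges (a', b', c', d') = A1 \<union> A2 \<union> A3 \<union> A4"
    unfolding cycle_edges_def A1_def A2_def A3_def A4_def by auto
  moreover have "A1 \<inter> A2 = {}" "(A1 \<union> A2) \<inter> A3 = {}" "(A1 \<union> A2 \<union> A3) \<inter> A4 = {}"
    unfolding A1_def A2_def A3_def A4_def using r by (auto simp: doubleton_eq_iff)
  moreover have "finite A1" "finite A2" "finite A3" "finite A4"
    unfolding A1_def A2_def A3_def A4_def by auto
  ultimately have "card (cycle_edges (a, b, c, d) \<union> cycle_edges (a', b', c', d')) = card A1 + card A2 + card A3 + card A4"
    by (simp add: card_Un_disjoint)
  moreover have "card A1 = (if a = a' \<and> b = b' then 1 else 2)" "card A2 = (if b = b' \<and> c = c' then 1 else 2)"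
    "card A3 = (if c = c' \<and> d = d' then 1 else 2)" "card A4 = (if d = d' \<and> a = a' then 1 else 2)"
    unfolding A1_def A2_def A3_def A4_def using r by (auto simp: doubleton_eq_iff)
  ultimately show ?thesis by simp
qed

text \<open>\<open>x1\<close> to \<open>x4\<close> record which vertices of two 4-cycles agree. One
  common edge needs two neighbouring agreements, two common edges need three, and three common edges
  force the fourth; hence the powers 8, 7, 6 and 4.\<close>

lemma overlap_bound:
  fixes p :: real
  assumes "0 \<le> p"
  shows "p ^ ((if x1 \<and> x2 then 1 else 2) + (if x2 \<and> x3 then 1 else 2) + (if x3 \<and> x4 then 1 else 2) + (if x4 \<and> x1 then 1 else 2))
    \<le> p ^ 8 + p ^ 7 * (of_bool (x1 \<and> x2) + of_bool (x2 \<and> x3) + of_bool (x3 \<and> x4) + of_bool (x4 \<and> x1))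
      + p ^ 6 * (of_bool (x1 \<and> x2 \<and> x3) + of_bool (x2 \<and> x3 \<and> x4) + of_bool (x3 \<and> x4 \<and> x1) + of_bool (x4 \<and> x1 \<and> x2))
      + p ^ 4 * of_bool (x1 \<and> x2 \<and> x3 \<and> x4)"
proof -
  have "0 \<le> p ^ 8" "0 \<le> p ^ 7" "0 \<le> p ^ 6" "0 \<le> p ^ 4" using assms by simp_all
  moreover have "p * (p * (p * p)) = p ^ 4" "p * (p * (p * (p * (p * p)))) = p ^ 6"
    "p * (p * (p * (p * (p * (p * p))))) = p ^ 7"
    by (simp_all add: power_numeral_reduce)
  ultimately show ?thesis by (cases x1; cases x2; cases x3; cases x4; simp; linarith)
qed

lemma sum_of_bool_le:
  assumes "finite I" "finite S" "{j \<in> I. P j} \<subseteq> S" "card S \<le> m"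
  shows "(\<Sum>j\<in>I. of_bool (P j)) \<le> real m"
proof -
  have "(\<Sum>j\<in>I. of_bool (P j)) = real (card {j \<in> I. P j})"
    using assms(1) by (simp add: of_bool_def sum.If_cases Int_def)
  also have "\<dots> \<le> real m" using card_mono[OF assms(2,3)] assms(4) by simp
  finally show ?thesis .
qed

text \<open>Given a 4-cycle, the pairs with one, two or four common edges contribute at most
  \<open>4 k^2 p^7\<close>, \<open>4 k p^6\<close> and \<open>p^4\<close>. With \<open>k p\<close>
  at least 1, \<open>k^3 p^7\<close> dominates each of these nine terms, and this is a fraction
  \<open>1 / (k p)\<close> of the main term \<open>k^4 p^8\<close>.\<close>

lemma Pr_no_square:
  assumes p: "0 < p" "p \<le> 1" and k: "4 * k \<le> n" "1 \<le> real k * p"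
  shows "Pr (pairs n) p (\<lambda>E. \<not> (\<exists>i\<in>parts k. cycle_edges i \<subseteq> E)) \<le> 9 / (real k * p)"
proof (rule Pr_second_moment[where k = 4])
  show "0 \<le> p" "p \<le> 1" using p by auto
  show "finite (pairs n)" "finite (parts k)" by (simp_all add: card_parts)
  show "cycle_edges i \<subseteq> pairs n \<and> card (cycle_edges i) = 4" if "i \<in> parts k" for i using cycle_edges_parts[OF that k(1)] .
  show "real k ^ 4 * p ^ 4 = real (card (parts k)) * p ^ 4" by (simp add: card_parts)
  have k0: "0 < real k" "1 \<le> real k" using k(2) p(1) by (cases "k = 0"; simp)+
  then show "0 < real k ^ 4 * p ^ 4" using p by simp
  define K where "K = real k"
  have row: "(\<Sum>j\<in>parts k. p ^ card (cycle_edges i \<union> cycle_edges j)) \<le> K ^ 4 * p ^ 8 + 9 * (K ^ 3 * p ^ 7)" if i: "i \<in> parts k" for i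
  proof -
    obtain a b c d where abcd: "i = (a, b, c, d)" by (metis prod.exhaust)
    note ip = i[unfolded abcd]
    define x1 x2 x3 x4 where "x1 j = (case j of (a', b', c', d') \<Rightarrow> a = a')" and "x2 j = (case j of (a', b', c', d') \<Rightarrow> b = b')"
      and "x3 j = (case j of (a', b', c', d') \<Rightarrow> c = c')" and "x4 j = (case j of (a', b', c', d') \<Rightarrow> d = d')" for j
    define S where "S Q = (\<Sum>j\<in>parts k. of_bool (Q j) :: real)" for Q
    have "p ^ card (cycle_edges i \<union> cycle_edges j)
      \<le> p ^ 8 + p ^ 7 * (of_bool (x1 j \<and> x2 j) + of_bool (x2 j \<and> x3 j) + of_bool (x3 j \<and> x4 j) + of_bool (x4 j \<and> x1 j))
      + p ^ 6 * (of_bool (x1 j \<and> x2 j \<and> x3 j) + of_bool (x2 j \<and> x3 j \<and> x4 j) + of_bool (x3 j \<and> x4 j \<and> x1 j) + of_bool (x4 j \<and> x1 j \<and> x2 j))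
      + p ^ 4 * of_bool (x1 j \<and> x2 j \<and> x3 j \<and> x4 j)" if j: "j \<in> parts k" for j
    proof -
      obtain a' b' c' d' where j': "j = (a', b', c', d')" by (metis prod.exhaust)
      show ?thesis
        using overlap_bound[of p "x1 j" "x2 j" "x3 j" "x4 j"] card_cycle_edges_union[OF ip j[unfolded j']] p(1)
        unfolding abcd j' x1_def x2_def x3_def x4_def by simp
    qed
    then have "(\<Sum>j\<in>parts k. p ^ card (cycle_edges i \<union> cycle_edges j)) \<le> (\<Sum>j\<in>parts k.
      p ^ 8 + p ^ 7 * (of_bool (x1 j \<and> x2 j) + of_bool (x2 j \<and> x3 j) + of_bool (x3 j \<and> x4 j) + of_bool (x4 j \<and> x1 j))
      + p ^ 6 * (of_bool (x1 j \<and> x2 j \<and> x3 j) + of_bool (x2 j \<and> x3 j \<and> x4 j) + of_bool (x3 j \<and> x4 j \<and> x1 j) + of_bool (x4 j \<and> x1 j \<and> x2 j))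
      + p ^ 4 * of_bool (x1 j \<and> x2 j \<and> x3 j \<and> x4 j))" by (rule sum_mono)
    also have "\<dots> = real (card (parts k)) * p ^ 8 + p ^ 7 * (S (\<lambda>j. x1 j \<and> x2 j) + S (\<lambda>j. x2 j \<and> x3 j) + S (\<lambda>j. x3 j \<and> x4 j) + S (\<lambda>j. x4 j \<and> x1 j))
      + p ^ 6 * (S (\<lambda>j. x1 j \<and> x2 j \<and> x3 j) + S (\<lambda>j. x2 j \<and> x3 j \<and> x4 j) + S (\<lambda>j. x3 j \<and> x4 j \<and> x1 j) + S (\<lambda>j. x4 j \<and> x1 j \<and> x2 j))
      + p ^ 4 * S (\<lambda>j. x1 j \<and> x2 j \<and> x3 j \<and> x4 j)"
      unfolding S_def by (simp add: sum.distrib sum_distrib_left distrib_left)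
    also have "\<dots> \<le> real (card (parts k)) * p ^ 8 + p ^ 7 * (real (k ^ 2) + real (k ^ 2) + real (k ^ 2) + real (k ^ 2))
      + p ^ 6 * (real k + real k + real k + real k) + p ^ 4 * real 1"
    proof -
      note L = sum_of_bool_le[OF card_parts(2)]
      have 2: "S (\<lambda>j. x1 j \<and> x2 j) \<le> real (k ^ 2)" unfolding S_def
        by (rule L[of "{a} \<times> {b} \<times> {2 * k..<3 * k} \<times> {3 * k..<4 * k}"])
          (auto simp: x1_def x2_def parts_def card_cartesian_product power2_eq_square)
      have 3: "S (\<lambda>j. x2 j \<and> x3 j) \<le> real (k ^ 2)" unfolding S_def
        by (rule L[of "{..<k} \<times> {b} \<times> {c} \<times> {3 * k..<4 * k}"])
          (auto simp: x2_def x3_def parts_def card_cartesian_product power2_eq_square)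
      have 4: "S (\<lambda>j. x3 j \<and> x4 j) \<le> real (k ^ 2)" unfolding S_def
        by (rule L[of "{..<k} \<times> {k..<2 * k} \<times> {c} \<times> {d}"])
          (auto simp: x3_def x4_def parts_def card_cartesian_product power2_eq_square)
      have 5: "S (\<lambda>j. x4 j \<and> x1 j) \<le> real (k ^ 2)" unfolding S_def
        by (rule L[of "{a} \<times> {k..<2 * k} \<times> {2 * k..<3 * k} \<times> {d}"])
          (auto simp: x4_def x1_def parts_def card_cartesian_product power2_eq_square)
      have 6: "S (\<lambda>j. x1 j \<and> x2 j \<and> x3 j) \<le> real k" unfolding S_def
        by (rule L[of "{a} \<times> {b} \<times> {c} \<times> {3 * k..<4 * k}"])
          (auto simp: x1_def x2_def x3_def parts_def card_cartesian_product)
      have 7: "S (\<lambda>j. x2 j \<and> x3 j \<and> x4 j) \<le> real k" unfolding S_def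
        by (rule L[of "{..<k} \<times> {b} \<times> {c} \<times> {d}"])
          (auto simp: x4_def x2_def x3_def parts_def card_cartesian_product)
      have 8: "S (\<lambda>j. x3 j \<and> x4 j \<and> x1 j) \<le> real k" unfolding S_def
        by (rule L[of "{a} \<times> {k..<2 * k} \<times> {c} \<times> {d}"])
          (auto simp: x1_def x4_def x3_def parts_def card_cartesian_product)
      have 9: "S (\<lambda>j. x4 j \<and> x1 j \<and> x2 j) \<le> real k" unfolding S_def
        by (rule L[of "{a} \<times> {b} \<times> {2 * k..<3 * k} \<times> {d}"])
          (auto simp: x1_def x2_def x4_def parts_def card_cartesian_product)
      have 10: "S (\<lambda>j. x1 j \<and> x2 j \<and> x3 j \<and> x4 j) \<le> real 1" unfolding S_def
        by (rule L[of "{(a, b, c, d)}"]) (auto simp: x1_def x2_def x3_def x4_def)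
      show ?thesis using p(1) by (intro add_mono mult_left_mono order_refl 2 3 4 5 6 7 8 9 10) auto
    qed
    also have "\<dots> = K ^ 4 * p ^ 8 + (4 * (K ^ 2 * p ^ 7) + 4 * (K * p ^ 6) + p ^ 4)"
      by (simp add: K_def card_parts algebra_simps)
    also have "\<dots> \<le> K ^ 4 * p ^ 8 + 9 * (K ^ 3 * p ^ 7)"
    proof -
      have Kp: "1 \<le> K * p" "1 \<le> K" using k(2) k0 by (auto simp: K_def)
      have "K ^ 2 * p ^ 7 * 1 \<le> K ^ 2 * p ^ 7 * K" using Kp p by (intro mult_left_mono) auto
      then have 1: "K ^ 2 * p ^ 7 \<le> K ^ 3 * p ^ 7" by (simp add: power_numeral_reduce algebra_simps)
      have "1 * 1 \<le> K * (K * p)" using Kp by (intro mult_mono) auto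
      then have "K * p ^ 6 * 1 \<le> K * p ^ 6 * (K * (K * p))" using Kp p by (intro mult_left_mono) auto
      then have 2: "K * p ^ 6 \<le> K ^ 3 * p ^ 7" by (simp add: power_numeral_reduce algebra_simps)
      have "1 \<le> (K * p) ^ 3" using Kp(1) by (rule one_le_power)
      then have "p ^ 4 * 1 \<le> p ^ 4 * (K * p) ^ 3" using p by (intro mult_left_mono) auto
      then have 3: "p ^ 4 \<le> K ^ 3 * p ^ 7" by (simp add: power_mult_distrib power_numeral_reduce algebra_simps)
      show ?thesis using 1 2 3 by linarith
    qed
    finally show ?thesis .
  qed
  have "(\<Sum>i\<in>parts k. \<Sum>j\<in>parts k. p ^ card (cycle_edges i \<union> cycle_edges j)) \<le> (\<Sum>i\<in>parts k. K ^ 4 * p ^ 8 + 9 * (K ^ 3 * p ^ 7))"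
    by (rule sum_mono[OF row])
  also have "\<dots> = K ^ 4 * (K ^ 4 * p ^ 8 + 9 * (K ^ 3 * p ^ 7))" by (simp add: card_parts K_def)
  also have "\<dots> = (K ^ 4 * p ^ 4)\<^sup>2 + 9 / (K * p) * (K ^ 4 * p ^ 4)\<^sup>2"
    using k0 p by (simp add: K_def field_simps power_numeral_reduce)
  finally show "(\<Sum>i\<in>parts k. \<Sum>j\<in>parts k. p ^ card (cycle_edges i \<union> cycle_edges j))
      \<le> (real k ^ 4 * p ^ 4)\<^sup>2 + 9 / (real k * p) * (real k ^ 4 * p ^ 4)\<^sup>2" by (simp add: K_def)
qed

section \<open>Joining a 4-cycle to the giant component\<close>

lemma reachable_mono:
  assumes "E \<subseteq> E'" "reachable E x y" shows "reachable E' x y"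
proof -
  obtain n where "(adj E ^^ n) x y" using assms(2) by (auto simp: reachable_iff)
  then show ?thesis
  proof (induction n arbitrary: y)
    case (Suc n)
    then obtain z where z: "(adj E ^^ n) x z" "adj E z y" by auto
    then have "adj E' z y" using assms(1) by (auto simp: adj_def)
    then show ?case by (rule reachable_trans[OF Suc.IH[OF z(1)] reachable_adj])
  qed auto
qed

lemma reachable_exit:
  assumes "reachable E x z" "x \<in> T" "z \<notin> T"
  shows "\<exists>u\<in>T. \<exists>v. v \<notin> T \<and> adj E u v"
proof -
  obtain n where "(adj E ^^ n) x z" using assms(1) by (auto simp: reachable_iff)
  then show ?thesis using assms(3)
  proof (induction n arbitrary: z)
    case (Suc n)
    then obtain w where w: "(adj E ^^ n) x w" "adj E w z" by auto
    then show ?case using Suc.IH[OF w(1)] Suc.prems(2) by (cases "w \<in> T") auto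
  qed (use assms(2) in auto)
qed

text \<open>The square is sought in {..<4k}; it has to be joined to a large connected part of the remaining vertices.\<close>

definition inner_pairs :: "nat \<Rightarrow> nat \<Rightarrow> nat set set" where
  "inner_pairs n k = {e \<in> pairs n. e \<subseteq> {..<4 * k} \<or> e \<subseteq> {4 * k..<n}}"

definition big_part :: "nat \<Rightarrow> nat \<Rightarrow> nat set set \<Rightarrow> nat set \<Rightarrow> bool" where
  "big_part n k E K \<longleftrightarrow> K \<subseteq> {4 * k..<n} \<and> 2 * (n - 4 * k) < 3 * card K \<and> (\<forall>x\<in>K. \<forall>y\<in>K. reachable E x y)"

definition chosen_square :: "nat \<Rightarrow> nat set set \<Rightarrow> nat \<times> nat \<times> nat \<times> nat" where
  "chosen_square k E = (SOME i. i \<in> parts k \<and> cycle_edges i \<subseteq> E)"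

definition chosen_part :: "nat \<Rightarrow> nat \<Rightarrow> nat set set \<Rightarrow> nat set" where
  "chosen_part n k E = (SOME K. big_part n k E K)"

definition joinable :: "nat \<Rightarrow> nat \<Rightarrow> nat set set \<Rightarrow> bool" where
  "joinable n k E \<longleftrightarrow> (\<exists>i\<in>parts k. cycle_edges i \<subseteq> E) \<and> (\<exists>K. big_part n k E K)"

definition joining_edges :: "nat \<Rightarrow> nat \<Rightarrow> nat set set \<Rightarrow> nat set set" where
  "joining_edges n k E = (\<lambda>y. {fst (chosen_square k E), y}) ` chosen_part n k E"

text \<open>The 4-cycle and the large part are chosen from the inner edges alone, which makes the
  joining edges independent of the choice.\<close>

definition unjoined :: "nat \<Rightarrow> nat \<Rightarrow> nat set set \<Rightarrow> bool" where
  "unjoined n k E \<longleftrightarrow> joinable n k (E \<inter> inner_pairs n k) \<and> E \<inter> joining_edges n k (E \<inter> inner_pairs n k) = {}"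

lemma joinable_chosen:
  assumes "joinable n k E"
  shows "chosen_square k E \<in> parts k" "cycle_edges (chosen_square k E) \<subseteq> E" "big_part n k E (chosen_part n k E)"
proof -
  obtain i where "i \<in> parts k \<and> cycle_edges i \<subseteq> E" using assms by (auto simp: joinable_def)
  then show "chosen_square k E \<in> parts k" "cycle_edges (chosen_square k E) \<subseteq> E"
    unfolding chosen_square_def by (metis (mono_tags, lifting) someI)+
  show "big_part n k E (chosen_part n k E)"
    unfolding chosen_part_def by (rule someI_ex) (use assms in \<open>simp add: joinable_def\<close>)
qed

lemma Pr_unjoined:
  assumes p: "0 \<le> p" "p \<le> 1" and k: "8 * k \<le> n"
  shows "Pr (pairs n) p (unjoined n k) \<le> exp (- p * real n / 3)"
proof -
  have U: "pairs n = inner_pairs n k \<union> (pairs n - inner_pairs n k)" by (auto simp: inner_pairs_def)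
  have "Pr (inner_pairs n k \<union> (pairs n - inner_pairs n k)) p (unjoined n k) \<le> exp (- p * real n / 3)"
    unfolding unjoined_def
  proof (rule Pr_two_step[OF p])
    fix E assume "joinable n k E"
    note ch = joinable_chosen[OF this]
    define a where "a = fst (chosen_square k E)"
    define K where "K = chosen_part n k E"
    have a: "a < k" using ch(1) by (auto simp: parts_def a_def)
    have K: "K \<subseteq> {4 * k..<n}" "2 * (n - 4 * k) < 3 * card K" using ch(3) by (auto simp: big_part_def K_def)
    have J: "joining_edges n k E = (\<lambda>y. {a, y}) ` K" by (simp add: joining_edges_def a_def K_def)
    have "inj_on (\<lambda>y. {a, y}) K" by (auto simp: inj_on_def doubleton_eq_iff)
    then have "card (joining_edges n k E) = card K" unfolding J by (rule card_image)
    \<comment> \<open>At least half of the vertices lie outside \<open>{..<4 * k}\<close>, and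
      \<open>K\<close> has more than two thirds of those.\<close>
    moreover have "n \<le> 3 * card K" using K(2) k by linarith
    ultimately have c: "real n / 3 \<le> real (card (joining_edges n k E))" by linarith
    have "joining_edges n k E \<subseteq> pairs n - inner_pairs n k"
      unfolding J using a K(1) k by (auto simp: pairs_iff inner_pairs_def)
    moreover have "(1 - p) ^ card (joining_edges n k E) \<le> exp (- p * real (card (joining_edges n k E)))"
      by (rule one_minus_power_le_exp[OF p])
    moreover have "exp (- p * real (card (joining_edges n k E))) \<le> exp (- p * real n / 3)"
      using mult_left_mono[OF c p(1)] by simp
    ultimately show "joining_edges n k E \<subseteq> pairs n - inner_pairs n k \<and>
      (1 - p) ^ card (joining_edges n k E) \<le> exp (- p * real n / 3)" by linarith
  qed (auto simp: inner_pairs_def)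
  then show ?thesis using U by simp
qed

text \<open>Through a joining edge, the component of the chosen 4-cycle contains the large part and
  thus at least one third of all vertices. Absence of sparse cuts raises this to more than two
  thirds, so no other component can be larger.\<close>

lemma giant_contains_square:
  assumes E: "E \<subseteq> pairs n" and n: "12 \<le> n" "8 * k \<le> n"
    and nd: "\<not> disconnected {..<n} E" "\<not> disconnected {4 * k..<n} E"
    and sq: "\<exists>i\<in>parts k. cycle_edges i \<subseteq> E" and nu: "\<not> unjoined n k E"
  shows "\<exists>C\<in>components {..<n} E. (\<forall>C'\<in>components {..<n} E. card C' \<le> card C) \<and> 4 < card C \<and> C \<subseteq> {..<n} \<and>
    (\<exists>T\<in>squares C E. \<exists>t\<in>T. \<exists>v\<in>{..<n} - T. adj E v t)"
proof -
  define E1 where "E1 = E \<inter> inner_pairs n k"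
  have "joinable n k E1"
    unfolding joinable_def
  proof
    obtain i where i: "i \<in> parts k" "cycle_edges i \<subseteq> E" using sq by auto
    have "e \<subseteq> {..<4 * k}" if "e \<in> cycle_edges i" for e using that i(1) by (auto simp: cycle_edges_def parts_def)
    then have "cycle_edges i \<subseteq> E1" using i(2) E by (auto simp: E1_def inner_pairs_def)
    then show "\<exists>i\<in>parts k. cycle_edges i \<subseteq> E1" using i by auto
    have "{4 * k..<n} \<noteq> {}" using n by auto
    then obtain K where K: "K \<subseteq> {4 * k..<n}" "2 * card {4 * k..<n} < 3 * card K"
      "\<forall>x\<in>K. \<forall>y\<in>K. reachable {e \<in> E. e \<subseteq> {4 * k..<n}} x y"
      using large_connected_subset[OF _ _ nd(2)] by auto
    have "{e \<in> E. e \<subseteq> {4 * k..<n}} \<subseteq> E1" using E by (auto simp: E1_def inner_pairs_def)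
    then have "big_part n k E1 K" using K(1,2) K(3) reachable_mono[of _ E1] unfolding big_part_def by simp
    then show "\<exists>K. big_part n k E1 K" by blast
  qed
  note ch = joinable_chosen[OF this]
  obtain a b c d where abcd: "chosen_square k E1 = (a, b, c, d)" by (metis prod.exhaust)
  define K where "K = chosen_part n k E1"
  have "E \<inter> joining_edges n k E1 \<noteq> {}" using nu \<open>joinable n k E1\<close> by (auto simp: unjoined_def E1_def)
  then obtain y where y: "y \<in> K" "{a, y} \<in> E" by (auto simp: joining_edges_def abcd K_def)
  have K: "K \<subseteq> {4 * k..<n}" "2 * (n - 4 * k) < 3 * card K" "\<And>x y. x \<in> K \<Longrightarrow> y \<in> K \<Longrightarrow> reachable E x y"
    using ch(3) reachable_mono[of E1 E] by (auto simp: big_part_def K_def E1_def)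
  have pt: "(a, b, c, d) \<in> parts k" using ch(1) abcd by simp
  then have "distinct [a, b, c, d]" and less: "{a, b, c, d} \<subseteq> {..<n}" using n by (auto simp: parts_def)
  then have isq: "is_square E a b c d" using is_square_cycle_edges[OF E] ch(2) abcd by (auto simp: E1_def)
  define T where "T = {a, b, c, d}"
  define C where "C = {z \<in> {..<n}. reachable E a z}"
  have aV: "a < n" using less by auto
  have "adj E a y" using y E by (simp add: adj_pairs[OF E])
  then have "K \<subseteq> C" using reachable_trans[OF reachable_adj K(3)[OF y(1)]] K(1) by (auto simp: C_def)
  then have KC: "card K \<le> card C" by (intro card_mono) (auto simp: C_def)
  have "adj E a b" "adj E b c" "adj E a d" using isq adj_sym[of E a d] by (auto simp: is_square_def)
  then have TC: "T \<subseteq> C"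
    using less reachable_trans[OF reachable_adj[of E a b] reachable_adj[of E b c]] reachable_adj[of E]
    by (auto simp: T_def C_def)
  have comp: "C \<in> components {..<n} E" unfolding components_def C_def using aV by blast
  have "{e \<in> E. e \<subseteq> {..<n}} = E" using E pairs_form by force
  then have "closed_in {..<n} E C" using closed_component[of "{..<n}" E a] by (simp add: C_def)
  moreover have "card {..<n} \<le> 3 * card C" using K(2) KC n(2) by simp
  ultimately have big: "2 * n < 3 * card C" using closed_in_large[OF nd(1)] by simp
  have "card C' \<le> card C" if C': "C' \<in> components {..<n} E" for C'
  proof -
    obtain x where x: "x < n" "C' = {z \<in> {..<n}. reachable E x z}" using C' by (auto simp: components_def)
    show ?thesis
    proof (cases "reachable E a x")
      case True
      then have "C' \<subseteq> C" using x reachable_trans by (auto simp: C_def)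
      then show ?thesis by (intro card_mono) (auto simp: C_def)
    next
      case False
      then have "C' \<inter> C = {}" using x reachable_trans reachable_sym by (fastforce simp: C_def)
      then have "card C' + card C = card (C' \<union> C)" using x by (subst card_Un_disjoint) (auto simp: C_def)
      also have "\<dots> \<le> card {..<n}" using x by (intro card_mono) (auto simp: C_def)
      finally show ?thesis using big by simp
    qed
  qed
  moreover have c4: "4 < card C" using big n(1) by linarith
  moreover have "T \<in> squares C E" using TC isq unfolding squares_def T_def by blast
  \<comment> \<open>The component is larger than the 4-cycle; a walk leaving the 4-cycle yields the
    neighbour that prevents its subgroup from being a free factor.\<close>
  moreover have "\<exists>t\<in>T. \<exists>v\<in>{..<n} - T. adj E v t"
  proof -
    have "card T \<le> 4" unfolding T_def by (simp add: card_insert_if)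
    then have "\<not> C \<subseteq> T" using card_mono[of T C] c4 by (auto simp: T_def)
    then obtain z where "z \<in> C" "z \<notin> T" by auto
    then obtain u v where "u \<in> T" "v \<notin> T" "adj E u v"
      using reachable_exit[of E a z T] by (auto simp: C_def T_def)
    then show ?thesis using adj_pairs_less[OF E] adj_sym[of E] by blast
  qed
  moreover have "C \<subseteq> {..<n}" by (auto simp: C_def)
  ultimately show ?thesis by (intro bexI[OF _ comp] conjI) blast+
qed

section \<open>Typical graphs and the limit\<close>

definition typical :: "nat \<Rightarrow> nat set set \<Rightarrow> bool" where
  "typical n E \<longleftrightarrow> E \<subseteq> pairs n \<and> sparse_graph {..<n} E \<and>
    (\<exists>C\<in>components {..<n} E. (\<forall>C'\<in>components {..<n} E. card C' \<le> card C) \<and> 4 < card C \<and> C \<subseteq> {..<n} \<and>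
      (\<exists>T\<in>squares C E. \<exists>t\<in>T. \<exists>v\<in>{..<n} - T. adj E v t))"

lemma exp_minus_le: "0 < (x::real) \<Longrightarrow> exp (- x) \<le> 1 / x"
proof -
  assume "0 < x"
  moreover have "x \<le> exp x" using exp_ge_add_one_self[of x] by linarith
  ultimately show ?thesis by (simp add: exp_minus field_simps)
qed

text \<open>Each forbidden subgraph costs \<open>n^5 p^6\<close> and each of the two cut conditions
  1/n. With \<open>k = n div 8\<close> one has \<open>n \<le> 16 * k\<close>, so the bound
  \<open>9 / (k p)\<close> for 4-cycles becomes \<open>144 / (p n)\<close>; the failure to join adds
  \<open>3 / (p n)\<close>.\<close>

lemma Pr_typical:
  assumes p: "0 \<le> p" "p \<le> 1" and n: "12 \<le> n" and np: "36 \<le> p * real n"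
  shows "1 - (3 * (p ^ 6 * real n ^ 5) + 2 / real n + 147 / (p * real n)) \<le> Pr (pairs n) p (typical n)"
proof -
  define k where "k = n div 8"
  have k: "8 * k \<le> n" "n \<le> 16 * k" using n unfolding k_def by presburger+
  have p0: "0 < p" using np p(1) by (cases "p = 0") auto
  have n0: "0 < real n" using n by simp
  have kp: "p * real n \<le> 16 * (real k * p)" using k(2) p(1) mult_left_mono[of "real n" "16 * real k" p] by (simp add: algebra_simps)
  let ?bad = "\<lambda>E. chorded n E \<or> theta_graph n E \<or> house_graph n E \<or> disconnected {..<n} E \<or>
     disconnected {4 * k..<n} E \<or> \<not> (\<exists>i\<in>parts k. cycle_edges i \<subseteq> E) \<or> unjoined n k E"
  have "Pr (pairs n) p (\<lambda>E. \<not> typical n E) \<le> Pr (pairs n) p ?bad"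
  proof (rule Pr_mono[OF p])
    fix E assume E: "E \<subseteq> pairs n" and nt: "\<not> typical n E"
    show "?bad E"
    proof (rule ccontr)
      assume nb: "\<not> ?bad E"
      then have "sparse_graph {..<n} E" by (intro sparse_graphI[OF E]) simp_all
      moreover have "\<exists>C\<in>components {..<n} E. (\<forall>C'\<in>components {..<n} E. card C' \<le> card C) \<and> 4 < card C \<and> C \<subseteq> {..<n} \<and>
        (\<exists>T\<in>squares C E. \<exists>t\<in>T. \<exists>v\<in>{..<n} - T. adj E v t)"
        using nb by (intro giant_contains_square[OF E n k(1)]) simp_all
      ultimately show False using nt E unfolding typical_def by simp
    qed
  qed
  also have "\<dots> \<le> Pr (pairs n) p (chorded n) + (Pr (pairs n) p (theta_graph n) + (Pr (pairs n) p (house_graph n)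
     + (Pr (pairs n) p (disconnected {..<n}) + (Pr (pairs n) p (disconnected {4 * k..<n})
     + (Pr (pairs n) p (\<lambda>E. \<not> (\<exists>i\<in>parts k. cycle_edges i \<subseteq> E)) + Pr (pairs n) p (unjoined n k))))))"
    by (intro order_trans[OF Pr_disj[OF p]] add_left_mono order_refl)
  also have "\<dots> \<le> p ^ 6 * real n ^ 5 + (p ^ 6 * real n ^ 5 + (p ^ 6 * real n ^ 5
     + (1 / real n + (1 / real n + (144 / (p * real n) + 3 / (p * real n))))))"
  proof (intro add_mono)
    have "Pr (pairs n) p (chorded n) \<le> real (n ^ 4) * p ^ 5" by (rule Pr_chorded[OF p])
    also have "\<dots> \<le> real (n ^ 4) * p ^ 5 * (p * real n)"
      using np p mult_left_mono[of 1 "p * real n" "real (n ^ 4) * p ^ 5"] by simp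
    also have "\<dots> = p ^ 6 * real n ^ 5" by (simp add: power_numeral_reduce algebra_simps)
    finally show "Pr (pairs n) p (chorded n) \<le> p ^ 6 * real n ^ 5" .
    show "Pr (pairs n) p (theta_graph n) \<le> p ^ 6 * real n ^ 5" using Pr_theta[OF p, of n] by (simp add: mult.commute)
    show "Pr (pairs n) p (house_graph n) \<le> p ^ 6 * real n ^ 5" using Pr_house[OF p, of n] by (simp add: mult.commute)
    have dis: "2 ^ n * exp (- p * (real n)\<^sup>2 / 18) \<le> 1 / real n"
    proof -
      have "(2::real) ^ n \<le> exp 1 ^ n" using exp_ge_add_one_self[of 1] by (intro power_mono) auto
      also have "\<dots> = exp (real n)" by (simp add: exp_of_nat_mult[symmetric])
      finally have "2 ^ n * exp (- p * (real n)\<^sup>2 / 18) \<le> exp (real n) * exp (- p * (real n)\<^sup>2 / 18)"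
        by (intro mult_right_mono) auto
      also have "\<dots> = exp (real n + - p * (real n)\<^sup>2 / 18)" by (rule exp_add[symmetric])
      \<comment> \<open>The bound 36 on \<open>p n\<close> makes the exponent
        \<open>p n^2 / 18\<close> at least 2n, twice what is needed to beat the number of
        sets.\<close>
      also have "\<dots> \<le> exp (- real n)"
        using mult_right_mono[OF np, of "real n"] by (simp add: power2_eq_square algebra_simps)
      also have "\<dots> \<le> 1 / real n" by (rule exp_minus_le[OF n0])
      finally show ?thesis .
    qed
    show "Pr (pairs n) p (disconnected {..<n}) \<le> 1 / real n"
      using Pr_disconnected[OF p, of "{..<n}" n] dis by simp
    have "{4 * k..<n} \<subseteq> {..<n}" "n \<le> 2 * card {4 * k..<n}" using k(1) by auto
    from order_trans[OF Pr_disconnected[OF p this] dis]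
    show "Pr (pairs n) p (disconnected {4 * k..<n}) \<le> 1 / real n" .
    have "1 \<le> real k * p" using kp np by linarith
    then have "Pr (pairs n) p (\<lambda>E. \<not> (\<exists>i\<in>parts k. cycle_edges i \<subseteq> E)) \<le> 9 / (real k * p)"
      using k(1) by (intro Pr_no_square[OF p0 p(2)]) auto
    also have "\<dots> \<le> 144 / (p * real n)" using kp np \<open>1 \<le> real k * p\<close> p0 n0 by (simp add: field_simps)
    finally show "Pr (pairs n) p (\<lambda>E. \<not> (\<exists>i\<in>parts k. cycle_edges i \<subseteq> E)) \<le> 144 / (p * real n)" .
    have "Pr (pairs n) p (unjoined n k) \<le> exp (- (p * real n / 3))" using Pr_unjoined[OF p k(1)] by simp
    also have "\<dots> \<le> 1 / (p * real n / 3)" using np by (intro exp_minus_le) simp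
    finally show "Pr (pairs n) p (unjoined n k) \<le> 3 / (p * real n)" by simp
  qed
  also have "\<dots> = 3 * (p ^ 6 * real n ^ 5) + 2 / real n + 147 / (p * real n)"
    by (simp add: add_divide_distrib[symmetric])
  finally show ?thesis using Pr_compl[OF p finite_pairs, of n "typical n"] by linarith
qed

lemma typical_tendsto:
  fixes p :: "nat \<Rightarrow> real"
  assumes p_prob: "\<forall>n. 0 \<le> p n \<and> p n \<le> 1"
    and p_lower: "filterlim (\<lambda>n. p n * real n) at_top sequentially"
    and p_upper: "(\<lambda>n. p n ^ 6 * real n ^ 5) \<longlonglongrightarrow> 0"
    and Q: "\<And>n E. typical n E \<Longrightarrow> Q n E"
  shows "(\<lambda>n. gnp_prob n (p n) (Q n)) \<longlonglongrightarrow> 1"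
proof (rule tendsto_sandwich)
  have "(\<lambda>n. 1 - (3 * (p n ^ 6 * real n ^ 5) + 2 / real n + 147 / (p n * real n))) \<longlonglongrightarrow> 1 - (3 * 0 + 0 + 0)"
    by (intro tendsto_intros p_upper tendsto_divide_0[OF tendsto_const] filterlim_at_top_imp_at_infinity
        filterlim_real_sequentially p_lower)
  then show "(\<lambda>n. 1 - (3 * (p n ^ 6 * real n ^ 5) + 2 / real n + 147 / (p n * real n))) \<longlonglongrightarrow> 1" by simp
  have "\<forall>\<^sub>F n in sequentially. 36 \<le> p n * real n" using p_lower by (simp add: filterlim_at_top)
  then show "\<forall>\<^sub>F n in sequentially. 1 - (3 * (p n ^ 6 * real n ^ 5) + 2 / real n + 147 / (p n * real n)) \<le> gnp_prob n (p n) (Q n)"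
    using eventually_ge_at_top[of 12]
  proof eventually_elim
    case (elim n)
    have p: "0 \<le> p n" "p n \<le> 1" using p_prob by auto
    have "Pr (pairs n) (p n) (typical n) \<le> Pr (pairs n) (p n) (Q n)" using Q by (intro Pr_mono[OF p])
    then show ?case using Pr_typical[OF p elim(2,1)] by (simp add: gnp_prob_Pr)
  qed
  show "\<forall>\<^sub>F n in sequentially. gnp_prob n (p n) (Q n) \<le> 1"
    using Pr_le_1[OF _ _ finite_pairs] p_prob by (simp add: gnp_prob_Pr)
qed simp

lemma typical_giant:
  assumes "typical n E"
  shows "\<exists>C \<in> components {..<n} E. (\<forall>C' \<in> components {..<n} E. card C' \<le> card C) \<and>
    (\<exists>\<P>. rel_hyp_DD (special_subgroup {..<n} E C) \<P>)"
proof -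
  obtain C T where C: "C \<in> components {..<n} E" "\<forall>C'\<in>components {..<n} E. card C' \<le> card C" "4 < card C"
    "C \<subseteq> {..<n}" "T \<in> squares C E" and sp: "sparse_graph {..<n} E"
    using assms unfolding typical_def by blast
  have "\<exists>\<P>. rel_hyp_DD (special_subgroup {..<n} E C) \<P>"
    by (rule special_rel_hyp_DD[OF finite_lessThan C(4) sp _ C(3)]) (use C(5) in blast)
  then show ?thesis using C by blast
qed

lemma typical_full:
  assumes "typical n E"
  shows "\<exists>\<P>. rel_hyp_DD (RACG {..<n} E) \<P> \<and> (\<exists>P \<in> \<P>. \<not> proper_free_factor (RACG {..<n} E) P)"
proof -
  obtain C T t v where C: "4 < card C" "C \<subseteq> {..<n}" "T \<in> squares C E" "t \<in> T" "v \<in> {..<n} - T" "adj E v t"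
    and sp: "sparse_graph {..<n} E"
    using assms unfolding typical_def by blast
  have "T \<in> squares {..<n} E" using C(3) squares_mono[OF C(2)] by blast
  moreover have "4 < card {..<n}" using C(1) card_mono[OF _ C(2)] by simp
  ultimately show ?thesis using RACG_rel_hyp_DD[OF finite_lessThan sp _ _ C(4-6)] by blast
qed

theorem theorem3p5:
  fixes p :: "nat \<Rightarrow> real"
  assumes p_prob: "\<forall>n. 0 \<le> p n \<and> p n \<le> 1"
    and p_lower: "filterlim (\<lambda>n. p n * real n) at_top sequentially"
    and p_upper: "(\<lambda>n. p n ^ 6 * real n ^ 5) \<longlonglongrightarrow> 0"
  shows "(\<lambda>n. gnp_prob n (p n) (\<lambda>E.
            \<exists>C \<in> components {..<n} E.
              (\<forall>C' \<in> components {..<n} E. card C' \<le> card C) \<and>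
              (\<exists>\<P>. rel_hyp_DD (special_subgroup {..<n} E C) \<P>)))
           \<longlonglongrightarrow> 1
       \<and> (\<lambda>n. gnp_prob n (p n) (\<lambda>E.
            \<exists>\<P>. rel_hyp_DD (RACG {..<n} E) \<P> \<and>
                 (\<exists>P \<in> \<P>. \<not> proper_free_factor (RACG {..<n} E) P)))
           \<longlonglongrightarrow> 1"
proof
  show "(\<lambda>n. gnp_prob n (p n) (\<lambda>E.
            \<exists>C \<in> components {..<n} E.
              (\<forall>C' \<in> components {..<n} E. card C' \<le> card C) \<and>
              (\<exists>\<P>. rel_hyp_DD (special_subgroup {..<n} E C) \<P>)))
           \<longlonglongrightarrow> 1"
    by (rule typical_tendsto[OF assms typical_giant])
  show "(\<lambda>n. gnp_prob n (p n) (\<lambda>E.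
            \<exists>\<P>. rel_hyp_DD (RACG {..<n} E) \<P> \<and>
                 (\<exists>P \<in> \<P>. \<not> proper_free_factor (RACG {..<n} E) P)))
           \<longlonglongrightarrow> 1"
    by (rule typical_tendsto[OF assms typical_full])
qed

end
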